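(* $(\mathrm{2CVC}_{3},m_{ver})\equiv^{\mathrm{sL}}_{m}(\mathrm{2CVC}_{3},m_{edg})\equiv^{\mathrm{sL}}_{m}(\mathrm{2SAT}_{3},m_{vbl})$; that is, each of these three parameterized decision problems is short $\mathrm{L}$-m-reducible to each of the others.
   Context: A parameterized decision problem is a pair $(A,m)$ with $A$ a language and $m$ a log-space computable size parameter mapping inputs to positive integers. $(P_1,m_1)\leq^{\mathrm{sL}}_{m}(P_2,m_2)$ means there exist a function $f$ computable deterministically in polynomial time using logarithmic work space and constants $k_1,k_2>0$ such that for every input $x$: $x\in P_1$ iff $f(x)\in P_2$, and $m_2(f(x))\leq k_1m_1(x)+k_2$. $\equiv^{\mathrm{sL}}_{m}$ means reducibility in both directions. In an undirected graph $G=(V,E)$, an edge is a grip if both of its endpoints have degree at most $2$. A subset $V'\subseteq V$ is a vertex cover if every edge has at least one endpoint in $V'$; it is 2-checkered if every edge with both endpoints in $V'$ is a grip. $\mathrm{2CVC}_3$: given an undirected graph $G$ in which every vertex has degree at most $3$, does $G$ have a 2-checkered vertex cover? Size parameters: $m_{ver}(G)=|V|$, $m_{edg}(G)=|E|$. $\mathrm{2SAT}_3$: given a 2CNF Boolean formula $\phi$ in which every variable occurs at most $3$ times in total in the form of literals, is $\phi$ satisfiable? Size parameter: $m_{vbl}(\phi)$ = number of distinct variables of $\phi$. *)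

theory Defs
  imports Complex_Main
begin

section \<open>Logarithmic-space transducers\<close>

text \<open>
  Deterministic Turing machines with a two-way read-only input tape, a fixed number of
  read/write work tapes and a write-only output tape.  Alphabets of inputs and outputs are
  finite types; states and work symbols are initial segments of the naturals.  The initial
  state and the blank work symbol are both 0.  The input is written between two end markers.
  Work tapes are infinite to the right only.  The machine halts when the transition function
  returns None; each step may append one symbol to the output.
\<close>

datatype dir = Leftwards | Stay | Rightwards

datatype 'a cell = LeftEnd | Symbol 'a | RightEnd

record ('a, 'b) transducer =
  num_tapes :: nat
  num_states :: nat
  num_symbols :: nat
  delta :: "nat \<Rightarrow> 'a cell \<Rightarrow> nat list \<Rightarrow> (nat \<times> dir \<times> (nat \<times> dir) list \<times> 'b option) option"

text \<open>
  Only the values of the transition function on legal states and on legal tuples of work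
  symbols matter, so for a finite input alphabet a transducer is a finite object.
\<close>

definition wf_transducer :: "('a, 'b) transducer \<Rightarrow> bool" where
  "wf_transducer M \<longleftrightarrow> 0 < num_states M \<and> 0 < num_symbols M \<and>
     (\<forall>q a ss q' d acts e.
        q < num_states M \<longrightarrow> length ss = num_tapes M \<longrightarrow> set ss \<subseteq> {..<num_symbols M} \<longrightarrow>
        delta M q a ss = Some (q', d, acts, e) \<longrightarrow>
        q' < num_states M \<and> length acts = num_tapes M \<and> fst ` set acts \<subseteq> {..<num_symbols M})"

record 'b config =
  state :: nat
  input_pos :: nat
  work :: "((nat \<Rightarrow> nat) \<times> nat) list"  \<comment> \<open>contents and head position of each work tape\<close>
  out_word :: "'b list"

fun move :: "dir \<Rightarrow> nat \<Rightarrow> nat" where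
  "move Leftwards p = p - 1"
| "move Stay p = p"
| "move Rightwards p = p + 1"

text \<open>The symbols of the input occupy positions 1 to its length.\<close>

definition read_input :: "'a list \<Rightarrow> nat \<Rightarrow> 'a cell" where
  "read_input x p = (if p = 0 then LeftEnd
                     else if p \<le> length x then Symbol (x ! (p - 1)) else RightEnd)"

definition init_config :: "('a, 'b) transducer \<Rightarrow> 'b config" where
  "init_config M = \<lparr>state = 0, input_pos = 0, work = replicate (num_tapes M) (\<lambda>_. 0, 0), out_word = []\<rparr>"

definition step :: "('a, 'b) transducer \<Rightarrow> 'a list \<Rightarrow> 'b config \<Rightarrow> 'b config option" where
  "step M x c =
     (case delta M (state c) (read_input x (input_pos c)) (map (\<lambda>(t, h). t h) (work c)) of
        None \<Rightarrow> None
      | Some (q, d, acts, e) \<Rightarrow> Some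
          \<lparr>state = q,
           input_pos = min (move d (input_pos c)) (length x + 1),
           work = map2 (\<lambda>(t, h) (s, d'). (t(h := s), move d' h)) (work c) acts,
           out_word = out_word c @ (case e of None \<Rightarrow> [] | Some b \<Rightarrow> [b])\<rparr>)"

primrec run :: "('a, 'b) transducer \<Rightarrow> 'a list \<Rightarrow> nat \<Rightarrow> 'b config option" where
  "run M x 0 = Some (init_config M)"
| "run M x (Suc t) = Option.bind (run M x t) (step M x)"

definition halts_with :: "('a, 'b) transducer \<Rightarrow> 'a list \<Rightarrow> nat \<Rightarrow> 'b list \<Rightarrow> bool" where
  "halts_with M x t y \<longleftrightarrow> (\<exists>c. run M x t = Some c \<and> step M x c = None \<and> out_word c = y)"

text \<open>
  Heads start in cell 0 and move by at most one cell per step, so a bound on the head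
  positions bounds the number of visited cells.  Input and output tapes are not charged.
\<close>

definition work_space_le :: "('a, 'b) transducer \<Rightarrow> 'a list \<Rightarrow> real \<Rightarrow> bool" where
  "work_space_le M x s \<longleftrightarrow>
     (\<forall>t c. run M x t = Some c \<longrightarrow> (\<forall>(_, h) \<in> set (work c). real (h + 1) \<le> s))"

definition logspace_polytime_computable :: "('a::finite list \<Rightarrow> 'b::finite list) \<Rightarrow> bool" where
  "logspace_polytime_computable f \<longleftrightarrow>
     (\<exists>(M :: ('a, 'b) transducer) (a :: nat) (d :: nat) (b :: real). wf_transducer M \<and>
        (\<forall>x. (\<exists>t \<le> a * (length x + 1) ^ d. halts_with M x t (f x)) \<and>
             work_space_le M x (b * log 2 (real (length x) + 2))))"


section \<open>Parameterized decision problems and short reductions\<close>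

type_synonym 'a param_problem = "'a list set \<times> ('a list \<Rightarrow> nat)"

definition sL_reducible :: "'a::finite param_problem \<Rightarrow> 'b::finite param_problem \<Rightarrow> bool"
    (infix "\<le>\<^sub>s\<^sub>L" 50) where
  "P \<le>\<^sub>s\<^sub>L Q \<longleftrightarrow>
     (\<exists>f (k1 :: real) (k2 :: real). logspace_polytime_computable f \<and> k1 > 0 \<and> k2 > 0 \<and>
        (\<forall>x. (x \<in> fst P \<longleftrightarrow> f x \<in> fst Q) \<and>
             real (snd Q (f x)) \<le> k1 * real (snd P x) + k2))"

definition sL_equivalent :: "'a::finite param_problem \<Rightarrow> 'b::finite param_problem \<Rightarrow> bool"
    (infix "\<equiv>\<^sub>s\<^sub>L" 50) where
  "P \<equiv>\<^sub>s\<^sub>L Q \<longleftrightarrow> P \<le>\<^sub>s\<^sub>L Q \<and> Q \<le>\<^sub>s\<^sub>L P"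


section \<open>2-checkered vertex covers\<close>

definition ugraph :: "'v set \<Rightarrow> 'v set set \<Rightarrow> bool" where
  "ugraph V E \<longleftrightarrow> finite V \<and> (\<forall>e\<in>E. e \<subseteq> V \<and> card e = 2)"

definition degree :: "'v set set \<Rightarrow> 'v \<Rightarrow> nat" where
  "degree E v = card {e \<in> E. v \<in> e}"

definition grip :: "'v set set \<Rightarrow> 'v set \<Rightarrow> bool" where
  "grip E e \<longleftrightarrow> e \<in> E \<and> (\<forall>v\<in>e. degree E v \<le> 2)"

definition vertex_cover :: "'v set \<Rightarrow> 'v set set \<Rightarrow> 'v set \<Rightarrow> bool" where
  "vertex_cover V E C \<longleftrightarrow> C \<subseteq> V \<and> (\<forall>e\<in>E. \<exists>v\<in>e. v \<in> C)"

definition two_checkered :: "'v set set \<Rightarrow> 'v set \<Rightarrow> bool" where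
  "two_checkered E C \<longleftrightarrow> (\<forall>e\<in>E. e \<subseteq> C \<longrightarrow> grip E e)"

text \<open>
  Instances are written as words: vertices are named by bit strings, and a graph is written by
  listing every vertex once and then every edge once, in any order and orientation.
\<close>

datatype gsym = GBit bool | GVertex | GEdge | GSep

instance gsym :: finite
proof
  have "(UNIV :: gsym set) = range GBit \<union> {GVertex, GEdge, GSep}"
  proof (rule set_eqI)
    fix a :: gsym show "a \<in> UNIV \<longleftrightarrow> a \<in> range GBit \<union> {GVertex, GEdge, GSep}"
      by (cases a) auto
  qed
  then show "finite (UNIV :: gsym set)"
    by (rule ssubst) simp
qed

type_synonym name = "bool list"

definition vertex_word :: "name \<Rightarrow> gsym list" where
  "vertex_word v = GVertex # map GBit v"

definition edge_word :: "name \<times> name \<Rightarrow> gsym list" where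
  "edge_word e = GEdge # map GBit (fst e) @ GSep # map GBit (snd e)"

definition graph_word :: "name list \<Rightarrow> (name \<times> name) list \<Rightarrow> gsym list" where
  "graph_word vs es = concat (map vertex_word vs) @ concat (map edge_word es)"

definition encodes_graph :: "gsym list \<Rightarrow> name set \<Rightarrow> name set set \<Rightarrow> bool" where
  "encodes_graph w V E \<longleftrightarrow> ugraph V E \<and>
     (\<exists>vs es. w = graph_word vs es \<and> distinct vs \<and> set vs = V \<and>
        distinct (map (\<lambda>(u, v). {u, v}) es) \<and> (\<lambda>(u, v). {u, v}) ` set es = E)"

definition TwoCVC3 :: "gsym list set" where
  "TwoCVC3 = {w. \<exists>V E. encodes_graph w V E \<and> (\<forall>v\<in>V. degree E v \<le> 3) \<and>
     (\<exists>C. vertex_cover V E C \<and> two_checkered E C)}"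

text \<open>
  A word encodes at most one graph (proved below).  Words that encode no graph are outside the
  language and have size 1.
\<close>

definition m_ver :: "gsym list \<Rightarrow> nat" where
  "m_ver w = (if \<exists>V E. encodes_graph w V E
              then (THE n. \<exists>V E. encodes_graph w V E \<and> n = card V) else 1)"

definition m_edg :: "gsym list \<Rightarrow> nat" where
  "m_edg w = (if \<exists>V E. encodes_graph w V E
              then (THE n. \<exists>V E. encodes_graph w V E \<and> n = card E) else 1)"


section \<open>2-satisfiability\<close>

datatype 'x literal = Pos 'x | Neg 'x

fun var_of :: "'x literal \<Rightarrow> 'x" where
  "var_of (Pos x) = x"
| "var_of (Neg x) = x"

fun lit_true :: "('x \<Rightarrow> bool) \<Rightarrow> 'x literal \<Rightarrow> bool" where
  "lit_true \<sigma> (Pos x) \<longleftrightarrow> \<sigma> x"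
| "lit_true \<sigma> (Neg x) \<longleftrightarrow> \<not> \<sigma> x"

text \<open>Formulas are lists of clauses and clauses lists of literals, so that occurrences of
  variables are counted with multiplicity.\<close>

type_synonym 'x cnf = "'x literal list list"

definition two_cnf :: "'x cnf \<Rightarrow> bool" where
  "two_cnf \<phi> \<longleftrightarrow> (\<forall>c \<in> set \<phi>. c \<noteq> [] \<and> length c \<le> 2)"

definition cnf_vars :: "'x cnf \<Rightarrow> 'x set" where
  "cnf_vars \<phi> = var_of ` set (concat \<phi>)"

definition occurrences :: "'x cnf \<Rightarrow> 'x \<Rightarrow> nat" where
  "occurrences \<phi> x = length (filter (\<lambda>l. var_of l = x) (concat \<phi>))"

definition satisfiable :: "'x cnf \<Rightarrow> bool" where
  "satisfiable \<phi> \<longleftrightarrow> (\<exists>\<sigma>. \<forall>c \<in> set \<phi>. \<exists>l \<in> set c. lit_true \<sigma> l)"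

datatype fsym = FBit bool | FPos | FNeg | FClause

instance fsym :: finite
proof
  have "(UNIV :: fsym set) = range FBit \<union> {FPos, FNeg, FClause}"
  proof (rule set_eqI)
    fix a :: fsym show "a \<in> UNIV \<longleftrightarrow> a \<in> range FBit \<union> {FPos, FNeg, FClause}"
      by (cases a) auto
  qed
  then show "finite (UNIV :: fsym set)"
    by (rule ssubst) simp
qed

fun literal_word :: "name literal \<Rightarrow> fsym list" where
  "literal_word (Pos x) = FPos # map FBit x"
| "literal_word (Neg x) = FNeg # map FBit x"

definition clause_word :: "name literal list \<Rightarrow> fsym list" where
  "clause_word c = FClause # concat (map literal_word c)"

definition cnf_word :: "name cnf \<Rightarrow> fsym list" where
  "cnf_word \<phi> = concat (map clause_word \<phi>)"

definition encodes_2cnf :: "fsym list \<Rightarrow> name cnf \<Rightarrow> bool" where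
  "encodes_2cnf w \<phi> \<longleftrightarrow> two_cnf \<phi> \<and> w = cnf_word \<phi>"

definition TwoSAT3 :: "fsym list set" where
  "TwoSAT3 = {w. \<exists>\<phi>. encodes_2cnf w \<phi> \<and> (\<forall>x. occurrences \<phi> x \<le> 3) \<and> satisfiable \<phi>}"

definition m_vbl :: "fsym list \<Rightarrow> nat" where
  "m_vbl w = (if \<exists>\<phi>. encodes_2cnf w \<phi> then card (cnf_vars (THE \<phi>. encodes_2cnf w \<phi>)) else 1)"


section \<open>Unambiguity of the encodings\<close>

lemma bits_append_eqD:
  assumes "map f u @ r = map f u' @ r'" and "inj f"
    and "r = [] \<or> hd r \<notin> range f" and "r' = [] \<or> hd r' \<notin> range f"
  shows "u = u' \<and> r = r'"
  using assms(1)
proof (induction u arbitrary: u')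
  case Nil
  then show ?case using assms(3) by (cases u') auto
next
  case (Cons a u)
  then show ?case using assms(2,4) by (cases u') (auto simp: inj_eq)
qed

lemma edges_word_start:
  "concat (map edge_word es) = [] \<or> hd (concat (map edge_word es)) = GEdge"
  by (cases es) (auto simp: edge_word_def)

lemma graph_word_start:
  "graph_word vs es = [] \<or> hd (graph_word vs es) \<in> {GVertex, GEdge}"
  using edges_word_start[of es] by (cases vs) (auto simp: graph_word_def vertex_word_def)

lemma edges_word_inj:
  "concat (map edge_word es) = concat (map edge_word es') \<Longrightarrow> es = es'"
proof (induction es arbitrary: es')
  case Nil
  then show ?case by (cases es') (auto simp: edge_word_def)
next
  case (Cons e es)
  then obtain e' fs where es': "es' = e' # fs"
    by (cases es') (auto simp: edge_word_def)
  have inj: "inj GBit" by (auto intro: injI)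
  let ?r = "\<lambda>e es. GSep # map GBit (snd e) @ concat (map edge_word es)"
  have "map GBit (fst e) @ ?r e es = map GBit (fst e') @ ?r e' fs"
    using Cons.prems es' by (simp add: edge_word_def[of e] edge_word_def[of e'])
  then have 1: "fst e = fst e'" "?r e es = ?r e' fs"
    using bits_append_eqD[OF _ inj, of "fst e" "?r e es" "fst e'" "?r e' fs"] by auto
  then have "map GBit (snd e) @ concat (map edge_word es)
      = map GBit (snd e') @ concat (map edge_word fs)" by simp
  then have "snd e = snd e' \<and> concat (map edge_word es) = concat (map edge_word fs)"
    by (rule bits_append_eqD[OF _ inj]) (use edges_word_start in fastforce)+
  then show ?case using Cons.IH 1 es' by (simp add: prod_eq_iff)
qed

lemma graph_word_inj:
  "graph_word vs es = graph_word vs' es' \<Longrightarrow> vs = vs' \<and> es = es'"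
proof (induction vs arbitrary: vs')
  case Nil
  then show ?case
  proof (cases vs')
    case Nil
    then show ?thesis using Nil.prems edges_word_inj \<open>graph_word [] es = graph_word vs' es'\<close>
      by (auto simp: graph_word_def)
  next
    case (Cons v ws)
    then show ?thesis using \<open>graph_word [] es = graph_word vs' es'\<close> edges_word_start[of es]
      by (auto simp: graph_word_def vertex_word_def)
  qed
next
  case (Cons v vs)
  obtain v' ws where vs': "vs' = v' # ws"
    using Cons.prems edges_word_start[of es']
    by (cases vs') (auto simp: graph_word_def vertex_word_def simp del: concat_eq_Nil_conv dest: arg_cong[where f = hd])
  have inj: "inj GBit" by (auto intro: injI)
  have "map GBit v @ graph_word vs es = map GBit v' @ graph_word ws es'"
    using Cons.prems vs' by (simp add: graph_word_def vertex_word_def)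
  then have "v = v' \<and> graph_word vs es = graph_word ws es'"
    by (rule bits_append_eqD[OF _ inj]) (use graph_word_start in fastforce)+
  then show ?case using Cons.IH vs' by blast
qed

lemma encodes_graph_unique:
  "encodes_graph w V E \<Longrightarrow> encodes_graph w V' E' \<Longrightarrow> V = V' \<and> E = E'"
  unfolding encodes_graph_def using graph_word_inj by metis

lemma m_ver_eq: "encodes_graph w V E \<Longrightarrow> m_ver w = card V"
  unfolding m_ver_def by (auto intro!: the_equality dest: encodes_graph_unique)

lemma m_edg_eq: "encodes_graph w V E \<Longrightarrow> m_edg w = card E"
  unfolding m_edg_def by (auto intro!: the_equality dest: encodes_graph_unique)

lemma literals_word_inj:
  assumes "concat (map literal_word c) @ r = concat (map literal_word c') @ r'"
    and "r = [] \<or> hd r = FClause" and "r' = [] \<or> hd r' = FClause"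
  shows "c = c' \<and> r = r'"
  using assms(1)
proof (induction c arbitrary: c')
  case Nil
  then show ?case using assms(2) by (cases c'; cases "hd c'") auto
next
  case (Cons l c)
  then obtain l' d where c': "c' = l' # d"
    using assms(3) by (cases c'; cases l) auto
  have inj: "inj FBit" by (auto intro: injI)
  have start: "concat (map literal_word c) @ s = [] \<or>
      hd (concat (map literal_word c) @ s) \<notin> range FBit" if "s = [] \<or> hd s = FClause" for c s
    using that by (cases c; cases "hd c") auto
  have "map FBit (var_of l) @ concat (map literal_word c) @ r
      = map FBit (var_of l') @ concat (map literal_word d) @ r'"
    using Cons.prems c' by (cases l; cases l') auto
  then have "var_of l = var_of l' \<and>
      concat (map literal_word c) @ r = concat (map literal_word d) @ r'"
    by (rule bits_append_eqD[OF _ inj]) (use start assms(2,3) in auto)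
  then show ?case using Cons.IH Cons.prems c' by (cases l; cases l') auto
qed

lemma cnf_word_inj: "cnf_word \<phi> = cnf_word \<psi> \<Longrightarrow> \<phi> = \<psi>"
proof (induction \<phi> arbitrary: \<psi>)
  case Nil
  then show ?case by (cases \<psi>) (auto simp: cnf_word_def clause_word_def)
next
  case (Cons c \<phi>)
  obtain c' \<psi>' where \<psi>: "\<psi> = c' # \<psi>'"
    using Cons.prems by (cases \<psi>) (auto simp: cnf_word_def clause_word_def)
  have start: "cnf_word \<chi> = [] \<or> hd (cnf_word \<chi>) = FClause" for \<chi>
    by (cases \<chi>) (auto simp: cnf_word_def clause_word_def)
  have "concat (map literal_word c) @ cnf_word \<phi> = concat (map literal_word c') @ cnf_word \<psi>'"
    using Cons.prems \<psi> by (simp add: cnf_word_def clause_word_def)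
  then have "c = c' \<and> cnf_word \<phi> = cnf_word \<psi>'"
    by (rule literals_word_inj) (rule start)+
  then show ?case using Cons.IH \<psi> by blast
qed

lemma m_vbl_eq: "encodes_2cnf w \<phi> \<Longrightarrow> m_vbl w = card (cnf_vars \<phi>)"
  unfolding m_vbl_def encodes_2cnf_def using cnf_word_inj
  by (metis (mono_tags, lifting) the_equality)

end

theory Submission
  imports Defs
begin

text \<open>
  A counter program moves the input head, increments and decrements counters bounded by the length
  of the input plus one, and tests counters for zero and the scanned input symbol.  A transducer that
  keeps every counter in binary on its own work tape simulates such a program in logarithmic space,
  and a terminating run is polynomially long since no configuration occurs twice.  A word over one of
  the two alphabets is a list of tokens, each a marker with a name; first-order queries on tokens (order,
  marker, equality of names) and nested loops that print copies of names are counter programs.  All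
  reductions have this form.

  Dropping isolated vertices relates the two size parameters of a graph of maximum degree 3.  For the
  reduction to satisfiability, every vertex becomes six equivalent variables, two for each incident
  edge; an edge that is not a grip says that its ends have opposite values, and a grip is a
  disjunction.  Conversely, edges at vertices of degree 3 force alternation, so that a ring of such
  vertices carries the value of a variable, and the clauses are grips between leaves of the rings.
\<close>

section \<open>Counter programs\<close>

text \<open>A short reduction must keep its size bound on every word, including words that encode
  nothing and words that encode a graph or formula violating the bound 3. So each of the three
  printers first decides whether its input is admissible and maps all other inputs to one fixed word
  of size 1 outside the target language; this is why the syntax has to be expressible by queries,
  and it explains the additive constant 1.

  The division into layers has a price reason: a counter program only needs a proof that it
  terminates with the right output, since time and space follow once and for all from the
  simulation.

  The numbers in the constructions come from the bound 3. Equality of copies is enforced by a cycle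
  of implications, which consumes two of the three permitted occurrences of each copy and leaves
  one, so every use needs its own copy: three incident edges with up to two clauses each give six.
  In the other direction a variable has three occurrences, each of either polarity, and a unit
  clause needs two leaves because loops are forbidden: 3 times 2 times 2 gives twelve
  leaves.\<close>

datatype 'b instr = GoLeft | GoRight | Inc nat | Dec nat | Emit 'b

datatype 'a test = Head "'a cell set" | NonZero nat

datatype ('a, 'b) com =
    Skip
  | Do "'b instr"
  | Seq "('a, 'b) com" "('a, 'b) com"  (infixr ";;" 60)
  | Cond "'a test" "('a, 'b) com" "('a, 'b) com"
  | Loop "'a test" "('a, 'b) com"

section \<open>Head normal forms and residual programs\<close>

datatype ('a, 'b) flow =
    Halt
  | Act "'b instr" "('a, 'b) com"
  | Branch "'a test" "('a, 'b) com" "('a, 'b) com"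

text \<open>The next visible action together with what remains afterwards. A finished first
  component of a sequence is skipped silently, so every counted step is an instruction or a
  test.\<close>

fun node :: "('a, 'b) com \<Rightarrow> ('a, 'b) flow" where
  "node Skip = Halt"
| "node (Do a) = Act a Skip"
| "node (c ;; d) = (case node c of Halt \<Rightarrow> node d
     | Act a c' \<Rightarrow> Act a (c' ;; d)
     | Branch b c1 c2 \<Rightarrow> Branch b (c1 ;; d) (c2 ;; d))"
| "node (Cond b c d) = Branch b c d"
| "node (Loop b c) = Branch b (c ;; Loop b c) Skip"

text \<open>A finite over-approximation of the programs that can remain during a run, similar to
  partial derivatives of regular expressions. It becomes the finite control of the transducer;
  residuals of a loop body carry the loop behind them, so unrolling produces nothing new.\<close>

fun residuals :: "('a, 'b) com \<Rightarrow> ('a, 'b) com set" where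
  "residuals Skip = {Skip}"
| "residuals (Do a) = {Do a, Skip}"
| "residuals (c ;; d) = (\<lambda>r. r ;; d) ` residuals c \<union> residuals d"
| "residuals (Cond b c d) = insert (Cond b c d) (residuals c \<union> residuals d)"
| "residuals (Loop b c) = {Loop b c, Skip} \<union> (\<lambda>r. r ;; Loop b c) ` residuals c"

lemma finite_residuals: "finite (residuals c)"
  by (induction c) auto

lemma residuals_self: "c \<in> residuals c"
  by (induction c) auto

fun successors :: "('a, 'b) flow \<Rightarrow> ('a, 'b) com set" where
  "successors Halt = {}"
| "successors (Act a c) = {c}"
| "successors (Branch b c d) = {c, d}"

lemma successors_Seq:
  "successors (node (c ;; d)) \<subseteq> (\<lambda>r. r ;; d) ` successors (node c) \<union> successors (node d)"
  by (cases "node c") auto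

lemma residuals_closed: "r \<in> residuals c \<Longrightarrow> successors (node r) \<subseteq> residuals c"
proof (induction c arbitrary: r)
  case (Seq c d)
  then consider "r \<in> residuals d" | r0 where "r = r0 ;; d" "r0 \<in> residuals c" by auto
  then show ?case
  proof cases
    case 1
    then show ?thesis using Seq.IH(2) by auto
  next
    case 2
    then show ?thesis
      using successors_Seq[of r0 d] Seq.IH(1)[OF 2(2)] Seq.IH(2)[OF residuals_self]
      unfolding 2(1) residuals.simps by blast
  qed
next
  case (Cond b c d)
  then consider "r = Cond b c d" | "r \<in> residuals c" | "r \<in> residuals d" by auto
  then show ?case
  proof cases
    case 1
    then show ?thesis using residuals_self[of c] residuals_self[of d] by simp
  next
    case 2
    then show ?thesis using Cond.IH(1) by auto
  next
    case 3
    then show ?thesis using Cond.IH(2) by auto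
  qed
next
  case (Loop b c)
  then consider "r = Loop b c" | "r = Skip" | r0 where "r = r0 ;; Loop b c" "r0 \<in> residuals c"
    by auto
  then show ?case
  proof cases
    case 1
    then show ?thesis using residuals_self[of c] by simp
  next
    case 2
    then show ?thesis by simp
  next
    case 3
    then show ?thesis
      using successors_Seq[of r0 "Loop b c"] Loop.IH[OF 3(2)] residuals_self[of c]
      unfolding 3(1) residuals.simps by (simp only: node.simps successors.simps) blast
  qed
qed auto

fun counters_instr :: "'b instr \<Rightarrow> nat set" where
  "counters_instr (Inc i) = {i}"
| "counters_instr (Dec i) = {i}"
| "counters_instr _ = {}"

fun counters_test :: "'a test \<Rightarrow> nat set" where
  "counters_test (NonZero i) = {i}"
| "counters_test (Head A) = {}"

fun counters :: "('a, 'b) com \<Rightarrow> nat set" where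
  "counters Skip = {}"
| "counters (Do a) = counters_instr a"
| "counters (c ;; d) = counters c \<union> counters d"
| "counters (Cond b c d) = counters_test b \<union> counters c \<union> counters d"
| "counters (Loop b c) = counters_test b \<union> counters c"

lemma finite_counters: "finite (counters c)"
proof -
  have "finite (counters_instr a)" for a :: "'b instr" by (cases a) auto
  moreover have "finite (counters_test a)" for a :: "'a test" by (cases a) auto
  ultimately show ?thesis by (induction c) auto
qed

lemma counters_residuals: "r \<in> residuals c \<Longrightarrow> counters r \<subseteq> counters c"
proof (induction c arbitrary: r)
  case (Seq c d)
  then consider "r \<in> residuals d" | r0 where "r = r0 ;; d" "r0 \<in> residuals c" by auto
  then show ?case by cases (use Seq.IH in auto)
next
  case (Cond b c d)
  then consider "r = Cond b c d" | "r \<in> residuals c" | "r \<in> residuals d" by auto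
  then show ?case by cases (use Cond.IH in auto)
next
  case (Loop b c)
  then consider "r = Loop b c" | "r = Skip" | r0 where "r = r0 ;; Loop b c" "r0 \<in> residuals c"
    by auto
  then show ?case by cases (use Loop.IH in auto)
qed auto

fun counters_node :: "('a, 'b) flow \<Rightarrow> nat set" where
  "counters_node Halt = {}"
| "counters_node (Act a c) = counters_instr a"
| "counters_node (Branch b c d) = counters_test b"

lemma counters_node: "counters_node (node c) \<subseteq> counters c"
proof (induction c)
  case (Seq c d)
  then show ?case by (cases "node c") auto
qed auto

type_synonym 'b store = "nat \<times> (nat \<Rightarrow> nat) \<times> 'b list"

text \<open>Overflow above \<open>length x + 1\<close> and decrementing 0 are undefined. A
  derivation of \<open>ends\<close> therefore contains the proof that all counters stay within the
  range for which logarithmic space suffices.\<close>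

fun perform :: "'a list \<Rightarrow> 'b instr \<Rightarrow> 'b store \<Rightarrow> 'b store option" where
  "perform x GoLeft (h, s, w) = Some (h - 1, s, w)"
| "perform x GoRight (h, s, w) = Some (min (h + 1) (length x + 1), s, w)"
| "perform x (Inc i) (h, s, w) = (if s i \<le> length x then Some (h, s(i := s i + 1), w) else None)"
| "perform x (Dec i) (h, s, w) = (if 0 < s i then Some (h, s(i := s i - 1), w) else None)"
| "perform x (Emit b) (h, s, w) = Some (h, s, w @ [b])"

fun holds :: "'a list \<Rightarrow> 'a test \<Rightarrow> 'b store \<Rightarrow> bool" where
  "holds x (Head A) (h, s, w) \<longleftrightarrow> read_input x h \<in> A"
| "holds x (NonZero i) (h, s, w) \<longleftrightarrow> s i \<noteq> 0"

inductive ends :: "'a list \<Rightarrow> ('a, 'b) com \<Rightarrow> 'b store \<Rightarrow> nat \<Rightarrow> 'b store \<Rightarrow> bool" for x where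
  halt: "node c = Halt \<Longrightarrow> ends x c st 0 st"
| act: "node c = Act a c' \<Longrightarrow> perform x a st = Some st1 \<Longrightarrow> ends x c' st1 t st2 \<Longrightarrow>
    ends x c st (Suc t) st2"
| branch: "node c = Branch b c1 c2 \<Longrightarrow> ends x (if holds x b st then c1 else c2) st t st2 \<Longrightarrow>
    ends x c st (Suc t) st2"

lemma ends_cases:
  assumes "ends x c st t st2"
  obtains "node c = Halt" "t = 0" "st2 = st"
  | a c' st1 t' where "node c = Act a c'" "perform x a st = Some st1" "ends x c' st1 t' st2" "t = Suc t'"
  | b c1 c2 t' where "node c = Branch b c1 c2" "ends x (if holds x b st then c1 else c2) st t' st2"
      "t = Suc t'"
  using assms by (cases rule: ends.cases) auto

text \<open>Execution is deterministic and never reads the output, so the two outputs may differ.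
  This allows the output, which has no fixed bound, to be left out when configurations are
  counted.\<close>

lemma ends_time_unique:
  "ends x c (h, s, w) t st \<Longrightarrow> ends x c (h, s, w') t' st' \<Longrightarrow> t = t'"
proof (induction c "(h, s, w)" t st arbitrary: h s w w' t' st' rule: ends.induct)
  case (halt c)
  then show ?case by (auto elim: ends_cases)
next
  case (act c a c' st1 t st2)
  obtain h1 s1 w1 where st1: "st1 = (h1, s1, w1)" by (cases st1)
  from act.prems act.hyps(1) obtain st1' t'' where
    *: "perform x a (h, s, w') = Some st1'" "ends x c' st1' t'' st'" "t' = Suc t''"
    by (auto elim: ends_cases)
  from act.hyps(2) *(1) st1 obtain w1' where "st1' = (h1, s1, w1')"
    by (cases a) (auto split: if_splits)
  with * act.hyps(4)[OF st1] show ?case by auto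
next
  case (branch c b c1 c2 t st2)
  have "holds x b (h, s, w) = holds x b (h, s, w')" by (cases b) auto
  moreover from branch.prems(1) branch.hyps(1) obtain t'' where
    "ends x (if holds x b (h, s, w') then c1 else c2) (h, s, w') t'' st'" "t' = Suc t''"
    by (cases rule: ends_cases) auto
  ultimately show ?case using branch.hyps(3)[of w' t'' st'] by simp
qed

definition bounded :: "'a list \<Rightarrow> nat \<Rightarrow> 'b store \<Rightarrow> bool" where
  "bounded x k st \<longleftrightarrow> fst st \<le> length x + 1 \<and> (\<forall>i. fst (snd st) i \<le> length x + 1) \<and>
     (\<forall>i\<ge>k. fst (snd st) i = 0)"

lemma bounded_perform:
  assumes "bounded x k st" "perform x a st = Some st'" "counters_instr a \<subseteq> {..<k}"
  shows "bounded x k st'"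
  using assms by (cases st; cases a) (auto simp: bounded_def le_diff_conv le_SucI split: if_splits)

definition configs :: "'a list \<Rightarrow> nat \<Rightarrow> ('a, 'b) com \<Rightarrow> (('a, 'b) com \<times> nat \<times> nat list) set" where
  "configs x k c = residuals c \<times> {..length x + 1} \<times> {ss. set ss \<subseteq> {..length x + 1} \<and> length ss = k}"

lemma card_configs:
  "finite (configs x k c)" "card (configs x k c) = card (residuals c) * (length x + 2) ^ (k + 1)"
proof -
  have "finite {ss :: nat list. set ss \<subseteq> {..length x + 1} \<and> length ss = k}"
    by (rule finite_lists_length_eq) simp
  then show "finite (configs x k c)" by (simp add: configs_def finite_residuals)
  have "card {ss :: nat list. set ss \<subseteq> {..length x + 1} \<and> length ss = k} = (length x + 2) ^ k"
    by (subst card_lists_length_eq) auto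
  then show "card (configs x k c) = card (residuals c) * (length x + 2) ^ (k + 1)"
    by (simp add: configs_def card_cartesian_product)
qed

text \<open>The remaining time is a function of the residual program, the head position and the
  counters, so no such triple occurs twice in a terminating execution.\<close>

lemma ends_time_le:
  assumes "ends x c0 st t st'" and "bounded x k st" and "counters c0 \<subseteq> {..<k}"
  shows "t \<le> card (residuals c0) * (length x + 2) ^ (k + 1)"
proof -
  define conf where "conf = (\<lambda>(c :: ('a, 'b) com) (st :: 'b store). (c, fst st, map (fst (snd st)) [0..<k]))"
  \<comment> \<open>Every remaining time from 0 to t occurs at some moment of the run.\<close>
  have *: "\<exists>r u. r \<in> residuals c0 \<and> bounded x k u \<and> ends x r u j st'"
    if "ends x c st t st'" "bounded x k st" "c \<in> residuals c0" "j \<le> t" for c st t j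
    using that
  proof (induction rule: ends.induct)
    case (halt c st)
    then show ?case using ends.halt[OF halt.hyps] by (metis le_zero_eq)
  next
    case (act c a c' st st1 t st2)
    have "counters_instr a \<subseteq> {..<k}"
      using counters_node[of c] act.hyps(1) counters_residuals[OF act.prems(2)] assms(3) by auto
    then have "bounded x k st1" using bounded_perform act by blast
    moreover have "c' \<in> residuals c0" using residuals_closed[OF act.prems(2)] act.hyps(1) by simp
    ultimately show ?case
      using act.IH act.prems ends.act[OF act.hyps] by (cases "j = Suc t") (blast, simp)
  next
    case (branch c b c1 c2 st t st2)
    have "(if holds x b st then c1 else c2) \<in> residuals c0" using residuals_closed[OF branch.prems(2)] branch.hyps(1) by simp
    then show ?case
      using branch.IH branch.prems ends.branch[OF branch.hyps] by (cases "j = Suc t") (blast, simp)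
  qed
  have "\<forall>j\<in>{..t}. \<exists>ru. fst ru \<in> residuals c0 \<and> bounded x k (snd ru) \<and> ends x (fst ru) (snd ru) j st'"
    using *[OF assms(1,2) residuals_self] by simp
  then obtain g where g: "\<And>j. j \<le> t \<Longrightarrow> fst (g j) \<in> residuals c0 \<and> bounded x k (snd (g j)) \<and>
      ends x (fst (g j)) (snd (g j)) j st'" unfolding bchoice_iff by auto
  \<comment> \<open>Equal configurations have equal remaining times. \<open>conf\<close> keeps only
    the first k counters, but \<open>bounded\<close> makes all others 0, so it determines the store
    up to the output.\<close>
  have "inj_on (\<lambda>j. conf (fst (g j)) (snd (g j))) {..t}"
  proof (rule inj_onI)
    fix i j assume ij: "i \<in> {..t}" "j \<in> {..t}"
      and eq: "conf (fst (g i)) (snd (g i)) = conf (fst (g j)) (snd (g j))"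
    obtain c h s w where gi: "g i = (c, h, s, w)" by (metis prod_cases4)
    obtain c' h' s' w' where gj: "g j = (c', h', s', w')" by (metis prod_cases4)
    have "bounded x k (h, s, w)" "bounded x k (h', s', w')" using g ij gi gj by fastforce+
    then have "s m = s' m" for m
      using eq gi gj by (cases "m < k") (auto simp: conf_def bounded_def)
    then have "s = s'" ..
    then have "c = c'" "h = h'" "s = s'" using eq gi gj by (auto simp: conf_def)
    then show "i = j" using g[of i] g[of j] ij gi gj by (auto intro: ends_time_unique)
  qed
  moreover have "(\<lambda>j. conf (fst (g j)) (snd (g j))) ` {..t} \<subseteq> configs x k c0"
    using g by (fastforce simp: conf_def configs_def bounded_def)
  ultimately have "card {..t} \<le> card (configs x k c0)"
    using card_configs(1) card_inj_on_le by blast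
  then show ?thesis unfolding card_configs(2) by simp
qed


section \<open>Simulation of counter programs by transducers\<close>

text \<open>Work symbols: 0 is blank, 1 marks cell 0, and 2 and 3 are the binary digits 0 and 1.
  Each counter is kept on its own tape, least significant digit first.\<close>

fun value_of :: "bool list \<Rightarrow> nat" where
  "value_of [] = 0"
| "value_of (b # bs) = of_bool b + 2 * value_of bs"

definition digit :: "bool \<Rightarrow> nat" where
  "digit b = (if b then 3 else 2)"

definition tape_of :: "bool list \<Rightarrow> nat \<Rightarrow> nat" where
  "tape_of bs j = (if j = 0 then 1 else if j \<le> length bs then digit (bs ! (j - 1)) else 0)"

text \<open>\<open>Up\<close> and \<open>Down\<close> are the propagation of a carry and of a
  borrow, \<open>Look\<close> searches for a digit 1 as a test for zero. All three are the same
  movement of the head and differ only in the symbols below.\<close>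

datatype sweep = Up | Down | Look

fun old_symbol :: "sweep \<Rightarrow> nat" where
  "old_symbol Up = 3" | "old_symbol Down = 2" | "old_symbol Look = 2"

fun new_symbol :: "sweep \<Rightarrow> nat" where
  "new_symbol Up = 2" | "new_symbol Down = 3" | "new_symbol Look = 2"

fun last_symbol :: "sweep \<Rightarrow> nat \<Rightarrow> nat" where
  "last_symbol Up s = 3" | "last_symbol Down s = 2" | "last_symbol Look s = s"

text \<open>A sweep replaces the leading old symbols and the symbol after them, and the head then
  returns to the mark in order to continue with the first program if the sweep stopped at digit 1
  and with the second one otherwise.\<close>

datatype ('a, 'b) control =
    Ready "('a, 'b) com"
  | Sweep sweep nat "('a, 'b) com" "('a, 'b) com"
  | Back nat "('a, 'b) com"

definition touch :: "nat list \<Rightarrow> nat \<Rightarrow> nat \<Rightarrow> dir \<Rightarrow> (nat \<times> dir) list" where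
  "touch ss i s d = (map (\<lambda>s. (s, Stay)) ss)[i := (s, d)]"

definition idle :: "nat list \<Rightarrow> (nat \<times> dir) list" where
  "idle ss = map (\<lambda>s. (s, Stay)) ss"

text \<open>Between operations every work head rests on the mark in cell 0; a counter operation
  starts by moving one head to the least significant digit in cell 1.\<close>

fun flow_trans where
  "flow_trans Halt a ss = None"
| "flow_trans (Act GoLeft c) a ss = Some (Ready c, Leftwards, idle ss, None)"
| "flow_trans (Act GoRight c) a ss = Some (Ready c, Rightwards, idle ss, None)"
| "flow_trans (Act (Emit b) c) a ss = Some (Ready c, Stay, idle ss, Some b)"
| "flow_trans (Act (Inc i) c) a ss =
     Some (Sweep Up i c c, Stay, touch ss i (ss ! i) Rightwards, None)"
| "flow_trans (Act (Dec i) c) a ss =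
     Some (Sweep Down i c c, Stay, touch ss i (ss ! i) Rightwards, None)"
| "flow_trans (Branch (Head A) c d) a ss =
     Some (Ready (if a \<in> A then c else d), Stay, idle ss, None)"
| "flow_trans (Branch (NonZero i) c d) a ss =
     Some (Sweep Look i c d, Stay, touch ss i (ss ! i) Rightwards, None)"

fun trans :: "('a, 'b) control \<Rightarrow> 'a cell \<Rightarrow> nat list \<Rightarrow>
    (('a, 'b) control \<times> dir \<times> (nat \<times> dir) list \<times> 'b option) option" where
  "trans (Ready c) a ss = flow_trans (node c) a ss"
| "trans (Sweep p i c d) a ss = Some (if ss ! i = old_symbol p
     then (Sweep p i c d, Stay, touch ss i (new_symbol p) Rightwards, None)
     else (Back i (if ss ! i = 3 then c else d), Stay, touch ss i (last_symbol p (ss ! i)) Leftwards, None))"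
| "trans (Back i c) a ss = Some (if ss ! i = 1
     then (Ready c, Stay, idle ss, None)
     else (Back i c, Stay, touch ss i (ss ! i) Leftwards, None))"

definition controls :: "nat \<Rightarrow> ('a, 'b) com \<Rightarrow> ('a, 'b) control set" where
  "controls k c0 = Ready ` residuals c0 \<union>
     (\<Union>p\<in>{Up, Down, Look}. \<Union>i<k. \<Union>c\<in>residuals c0. \<Union>d\<in>residuals c0. {Sweep p i c d}) \<union>
     (\<Union>i<k. \<Union>c\<in>residuals c0. {Back i c})"

lemma finite_controls: "finite (controls k c0)"
  by (auto simp: controls_def finite_residuals)

lemma controls_iff [simp]:
  "Ready c \<in> controls k c0 \<longleftrightarrow> c \<in> residuals c0"
  "Sweep p i c d \<in> controls k c0 \<longleftrightarrow> i < k \<and> c \<in> residuals c0 \<and> d \<in> residuals c0"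
  "Back i c \<in> controls k c0 \<longleftrightarrow> i < k \<and> c \<in> residuals c0"
  using sweep.exhaust[of p] by (auto simp: controls_def)

lemma set_touch: "fst ` set (touch ss i s d) \<subseteq> insert s (set ss)"
  by (auto simp: touch_def dest!: subsetD[OF set_update_subset_insert])

lemma trans_wf:
  assumes "counters c0 \<subseteq> {..<k}" "q \<in> controls k c0" "length ss = k" "set ss \<subseteq> {..<4}"
    and "trans q a ss = Some (q', d, acts, e)"
  shows "q' \<in> controls k c0 \<and> length acts = k \<and> fst ` set acts \<subseteq> {..<4}"
proof -
  define legal where "legal = (\<lambda>acts :: (nat \<times> dir) list. length acts = k \<and> fst ` set acts \<subseteq> {..<4})"
  have idle: "legal (idle ss)"
    using assms(3,4) by (auto simp: idle_def legal_def)
  have touch: "legal (touch ss i s d)" if "s < 4" for i s d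
    using assms(3,4) set_touch[of ss i s d] that by (force simp: touch_def legal_def)
  have nth: "ss ! i < 4" if "i < k" for i
    using assms(3,4) that nth_mem by fastforce
  have "q' \<in> controls k c0 \<and> legal acts"
  proof (cases q)
    case (Ready c)
    then have c: "c \<in> residuals c0" using assms(2) by simp
    have succ: "successors (node c) \<subseteq> residuals c0" by (rule residuals_closed[OF c])
    have cnt: "counters_node (node c) \<subseteq> {..<k}"
      using counters_node[of c] counters_residuals[OF c] assms(1) by blast
    show ?thesis
    proof (cases "(node c, a, ss)" rule: flow_trans.cases)
    qed (use assms(5) Ready succ cnt idle touch nth in auto)
  next
    case (Sweep p i c d)
    then have "i < k" "c \<in> residuals c0" "d \<in> residuals c0" using assms(2) by auto
    moreover have "new_symbol p < 4" "last_symbol p (ss ! i) < 4"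
      using nth[OF \<open>i < k\<close>] by (cases p; simp)+
    ultimately show ?thesis using assms(5) Sweep touch by (auto split: if_splits)
  next
    case (Back i c)
    then show ?thesis using assms(2,5) touch idle nth by (auto split: if_splits)
  qed
  then show ?thesis unfolding legal_def .
qed

text \<open>A piece of a computation with a common bound B on the work heads of all its
  configurations, so that time and space bounds are both preserved by concatenation.\<close>

inductive path :: "('a, 'b) transducer \<Rightarrow> 'a list \<Rightarrow> nat \<Rightarrow> 'b config \<Rightarrow> nat \<Rightarrow> 'b config \<Rightarrow> bool"
  for M x B where
  stop: "\<forall>(_, h) \<in> set (work c). h < B \<Longrightarrow> path M x B c 0 c"
| go: "\<forall>(_, h) \<in> set (work c). h < B \<Longrightarrow> step M x c = Some c1 \<Longrightarrow> path M x B c1 t c2 \<Longrightarrow>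
    path M x B c (Suc t) c2"

lemma path_trans: "path M x B c t c1 \<Longrightarrow> path M x B c1 t' c2 \<Longrightarrow> path M x B c (t + t') c2"
  by (induction rule: path.induct) (auto intro: path.go)

lemma path_run:
  assumes "path M x B c t c'" "run M x t0 = Some c"
  shows "run M x (t0 + t) = Some c' \<and>
    (\<forall>j\<le>t. \<forall>u. run M x (t0 + j) = Some u \<longrightarrow> (\<forall>(_, h) \<in> set (work u). h < B))"
  using assms
proof (induction arbitrary: t0 rule: path.induct)
  case (go c c1 t c2)
  then have 1: "run M x (Suc t0) = Some c1" by simp
  show ?case
  proof (intro conjI allI impI)
    show "run M x (t0 + Suc t) = Some c2" using go.IH[OF 1] by simp
    fix j u assume j: "j \<le> Suc t" "run M x (t0 + j) = Some u"
    show "\<forall>(_, h)\<in>set (work u). h < B"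
    proof (cases j)
      case 0
      then show ?thesis using j go.hyps(1) go.prems by simp
    next
      case (Suc j')
      then show ?thesis using j go.IH[OF 1] by simp
    qed
  qed
qed auto

lemma run_after_halt: "run M x t = Some c \<Longrightarrow> step M x c = None \<Longrightarrow> run M x (Suc t + j) = None"
  by (induction j) auto

text \<open>No run is defined beyond a halting configuration, so the configurations of the path are
  all those that the space bound quantifies over.\<close>

lemma path_halts:
  assumes "path M x B (init_config M) t c" "step M x c = None" "real B \<le> s"
  shows "halts_with M x t (out_word c) \<and> work_space_le M x s"
proof -
  have *: "run M x t = Some c"
    "\<forall>j\<le>t. \<forall>u. run M x j = Some u \<longrightarrow> (\<forall>(_, h) \<in> set (work u). h < B)"
    using path_run[OF assms(1), of 0] by auto
  have "\<forall>(_, h) \<in> set (work u). real (h + 1) \<le> s" if "run M x j = Some u" for j u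
  proof -
    have "j \<le> t"
      using that run_after_halt[OF *(1) assms(2), of "j - Suc t"] by (cases "j \<le> t") auto
    then have "\<forall>(_, h) \<in> set (work u). h < B" using * that by blast
    then show ?thesis using assms(3) by fastforce
  qed
  then show ?thesis using * assms(2) unfolding halts_with_def work_space_le_def by blast
qed


section \<open>Effect of a sweep on binary numbers\<close>

fun swept :: "sweep \<Rightarrow> bool list \<Rightarrow> bool list" where
  "swept Up [] = [True]"
| "swept Up (b # bs) = (if b then False # swept Up bs else True # bs)"
| "swept Down [] = []"
| "swept Down (b # bs) = (if b then False # bs else True # swept Down bs)"
| "swept Look bs = bs"

lemma value_of_eq_0_iff: "value_of bs = 0 \<longleftrightarrow> True \<notin> set bs"
  by (induction bs) auto

lemma value_of_swept_Up: "value_of (swept Up bs) = Suc (value_of bs)"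
  by (induction bs) auto

lemma value_of_swept_Down: "0 < value_of bs \<Longrightarrow> value_of (swept Down bs) = value_of bs - 1"
  by (induction bs) auto

lemma length_swept_Down: "length (swept Down bs) = length bs"
  by (induction bs) auto

text \<open>A new digit appears only when all digits were 1, and then the new value is a power of
  two. This keeps digit strings logarithmically short.\<close>

lemma length_swept_Up:
  "length (swept Up bs) = length bs \<or>
   length (swept Up bs) = Suc (length bs) \<and> value_of (swept Up bs) = 2 ^ length bs"
  by (induction bs) auto

lemma tape_of_nth:
  "tape_of (ps @ b # bs) (Suc (length ps)) = digit b" "tape_of ps (Suc (length ps)) = 0"
  by (auto simp: tape_of_def)

lemma tape_of_upd:
  "(tape_of (ps @ b # bs))(Suc (length ps) := digit b') = tape_of (ps @ b' # bs)"
  "(tape_of ps)(Suc (length ps) := digit b') = tape_of (ps @ [b'])"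
  by (auto simp: tape_of_def fun_eq_iff nth_append nth_Cons')

lemma digit_cases: "digit b = 3 \<longleftrightarrow> b" "digit b = 2 \<longleftrightarrow> \<not> b" "digit b \<noteq> Suc 0" "digit b \<noteq> 0"
  by (auto simp: digit_def)

lemma tape_of_mark: "tape_of bs j = Suc 0 \<longleftrightarrow> j = 0"
  by (auto simp: tape_of_def digit_cases)

section \<open>The simulating transducer\<close>

locale simulation =
  fixes c0 :: "('a, 'b) com" and k :: nat and code :: "('a, 'b) control \<Rightarrow> nat"
    and decode :: "nat \<Rightarrow> ('a, 'b) control" and K :: nat
  assumes counters: "counters c0 \<subseteq> {..<k}"
    and code: "q \<in> controls k c0 \<Longrightarrow> code q < K \<and> decode (code q) = q"
    and decode: "n < K \<Longrightarrow> decode n \<in> controls k c0"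
begin

text \<open>State 0 is used for the first step alone, which writes the mark into cell 0 of every
  tape, since all tapes start blank. The codes of the controls are therefore shifted by one.\<close>

definition machine :: "('a, 'b) transducer" where
  "machine = \<lparr>num_tapes = k, num_states = Suc K, num_symbols = 4,
     delta = (\<lambda>n a ss. case n of
         0 \<Rightarrow> Some (Suc (code (Ready c0)), Stay, map (\<lambda>_. (1, Stay)) ss, None)
       | Suc n \<Rightarrow> map_option (\<lambda>(q, d, acts, e). (Suc (code q), d, acts, e)) (trans (decode n) a ss))\<rparr>"

lemma wf_machine: "wf_transducer machine"
  unfolding wf_transducer_def
proof (intro conjI allI impI)
  show "0 < num_states machine" "0 < num_symbols machine" by (auto simp: machine_def)
next
  fix q a ss q' d acts e
  assume *: "q < num_states machine" "length ss = num_tapes machine"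
    "set ss \<subseteq> {..<num_symbols machine}" "delta machine q a ss = Some (q', d, acts, e)"
  have "q' < num_states machine \<and> length acts = num_tapes machine \<and>
    fst ` set acts \<subseteq> {..<num_symbols machine}"
  proof (cases q)
    case 0
    then show ?thesis using * code[of "Ready c0"] residuals_self[of c0]
      by (auto simp: machine_def)
  next
    case (Suc n)
    then obtain p where p: "trans (decode n) a ss = Some (p, d, acts, e)" "q' = Suc (code p)"
      using * by (auto simp: machine_def)
    have "p \<in> controls k c0 \<and> length acts = k \<and> fst ` set acts \<subseteq> {..<4}"
      by (rule trans_wf[OF counters _ _ _ p(1)]) (use * Suc decode in \<open>auto simp: machine_def\<close>)
    then show ?thesis using p code by (auto simp: machine_def)
  qed
  then show "q' < num_states machine" "length acts = num_tapes machine"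
    "fst ` set acts \<subseteq> {..<num_symbols machine}" by auto
qed

definition cfg :: "('a, 'b) control \<Rightarrow> nat \<Rightarrow> (nat \<Rightarrow> (nat \<Rightarrow> nat) \<times> nat) \<Rightarrow> 'b list \<Rightarrow> 'b config" where
  "cfg q h T w = \<lparr>state = Suc (code q), input_pos = h, work = map T [0..<k], out_word = w\<rparr>"

definition symbols :: "(nat \<Rightarrow> (nat \<Rightarrow> nat) \<times> nat) \<Rightarrow> nat list" where
  "symbols T = map (\<lambda>i. fst (T i) (snd (T i))) [0..<k]"

lemma symbols_nth: "i < k \<Longrightarrow> symbols T ! i = fst (T i) (snd (T i))"
  by (simp add: symbols_def)

lemma step_machine:
  assumes "q \<in> controls k c0"
    and "trans q (read_input x h) (symbols T) = Some (q', d, acts, e)"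
  shows "step machine x (cfg q h T w) = Some
    \<lparr>state = Suc (code q'), input_pos = min (move d h) (length x + 1),
     work = map2 (\<lambda>(t, h) (s, d'). (t(h := s), move d' h)) (map T [0..<k]) acts,
     out_word = w @ (case e of None \<Rightarrow> [] | Some b \<Rightarrow> [b])\<rparr>"
proof -
  have "map (\<lambda>(t, h). t h) (map T [0..<k]) = symbols T"
    by (auto simp: symbols_def split_beta)
  then show ?thesis
    using assms code[OF assms(1)] by (simp add: step_def machine_def cfg_def)
qed

lemma step_idle:
  assumes "q \<in> controls k c0"
    and "trans q (read_input x h) (symbols T) = Some (q', d, idle (symbols T), e)"
  shows "step machine x (cfg q h T w) = Some
    (cfg q' (min (move d h) (length x + 1)) T (w @ (case e of None \<Rightarrow> [] | Some b \<Rightarrow> [b])))"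
proof -
  have "map2 (\<lambda>(t, h) (s, d'). (t(h := s), move d' h)) (map T [0..<k]) (idle (symbols T)) = map T [0..<k]"
    by (rule nth_equalityI) (auto simp: idle_def symbols_def split_beta)
  then show ?thesis using step_machine[OF assms] by (simp add: cfg_def)
qed

lemma step_touch:
  assumes "q \<in> controls k c0" "h \<le> length x + 1" "i < k" "T i = (t, p)"
    and "trans q (read_input x h) (symbols T) = Some (q', Stay, touch (symbols T) i s d, None)"
  shows "step machine x (cfg q h T w) = Some (cfg q' h (T(i := (t(p := s), move d p))) w)"
proof -
  have "map2 (\<lambda>(t, h) (s, d'). (t(h := s), move d' h)) (map T [0..<k]) (touch (symbols T) i s d)
      = map (T(i := (t(p := s), move d p))) [0..<k]"
  proof (rule nth_equalityI)
    fix j assume "j < length (map2 (\<lambda>(t, h) (s, d'). (t(h := s), move d' h)) (map T [0..<k]) (touch (symbols T) i s d))"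
    then have "j < k" by simp
    then show "map2 (\<lambda>(t, h) (s, d'). (t(h := s), move d' h)) (map T [0..<k]) (touch (symbols T) i s d) ! j
      = map (T(i := (t(p := s), move d p))) [0..<k] ! j"
      using assms(3,4) by (cases "j = i") (auto simp: touch_def symbols_def split_beta)
  qed (simp add: touch_def symbols_def)
  then show ?thesis using step_machine[OF assms(1,5)] assms(2) by (simp add: cfg_def)
qed

lemma heads_cfg: "(\<forall>(_, h) \<in> set (work (cfg q h' T w)). h < B) \<longleftrightarrow> (\<forall>i<k. snd (T i) < B)"
  by (auto simp: cfg_def split_beta)

lemma path_cfg_stop:
  "\<forall>i<k. snd (T i) < B \<Longrightarrow> path machine x B (cfg q h T w) 0 (cfg q h T w)"
  by (rule path.stop) (simp only: heads_cfg)

lemma path_cfg_go: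
  "\<forall>i<k. snd (T i) < B \<Longrightarrow> step machine x (cfg q h T w) = Some c1 \<Longrightarrow> path machine x B c1 t c2 \<Longrightarrow>
    path machine x B (cfg q h T w) (Suc t) c2"
  by (rule path.go) (simp only: heads_cfg)

text \<open>There are p moves to the left and one last step that recognises the mark, a symbol found
  nowhere else on the tape.\<close>

lemma path_back:
  assumes "i < k" "c \<in> residuals c0" "h \<le> length x + 1" "\<forall>j<k. snd (T j) < B" "T i = (tape_of bs, p)"
  shows "path machine x B (cfg (Back i c) h T w) (Suc p) (cfg (Ready c) h (T(i := (tape_of bs, 0))) w)"
  using assms(4,5)
proof (induction p arbitrary: T)
  case 0
  have "step machine x (cfg (Back i c) h T w) = Some (cfg (Ready c) h T w)"
    using step_idle[of "Back i c" x h T "Ready c" Stay None w] assms(1-3) 0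
    by (simp add: symbols_nth tape_of_mark)
  moreover have "T(i := (tape_of bs, 0)) = T" using 0 by auto
  ultimately show ?case using 0 by (auto intro!: path_cfg_go path_cfg_stop)
next
  case (Suc p)
  let ?T = "T(i := (tape_of bs, p))"
  have "step machine x (cfg (Back i c) h T w) = Some (cfg (Back i c) h ?T w)"
    using step_touch[of "Back i c" h x i T "tape_of bs" "Suc p" "Back i c" "symbols T ! i" Leftwards w]
      assms(1-3) Suc.prems
    by (simp add: symbols_nth tape_of_mark)
  moreover have "\<forall>j<k. snd (?T j) < B" using Suc.prems assms(1) by fastforce
  then have "path machine x B (cfg (Back i c) h ?T w) (Suc p) (cfg (Ready c) h (?T(i := (tape_of bs, 0))) w)"
    by (intro Suc.IH) auto
  ultimately have "path machine x B (cfg (Back i c) h T w) (Suc (Suc p))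
      (cfg (Ready c) h (?T(i := (tape_of bs, 0))) w)"
    by (rule path_cfg_go[OF Suc.prems(1)])
  then show ?case unfolding fun_upd_upd .
qed

text \<open>The digits \<open>ps\<close> have been passed already, which makes the induction on the
  remaining ones possible. The machine branches on the symbol at which it stops, the conclusion on
  the presence of a digit 1; these agree for \<open>Look\<close>, and for the other sweeps the two
  continuations coincide. For \<open>Down\<close> a digit 1 is required, since otherwise the borrow
  would leave the number.\<close>

lemma path_sweep:
  assumes "i < k" "c \<in> residuals c0" "d \<in> residuals c0" "h \<le> length x + 1"
    and "\<forall>j<k. snd (T j) < B" "T i = (tape_of (ps @ bs), Suc (length ps))"
    and "length (ps @ bs) + 1 < B" "p = Down \<Longrightarrow> True \<in> set bs" "p = Look \<or> c = d"
  shows "\<exists>q \<le> length (ps @ bs). \<exists>t \<le> length bs + 1. path machine x B (cfg (Sweep p i c d) h T w) t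
      (cfg (Back i (if True \<in> set bs then c else d)) h (T(i := (tape_of (ps @ swept p bs), q))) w)"
  using assms(5-8)
proof (induction bs arbitrary: T ps)
  case Nil
  have sym: "symbols T ! i = 0" using Nil(2) assms(1) tape_of_nth(2)[of ps] by (simp add: symbols_nth)
  let ?T = "T(i := ((tape_of ps)(Suc (length ps) := last_symbol p 0), length ps))"
  have p: "p \<noteq> Down" using Nil by auto
  then have "step machine x (cfg (Sweep p i c d) h T w) = Some (cfg (Back i d) h ?T w)"
    using step_touch[of "Sweep p i c d" h x i T "tape_of ps" "Suc (length ps)" "Back i d"
        "last_symbol p 0" Leftwards w] assms(1-4) Nil(2) sym
    by (cases p) auto
  moreover have "(tape_of ps)(Suc (length ps) := last_symbol p 0) = tape_of (ps @ swept p [])"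
    using p tape_of_upd(2)[of ps True] tape_of_nth(2)[of ps] by (cases p) (auto simp: digit_def fun_eq_iff)
  moreover have "\<forall>j<k. snd (?T j) < B" using Nil by auto
  ultimately have "path machine x B (cfg (Sweep p i c d) h T w) (Suc 0)
      (cfg (Back i d) h (T(i := (tape_of (ps @ swept p []), length ps))) w)"
    using Nil.prems by (auto intro!: path_cfg_go path_cfg_stop)
  moreover have "length ps \<le> length (ps @ [])" "Suc 0 \<le> length ([] :: bool list) + 1" by auto
  ultimately show ?case unfolding list.set(1) empty_iff if_False by blast
next
  case (Cons b bs)
  have sym: "symbols T ! i = digit b"
    using Cons.prems(2) assms(1) tape_of_nth(1)[of ps b bs] by (simp add: symbols_nth)
  show ?case
  proof (cases "digit b = old_symbol p")
    case True
    \<comment> \<open>The digit left behind: complemented by a carry or borrow, unchanged under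
      \<open>Look\<close>.\<close>
    define b' where "b' = (if p = Look then b else \<not> b)"
    have b': "digit b' = new_symbol p" using True by (cases p; cases b) (auto simp: b'_def digit_def)
    let ?T = "T(i := (tape_of ((ps @ [b']) @ bs), Suc (length (ps @ [b']))))"
    have "step machine x (cfg (Sweep p i c d) h T w) = Some (cfg (Sweep p i c d) h ?T w)"
      using step_touch[of "Sweep p i c d" h x i T "tape_of (ps @ b # bs)" "Suc (length ps)" "Sweep p i c d"
          "new_symbol p" Rightwards w] assms(1-4) Cons.prems(2) sym True tape_of_upd(1)[of ps b bs b'] b'
      by simp
    moreover have "\<forall>j<k. snd (?T j) < B" using Cons.prems by auto
    moreover have "\<exists>q \<le> length ((ps @ [b']) @ bs). \<exists>t \<le> length bs + 1.
        path machine x B (cfg (Sweep p i c d) h ?T w) t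
        (cfg (Back i (if True \<in> set bs then c else d)) h (?T(i := (tape_of ((ps @ [b']) @ swept p bs), q))) w)"
    proof (rule Cons.IH)
      show "\<forall>j<k. snd (?T j) < B" by fact
      show "length ((ps @ [b']) @ bs) + 1 < B" using Cons.prems by simp
      show "p = Down \<Longrightarrow> True \<in> set bs" using Cons.prems(4) True by (auto simp: digit_def split: if_splits)
    qed simp
    then obtain q t where q: "q \<le> length (ps @ b # bs)" "t \<le> length bs + 1"
      and pt: "path machine x B (cfg (Sweep p i c d) h ?T w) t
        (cfg (Back i (if True \<in> set bs then c else d)) h (T(i := (tape_of ((ps @ [b']) @ swept p bs), q))) w)"
      by auto
    moreover have "(ps @ [b']) @ swept p bs = ps @ swept p (b # bs)"
      using True by (cases p) (auto simp: b'_def digit_def split: if_splits)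
    moreover have "(if True \<in> set bs then c else d) = (if True \<in> set (b # bs) then c else d)"
      using True assms(9) by (cases p) (auto simp: digit_def split: if_splits)
    ultimately have "path machine x B (cfg (Sweep p i c d) h T w) (Suc t)
        (cfg (Back i (if True \<in> set (b # bs) then c else d)) h (T(i := (tape_of (ps @ swept p (b # bs)), q))) w)"
      using Cons.prems by (auto intro!: path_cfg_go)
    moreover have "Suc t \<le> length (b # bs) + 1" using q(2) by simp
    ultimately show ?thesis using q(1) by blast
  next
    case False
    define b' where "b' = (if p = Look then b else \<not> b)"
    have b': "digit b' = last_symbol p (digit b)" using False by (cases p; cases b) (auto simp: b'_def digit_def)
    let ?T = "T(i := (tape_of (ps @ b' # bs), length ps))"
    let ?e = "if True \<in> set (b # bs) then c else d"
    have e: "(if digit b = 3 then c else d) = ?e" using assms(9) False by (cases p) (auto simp: digit_def split: if_splits)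
    have "step machine x (cfg (Sweep p i c d) h T w) = Some (cfg (Back i ?e) h ?T w)"
      using step_touch[of "Sweep p i c d" h x i T "tape_of (ps @ b # bs)" "Suc (length ps)" "Back i ?e"
          "last_symbol p (digit b)" Leftwards w] assms(1-4) Cons.prems(2) sym False e
        tape_of_upd(1)[of ps b bs b'] b'
      by simp
    moreover have "b' # bs = swept p (b # bs)"
      using False by (cases p) (auto simp: b'_def digit_def split: if_splits)
    moreover have "\<forall>j<k. snd (?T j) < B" using Cons.prems by auto
    ultimately have "path machine x B (cfg (Sweep p i c d) h T w) (Suc 0)
      (cfg (Back i ?e) h (T(i := (tape_of (ps @ swept p (b # bs)), length ps))) w)"
      using Cons.prems by (auto intro!: path_cfg_go path_cfg_stop)
    moreover have "length ps \<le> length (ps @ b # bs)" "Suc 0 \<le> length (b # bs) + 1" by auto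
    ultimately show ?thesis by blast
  qed
qed

definition tapes :: "(nat \<Rightarrow> bool list) \<Rightarrow> nat \<Rightarrow> (nat \<Rightarrow> nat) \<times> nat" where
  "tapes bss i = (tape_of (bss i), 0)"

text \<open>One step leaves the mark, the sweep takes at most \<open>length (bss i) + 1\<close>
  steps, and so does the way back.\<close>

lemma path_operation:
  assumes "node r = Act a r' \<and> (a = Inc i \<and> p = Up \<or> a = Dec i \<and> p = Down) \<and> c = r' \<and> d = r' \<or>
      node r = Branch (NonZero i) c d \<and> p = Look"
    and "r \<in> residuals c0" "h \<le> length x + 1" "length (bss i) + 1 < B"
    and "p = Down \<Longrightarrow> True \<in> set (bss i)"
  shows "\<exists>t \<le> 2 * length (bss i) + 3. path machine x B (cfg (Ready r) h (tapes bss) w) t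
    (cfg (Ready (if True \<in> set (bss i) then c else d)) h (tapes (bss(i := swept p (bss i)))) w)"
proof -
  let ?e = "if True \<in> set (bss i) then c else d"
  have cd: "c \<in> residuals c0" "d \<in> residuals c0" using assms(1) residuals_closed[OF assms(2)] by auto
  have i: "i < k"
    using assms(1) counters_node[of r] counters_residuals[OF assms(2)] counters by auto
  let ?T = "(tapes bss)(i := (tape_of (bss i), 1))"
  have "step machine x (cfg (Ready r) h (tapes bss) w) = Some (cfg (Sweep p i c d) h ?T w)"
    using step_touch[of "Ready r" h x i "tapes bss" "tape_of (bss i)" 0 "Sweep p i c d"
        "symbols (tapes bss) ! i" Rightwards w] assms(1-3) i
    by (auto simp: tapes_def symbols_nth)
  moreover have T: "\<forall>j<k. snd (?T j) < B" "\<forall>j<k. snd (tapes bss j) < B"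
    using assms(4) by (auto simp: tapes_def)
  moreover have "\<exists>q \<le> length ([] @ bss i). \<exists>t \<le> length (bss i) + 1.
      path machine x B (cfg (Sweep p i c d) h ?T w) t
      (cfg (Back i ?e) h (?T(i := (tape_of ([] @ swept p (bss i)), q))) w)"
    by (rule path_sweep[OF i cd assms(3) T(1)]) (use assms in auto)
  then obtain q t where q: "q \<le> length (bss i)" "t \<le> length (bss i) + 1"
    and pt: "path machine x B (cfg (Sweep p i c d) h ?T w) t
      (cfg (Back i ?e) h ((tapes bss)(i := (tape_of (swept p (bss i)), q))) w)" by auto
  have "path machine x B (cfg (Back i ?e) h ((tapes bss)(i := (tape_of (swept p (bss i)), q))) w) (Suc q)
      (cfg (Ready ?e) h (((tapes bss)(i := (tape_of (swept p (bss i)), q)))(i := (tape_of (swept p (bss i)), 0))) w)"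
    by (rule path_back[OF i]) (use cd assms(3) T q assms(4) in auto)
  moreover have "((tapes bss)(i := (tape_of (swept p (bss i)), q)))(i := (tape_of (swept p (bss i)), 0))
      = tapes (bss(i := swept p (bss i)))"
    by (auto simp: tapes_def fun_eq_iff)
  ultimately have "path machine x B (cfg (Ready r) h (tapes bss) w) (Suc (t + Suc q))
      (cfg (Ready ?e) h (tapes (bss(i := swept p (bss i)))) w)"
    using path_cfg_go[OF T(2) _ path_trans[OF pt]] by (simp only:)
  then show ?thesis using q by (intro exI[of _ "Suc (t + Suc q)"]) auto
qed

text \<open>The length has to be bounded separately from the value, because \<open>Down\<close>
  leaves leading zeros in place. It grows only when the counter reaches a power of two, and no
  counter exceeds \<open>length x + 1\<close>.\<close>

definition short :: "'a list \<Rightarrow> bool list \<Rightarrow> bool" where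
  "short x bs \<longleftrightarrow> bs = [] \<or> 2 ^ (length bs - 1) \<le> length x + 1"

definition represents :: "'a list \<Rightarrow> (nat \<Rightarrow> bool list) \<Rightarrow> (nat \<Rightarrow> nat) \<Rightarrow> bool" where
  "represents x bss s \<longleftrightarrow> (\<forall>i<k. value_of (bss i) = s i \<and> short x (bss i))"

text \<open>A short string has at most one digit more than the rounded logarithm, the head visits
  the cell behind the last digit, and the bound is strict: together 3.\<close>

definition head_bound :: "'a list \<Rightarrow> nat" where
  "head_bound x = nat \<lfloor>log 2 (length x + 1)\<rfloor> + 3"

lemma short_le:
  assumes "short x bs"
  shows "length bs + 1 < head_bound x" "length bs \<le> length x + 1"
proof -
  have "length bs + 1 < head_bound x \<and> length bs \<le> length x + 1"
  proof (cases bs)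
    case (Cons b bs')
    then have *: "2 ^ length bs' \<le> length x + 1" using assms by (simp add: short_def)
    then have "real (2 ^ length bs') \<le> real (length x + 1)" by (rule of_nat_mono)
    then have "real (length bs') \<le> log 2 (length x + 1)"
      by (subst le_log_iff) (auto simp: powr_realpow)
    then have "length bs' \<le> nat \<lfloor>log 2 (length x + 1)\<rfloor>" by (simp add: le_nat_iff le_floor_iff)
    moreover have "length bs' \<le> length x" using * less_exp[of "length bs'"] by linarith
    ultimately show ?thesis using Cons by (simp add: head_bound_def)
  qed (simp add: head_bound_def)
  then show "length bs + 1 < head_bound x" "length bs \<le> length x + 1" by auto
qed

lemma represents_upd:
  "represents x bss s \<Longrightarrow> value_of bs = v \<Longrightarrow> short x bs \<Longrightarrow> represents x (bss(i := bs)) (s(i := v))"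
  by (auto simp: represents_def)

text \<open>The time is that of \<open>path_operation\<close> with the crude bound
  \<open>length x + 1\<close> on the number of digits, which is good enough for polynomial
  time.\<close>

lemma simulate_act:
  assumes "r \<in> residuals c0" "node r = Act a r'" "perform x a (h, s, w) = Some (h', s', w')"
    and "h \<le> length x + 1" "represents x bss s"
  shows "\<exists>t \<le> 2 * length x + 5. \<exists>bss'. represents x bss' s' \<and>
    path machine x (head_bound x) (cfg (Ready r) h (tapes bss) w) t (cfg (Ready r') h' (tapes bss') w')"
proof -
  have T: "\<forall>i<k. snd (tapes bss i) < head_bound x" by (simp add: tapes_def head_bound_def)
  have 1: ?thesis if "step machine x (cfg (Ready r) h (tapes bss) w) = Some (cfg (Ready r') h' (tapes bss) w')"
      "s' = s"
    using that T assms(5)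
    by (intro exI[of _ "Suc 0"] exI[of _ bss] conjI) (auto intro!: path_cfg_go path_cfg_stop)
  have cnt: "counters_instr a \<subseteq> {..<k}"
    using assms(2) counters_node[of r] counters_residuals[OF assms(1)] counters by auto
  show ?thesis
  proof (cases a)
    case GoLeft
    then show ?thesis using assms step_idle[of "Ready r" x h "tapes bss" "Ready r'" Leftwards None w] 1 by auto
  next
    case GoRight
    then show ?thesis using assms step_idle[of "Ready r" x h "tapes bss" "Ready r'" Rightwards None w] 1 by auto
  next
    case (Emit b)
    then show ?thesis using assms step_idle[of "Ready r" x h "tapes bss" "Ready r'" Stay "Some b" w] 1 by auto
  next
    case (Inc i)
    then have i: "i < k" "value_of (bss i) = s i" "short x (bss i)"
      using cnt assms(5) by (auto simp: represents_def)
    have eq: "h' = h" "w' = w" "s' = s(i := s i + 1)" "s i \<le> length x"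
      using assms(3) Inc by (auto split: if_splits)
    let ?b = "swept Up (bss i)"
    have v: "value_of ?b = s i + 1" using i by (simp add: value_of_swept_Up)
    \<comment> \<open>If the string grows, its new value is \<open>2 ^ length (bss i)\<close>, and
      this is at most \<open>length x + 1\<close> because the increment was permitted.\<close>
    have "short x ?b"
      using length_swept_Up[of "bss i"] i(3) v eq(4) by (auto simp: short_def)
    then have "represents x (bss(i := ?b)) s'" using represents_upd assms(5) v eq(3) by blast
    moreover have "\<exists>t \<le> 2 * length (bss i) + 3. path machine x (head_bound x) (cfg (Ready r) h (tapes bss) w) t
       (cfg (Ready (if True \<in> set (bss i) then r' else r')) h (tapes (bss(i := ?b))) w)"
      by (rule path_operation[where a = a]) (use assms(1,2,4) Inc short_le[OF i(3)] in auto)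
    moreover have "2 * length (bss i) + 3 \<le> 2 * length x + 5" using short_le[OF i(3)] by simp
    ultimately show ?thesis unfolding if_cancel eq(1,2) by (meson le_trans)
  next
    case (Dec i)
    then have i: "i < k" "value_of (bss i) = s i" "short x (bss i)"
      using cnt assms(5) by (auto simp: represents_def)
    have eq: "h' = h" "w' = w" "s' = s(i := s i - 1)" "0 < s i"
      using assms(3) Dec by (auto split: if_splits)
    let ?b = "swept Down (bss i)"
    have v: "value_of ?b = s i - 1" using i eq(4) by (simp add: value_of_swept_Down)
    have "short x ?b"
      using length_swept_Down[of "bss i"] i(3) by (auto simp: short_def simp flip: length_0_conv)
    then have "represents x (bss(i := ?b)) s'" using represents_upd assms(5) v eq(3) by blast
    moreover have "\<exists>t \<le> 2 * length (bss i) + 3. path machine x (head_bound x) (cfg (Ready r) h (tapes bss) w) t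
       (cfg (Ready (if True \<in> set (bss i) then r' else r')) h (tapes (bss(i := ?b))) w)"
      by (rule path_operation[where a = a])
        (use assms(1,2,4) Dec short_le[OF i(3)] i(2) eq(4) value_of_eq_0_iff[of "bss i"] in auto)
    moreover have "2 * length (bss i) + 3 \<le> 2 * length x + 5" using short_le[OF i(3)] by simp
    ultimately show ?thesis unfolding if_cancel eq(1,2) by (meson le_trans)
  qed
qed

lemma simulate_branch:
  assumes "r \<in> residuals c0" "node r = Branch b c d" "h \<le> length x + 1" "represents x bss s"
  shows "\<exists>t \<le> 2 * length x + 5.
    path machine x (head_bound x) (cfg (Ready r) h (tapes bss) w) t
      (cfg (Ready (if holds x b (h, s, w) then c else d)) h (tapes bss) w)"
proof (cases b)
  case (Head A)
  have T: "\<forall>i<k. snd (tapes bss i) < head_bound x" by (simp add: tapes_def head_bound_def)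
  have "step machine x (cfg (Ready r) h (tapes bss) w) =
      Some (cfg (Ready (if holds x b (h, s, w) then c else d)) h (tapes bss) w)"
    using assms Head step_idle[of "Ready r" x h "tapes bss" _ Stay None w] by auto
  then show ?thesis using T by (intro exI[of _ "Suc 0"]) (auto intro!: path_cfg_go path_cfg_stop)
next
  case (NonZero i)
  then have "i < k" using assms(2) counters_node[of r] counters_residuals[OF assms(1)] counters by auto
  then have i: "value_of (bss i) = s i" "short x (bss i)" using assms(4) by (auto simp: represents_def)
  have "\<exists>t \<le> 2 * length (bss i) + 3. path machine x (head_bound x) (cfg (Ready r) h (tapes bss) w) t
     (cfg (Ready (if True \<in> set (bss i) then c else d)) h (tapes (bss(i := swept Look (bss i)))) w)"
    by (rule path_operation) (use assms(1-3) NonZero short_le[OF i(2)] in auto)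
  moreover have "holds x b (h, s, w) \<longleftrightarrow> True \<in> set (bss i)"
    using NonZero value_of_eq_0_iff[of "bss i"] i(1) by auto
  moreover have "2 * length (bss i) + 3 \<le> 2 * length x + 5" using short_le[OF i(2)] by simp
  ultimately show ?thesis
    unfolding swept.simps fun_upd_triv \<open>holds x b (h, s, w) \<longleftrightarrow> True \<in> set (bss i)\<close>
    by (meson le_trans)
qed

lemma simulate_ends:
  assumes "ends x c (h, s, w) t (h', s', w')" "c \<in> residuals c0" "h \<le> length x + 1" "represents x bss s"
  shows "\<exists>t' \<le> t * (2 * length x + 5). \<exists>r bss'. r \<in> residuals c0 \<and> node r = Halt \<and>
    path machine x (head_bound x) (cfg (Ready c) h (tapes bss) w) t' (cfg (Ready r) h' (tapes bss') w')"
  using assms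
proof (induction c "(h, s, w)" t "(h', s', w')" arbitrary: h s w bss rule: ends.induct)
  case (halt c)
  have "path machine x (head_bound x) (cfg (Ready c) h' (tapes bss) w') 0 (cfg (Ready c) h' (tapes bss) w')"
    by (rule path_cfg_stop) (simp add: tapes_def head_bound_def)
  then show ?case using halt by auto
next
  case (act c a c' st1 t)
  obtain h1 s1 w1 where st1: "st1 = (h1, s1, w1)" by (cases st1)
  from simulate_act[OF act.prems(1) act.hyps(1) _ act.prems(2,3)] act.hyps(2) st1
  obtain t1 bss1 where t1: "t1 \<le> 2 * length x + 5" "represents x bss1 s1"
    "path machine x (head_bound x) (cfg (Ready c) h (tapes bss) w) t1 (cfg (Ready c') h1 (tapes bss1) w1)"
    by blast
  have "c' \<in> residuals c0" using residuals_closed[OF act.prems(1)] act.hyps(1) by simp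
  moreover have "h1 \<le> length x + 1"
    using act.hyps(2) act.prems(2) st1 by (cases a) (auto split: if_splits)
  ultimately obtain t2 r bss2 where t2: "t2 \<le> t * (2 * length x + 5)" "r \<in> residuals c0" "node r = Halt"
    "path machine x (head_bound x) (cfg (Ready c') h1 (tapes bss1) w1) t2 (cfg (Ready r) h' (tapes bss2) w')"
    using act.hyps(4)[OF st1 _ _ t1(2)] by blast
  have "t1 + t2 \<le> Suc t * (2 * length x + 5)" using t1(1) t2(1) by simp
  then show ?case using path_trans[OF t1(3) t2(4)] t2(2,3) by blast
next
  case (branch c b c1 c2 t)
  let ?c = "if holds x b (h, s, w) then c1 else c2"
  from simulate_branch[OF branch.prems(1) branch.hyps(1) branch.prems(2,3)]
  obtain t1 where t1: "t1 \<le> 2 * length x + 5"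
    "path machine x (head_bound x) (cfg (Ready c) h (tapes bss) w) t1 (cfg (Ready ?c) h (tapes bss) w)"
    by blast
  have "?c \<in> residuals c0" using residuals_closed[OF branch.prems(1)] branch.hyps(1) by simp
  then obtain t2 r bss2 where t2: "t2 \<le> t * (2 * length x + 5)" "r \<in> residuals c0" "node r = Halt"
    "path machine x (head_bound x) (cfg (Ready ?c) h (tapes bss) w) t2 (cfg (Ready r) h' (tapes bss2) w')"
    using branch.hyps(3)[OF _ branch.prems(2,3)] by blast
  have "t1 + t2 \<le> Suc t * (2 * length x + 5)" using t1(1) t2(1) by simp
  then show ?case using path_trans[OF t1(2) t2(4)] t2(2,3) by blast
qed

lemma machine_halts:
  assumes "ends x c0 (0, \<lambda>_. 0, []) t (h, s, w)"
  shows "\<exists>t' \<le> t * (2 * length x + 5) + 1. halts_with machine x t' w \<and>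
    work_space_le machine x (4 * log 2 (real (length x) + 2))"
proof -
  let ?T = "tapes (\<lambda>_. [])" and ?B = "head_bound x"
  have "represents x (\<lambda>_. []) (\<lambda>_. 0)" by (simp add: represents_def short_def)
  from simulate_ends[OF assms residuals_self _ this] obtain t' r bss
    where t': "t' \<le> t * (2 * length x + 5)" "r \<in> residuals c0" "node r = Halt"
    and pt: "path machine x ?B (cfg (Ready c0) 0 ?T []) t' (cfg (Ready r) h (tapes bss) w)"
    by auto
  have "step machine x (init_config machine) = Some (cfg (Ready c0) 0 ?T [])"
    by (auto simp: step_def init_config_def machine_def cfg_def tapes_def map2_map_map tape_of_def
        fun_eq_iff intro!: nth_equalityI)
  moreover have "\<forall>(_, h) \<in> set (work (init_config machine)). h < ?B"
    by (auto simp: init_config_def head_bound_def)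
  ultimately have "path machine x ?B (init_config machine) (Suc t') (cfg (Ready r) h (tapes bss) w)"
    using pt by (auto intro: path.go)
  moreover have "step machine x (cfg (Ready r) h (tapes bss) w) = None"
    using t' code[of "Ready r"] by (simp add: step_def machine_def cfg_def)
  \<comment> \<open>The logarithm of \<open>length x + 2\<close> is at least 1, so three further
    copies of it absorb the additive 3.\<close>
  moreover have "real ?B \<le> 4 * log 2 (real (length x) + 2)"
  proof -
    have "log 2 2 \<le> log 2 (real (length x) + 2)" by (subst log_le_cancel_iff) auto
    moreover have "log 2 (real (length x) + 1) \<le> log 2 (real (length x) + 2)"
      by (subst log_le_cancel_iff) auto
    moreover have "0 \<le> log 2 (real (length x) + 1)" by (subst zero_le_log_cancel_iff) auto
    then have "real (nat \<lfloor>log 2 (real (length x) + 1)\<rfloor>) \<le> log 2 (real (length x) + 1)"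
      by (rule of_nat_floor)
    moreover have "real ?B = real (nat \<lfloor>log 2 (real (length x) + 1)\<rfloor>) + 3"
      by (simp add: head_bound_def add.commute)
    ultimately show ?thesis using log_eq_one[of 2] by linarith
  qed
  ultimately have "halts_with machine x (Suc t') w \<and> work_space_le machine x (4 * log 2 (real (length x) + 2))"
    using path_halts[of machine x ?B "Suc t'" "cfg (Ready r) h (tapes bss) w"]
    by (simp add: cfg_def del: config.simps) (simp add: config.simps)
  then show ?thesis using t'(1) by (intro exI[of _ "Suc t'"]) auto
qed

end

text \<open>The hypothesis asks for termination with the right output and mentions no bound at all:
  the time comes from \<open>ends_time_le\<close>, the space from the range of the counters enforced
  by \<open>ends\<close>.\<close>

theorem logspace_polytime_computable_com:
  fixes f :: "'a::finite list \<Rightarrow> 'b::finite list"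
  assumes "\<And>x. \<exists>t h s. ends x c (0, \<lambda>_. 0, []) t (h, s, f x)"
  shows "logspace_polytime_computable f"
proof -
  obtain k where "\<forall>i\<in>counters c. i < k"
    using finite_counters[of c] unfolding finite_nat_set_iff_bounded ..
  then have k: "counters c \<subseteq> {..<k}" by blast
  define K where "K = card (controls k c)"
  obtain code where code: "bij_betw code (controls k c) {0..<K}"
    using ex_bij_betw_finite_nat[OF finite_controls] K_def by blast
  interpret simulation c k code "inv_into (controls k c) code" K
  proof
    show "counters c \<subseteq> {..<k}" by (rule k)
    show "code q < K \<and> inv_into (controls k c) code (code q) = q" if "q \<in> controls k c" for q
      using code that by (auto simp: bij_betw_def)
    show "inv_into (controls k c) code n \<in> controls k c" if "n < K" for n
      using code that by (auto simp: bij_betw_def intro: inv_into_into)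
  qed
  \<comment> \<open>The factors come from \<open>length x + 2 \<le> 2 * (length x + 1)\<close> and
    \<open>2 * length x + 5 \<le> 5 * (length x + 1)\<close>; the final 1 pays for the step that
    writes the marks.\<close>
  define a where "a = card (residuals c) * 2 ^ (k + 1) * 5 + 1"
  have "(\<exists>t \<le> a * (length x + 1) ^ (k + 2). halts_with machine x t (f x)) \<and>
      work_space_le machine x (4 * log 2 (real (length x) + 2))" for x
  proof -
    obtain t h s where e: "ends x c (0, \<lambda>_. 0, []) t (h, s, f x)" using assms by blast
    have "t \<le> card (residuals c) * (length x + 2) ^ (k + 1)"
      by (rule ends_time_le[OF e _ k]) (simp add: bounded_def)
    also have "\<dots> \<le> card (residuals c) * (2 * (length x + 1)) ^ (k + 1)"
      by (intro mult_le_mono2 power_mono) auto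
    finally have "t * (2 * length x + 5) \<le>
        (card (residuals c) * (2 * (length x + 1)) ^ (k + 1)) * (5 * (length x + 1))"
      by (intro mult_le_mono) auto
    also have "\<dots> = card (residuals c) * 2 ^ (k + 1) * 5 * (length x + 1) ^ (k + 2)"
      by (simp only: power_mult_distrib power_Suc add_2_eq_Suc' Suc_eq_plus1[symmetric]) (simp only: mult_ac)
    finally have "t * (2 * length x + 5) + 1 \<le> a * (length x + 1) ^ (k + 2)"
      unfolding a_def add_mult_distrib using one_le_power[of "length x + 1" "k + 2"] by linarith
    then show ?thesis using machine_halts[OF e] by (meson le_trans)
  qed
  then show ?thesis unfolding logspace_polytime_computable_def using wf_machine by blast
qed

section \<open>Basic counter programs\<close>

definition exec :: "'a list \<Rightarrow> ('a, 'b) com \<Rightarrow> 'b store \<Rightarrow> 'b store \<Rightarrow> bool" where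
  "exec x c st st' \<longleftrightarrow> (\<exists>t. ends x c st t st')"

lemma exec_Skip: "exec x Skip st st"
  unfolding exec_def by (intro exI, rule ends.halt) simp

lemma exec_Skip_eq: "st = st' \<Longrightarrow> exec x Skip st st'"
  by (simp add: exec_Skip)

lemma exec_Do: "perform x a st = Some st' \<Longrightarrow> exec x (Do a) st st'"
  unfolding exec_def by (intro exI, rule ends.act[OF _ _ ends.halt]) auto

lemma ends_node_cong: "ends x d st t st' \<Longrightarrow> node c = node d \<Longrightarrow> ends x c st t st'"
  by (erule ends_cases) (auto intro: ends.intros)

lemma ends_Seq:
  "ends x c st t st' \<Longrightarrow> ends x d st' t' st'' \<Longrightarrow> \<exists>t''. ends x (c ;; d) st t'' st''"
proof (induction rule: ends.induct)
  case (halt c st)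
  have "node (c ;; d) = node d" using halt(1) by simp
  then show ?case using ends_node_cong[OF halt(2)] by blast
next
  case (act c a c' st st1 t st2)
  then show ?case using ends.act[of "c ;; d" a "c' ;; d"] by fastforce
next
  case (branch c b c1 c2 st t st2)
  then obtain t'' where "ends x ((if holds x b st then c1 else c2) ;; d) st t'' st''" by blast
  then have "ends x (if holds x b st then c1 ;; d else c2 ;; d) st t'' st''"
    by (simp split: if_splits)
  then show ?case using ends.branch[of "c ;; d" b "c1 ;; d" "c2 ;; d"] branch.hyps(1) by fastforce
qed

lemma exec_Seq: "exec x c st st' \<Longrightarrow> exec x d st' st'' \<Longrightarrow> exec x (c ;; d) st st''"
  unfolding exec_def using ends_Seq by blast

lemma exec_Do_Seq: "perform x a st = Some st' \<Longrightarrow> exec x d st' st'' \<Longrightarrow> exec x (Do a ;; d) st st''"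
  by (rule exec_Seq[OF exec_Do])

lemma exec_branch:
  "node c = Branch b c1 c2 \<Longrightarrow> exec x (if holds x b st then c1 else c2) st st' \<Longrightarrow> exec x c st st'"
  unfolding exec_def by (elim exE, rule exI, rule ends.branch)

lemma exec_Cond: "exec x (if holds x b st then c else d) st st' \<Longrightarrow> exec x (Cond b c d) st st'"
  by (rule exec_branch) auto

lemma exec_Loop_end: "\<not> holds x b st \<Longrightarrow> exec x (Loop b c) st st"
  by (rule exec_branch) (auto intro: exec_Skip)

lemma exec_Loop:
  "holds x b st \<Longrightarrow> exec x c st st' \<Longrightarrow> exec x (Loop b c) st' st'' \<Longrightarrow> exec x (Loop b c) st st''"
  by (rule exec_branch) (auto intro: exec_Seq)

text \<open>The store after each round is given explicitly by S, so that loops are treated by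
  computation with stores instead of invariants.\<close>

lemma exec_iterate:
  assumes "\<And>m. m < n \<Longrightarrow> holds x b (S m) \<and> exec x c (S m) (S (Suc m))" "\<not> holds x b (S n)"
  shows "exec x (Loop b c) (S 0) (S n)"
  using assms
proof (induction n arbitrary: S)
  case 0
  then show ?case by (auto intro: exec_Loop_end)
next
  case (Suc n)
  have "exec x (Loop b c) (S (Suc 0)) (S (Suc n))"
    by (rule Suc.IH[of "\<lambda>m. S (Suc m)"]) (use Suc.prems in auto)
  then show ?case using Suc.prems(1)[of 0] exec_Loop by blast
qed

definition clear :: "nat \<Rightarrow> ('a, 'b) com" where
  "clear i = Loop (NonZero i) (Do (Dec i))"

lemma exec_clear: "exec x (clear i) (h, s, w) (h, s(i := 0), w)"
proof -
  let ?S = "\<lambda>m. (h, s(i := s i - m), w)"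
  have "exec x (clear i) (?S 0) (?S (s i))"
    unfolding clear_def by (rule exec_iterate) (auto intro!: exec_Do simp: fun_eq_iff)
  then show ?thesis by simp
qed

text \<open>Counter 0 holds results of tests and counters 1 to 4 are temporary; counter 1 remembers
  the position of the input head on its way back to the left end.\<close>

definition goto :: "nat \<Rightarrow> ('a, 'b) com" where
  "goto i = Loop (NonZero i) (Do (Dec i) ;; Do (Inc 1) ;; Do GoRight)"

definition rewind :: "('a, 'b) com" where
  "rewind = Loop (Head (- {LeftEnd})) (Do GoLeft)"

text \<open>Using a counter as an address destroys it, since \<open>goto\<close> drains it into
  counter 1. Adding counter 1 back restores the address, wherever the head has wandered in the
  meantime.\<close>

definition home :: "nat \<Rightarrow> ('a, 'b) com" where
  "home i = rewind ;; Loop (NonZero 1) (Do (Dec 1) ;; Do (Inc i))"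

lemma exec_goto:
  assumes "s 1 = 0" "i \<noteq> 1" "s i \<le> length x + 1"
  shows "exec x (goto i) (0, s, w) (s i, s(i := 0, 1 := s i), w)"
proof -
  let ?S = "\<lambda>m. (m, s(i := s i - m, 1 := m), w)"
  have "exec x (goto i) (?S 0) (?S (s i))"
    unfolding goto_def
    by (rule exec_iterate) (use assms in \<open>auto intro!: exec_Do_Seq exec_Do simp: fun_eq_iff\<close>)
  moreover have "s(i := s i - 0, 1 := 0) = s" using assms by (auto simp: fun_eq_iff)
  ultimately show ?thesis by simp
qed

lemma read_input_LeftEnd: "read_input x h = LeftEnd \<longleftrightarrow> h = 0"
  by (auto simp: read_input_def)

lemma read_input_RightEnd: "read_input x h = RightEnd \<longleftrightarrow> length x < h"
  by (auto simp: read_input_def)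

lemma exec_rewind: "exec x rewind (h, s, w) (0, s, w)"
proof -
  let ?S = "\<lambda>m. (h - m, s, w)"
  have "exec x rewind (?S 0) (?S h)"
    unfolding rewind_def by (rule exec_iterate) (auto intro!: exec_Do simp: read_input_LeftEnd)
  then show ?thesis by simp
qed

lemma exec_home:
  assumes "s i + s 1 \<le> length x + 1" "i \<noteq> 1"
  shows "exec x (home i) (h, s, w) (0, s(i := s i + s 1, 1 := 0), w)"
  unfolding home_def
proof (rule exec_Seq[OF exec_rewind])
  let ?S = "\<lambda>m. (0, s(i := s i + m, 1 := s 1 - m), w)"
  have "exec x (Loop (NonZero 1) (Do (Dec 1) ;; Do (Inc i))) (?S 0) (?S (s 1))"
    by (rule exec_iterate) (use assms in \<open>auto intro!: exec_Do_Seq exec_Do simp: fun_eq_iff\<close>)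
  then show "exec x (Loop (NonZero 1) (Do (Dec 1) ;; Do (Inc i))) (0, s, w)
      (0, s(i := s i + s 1, 1 := 0), w)" by simp
qed

lemma exec_home_goto:
  assumes "s 1 = 0" "i \<noteq> 1" "s i \<le> length x + 1"
  shows "exec x (home i) (h, s(i := 0, 1 := s i), w) (0, s, w)"
proof -
  have "s(i := 0, 1 := s i, i := 0 + s i, 1 := 0) = s" using assms by (auto simp: fun_eq_iff)
  then show ?thesis using exec_home[of "s(i := 0, 1 := s i)" i x h w] assms by simp
qed

definition ifsym :: "nat \<Rightarrow> 'a cell set \<Rightarrow> ('a, 'b) com \<Rightarrow> ('a, 'b) com \<Rightarrow> ('a, 'b) com" where
  "ifsym i A c d = goto i ;; Cond (Head A) (home i ;; c) (home i ;; d)"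

lemma exec_ifsym:
  assumes "s 1 = 0" "i \<noteq> 1" "s i \<le> length x + 1"
    and "exec x (if read_input x (s i) \<in> A then c else d) (0, s, w) st"
  shows "exec x (ifsym i A c d) (0, s, w) st"
  unfolding ifsym_def
  by (rule exec_Seq[OF exec_goto], (rule assms)+, rule exec_Cond)
    (use assms in \<open>auto intro: exec_Seq[OF exec_home_goto] simp del: One_nat_def\<close>)

definition copy :: "nat \<Rightarrow> nat \<Rightarrow> ('a, 'b) com" where
  "copy i j = clear j ;; Loop (NonZero i) (Do (Dec i) ;; Do (Inc 1) ;; Do (Inc j)) ;;
     Loop (NonZero 1) (Do (Dec 1) ;; Do (Inc i))"

lemma exec_copy:
  assumes "s 1 = 0" "i \<noteq> 1" "j \<noteq> 1" "i \<noteq> j" "s i \<le> length x + 1"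
  shows "exec x (copy i j) (h, s, w) (h, s(j := s i), w)"
  unfolding copy_def
proof (intro exec_Seq)
  show "exec x (clear j) (h, s, w) (h, s(j := 0), w)" by (rule exec_clear)
  let ?S = "\<lambda>m. (h, s(i := s i - m, 1 := m, j := m), w)"
  have "exec x (Loop (NonZero i) (Do (Dec i) ;; Do (Inc 1) ;; Do (Inc j))) (?S 0) (?S (s i))"
    by (rule exec_iterate) (use assms in \<open>auto intro!: exec_Do_Seq exec_Do simp: fun_eq_iff\<close>)
  moreover have "s(i := s i - 0, 1 := 0, j := 0) = s(j := 0)" using assms by (auto simp: fun_eq_iff)
  ultimately show "exec x (Loop (NonZero i) (Do (Dec i) ;; Do (Inc 1) ;; Do (Inc j)))
      (h, s(j := 0), w) (h, s(i := 0, 1 := s i, j := s i), w)" by simp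
  let ?S = "\<lambda>m. (h, s(i := m, 1 := s i - m, j := s i), w)"
  have "exec x (Loop (NonZero 1) (Do (Dec 1) ;; Do (Inc i))) (?S 0) (?S (s i))"
    by (rule exec_iterate) (use assms in \<open>auto intro!: exec_Do_Seq exec_Do simp: fun_eq_iff\<close>)
  moreover have "s(i := s i, 1 := s i - s i, j := s i) = s(j := s i)" using assms by (auto simp: fun_eq_iff)
  ultimately show "exec x (Loop (NonZero 1) (Do (Dec 1) ;; Do (Inc i)))
      (h, s(i := 0, 1 := s i, j := s i), w) (h, s(j := s i), w)" by simp
qed

text \<open>The loop is a truncated subtraction: it leaves in counter 3 the second value minus the
  first, which is positive exactly if the first is smaller.\<close>

definition put_less :: "nat \<Rightarrow> nat \<Rightarrow> ('a, 'b) com" where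
  "put_less i j = copy i 2 ;; copy j 3 ;;
     Loop (NonZero 2) (Do (Dec 2) ;; Cond (NonZero 3) (Do (Dec 3)) Skip) ;;
     Cond (NonZero 3) (Do (Inc 0) ;; clear 3) Skip"

lemma exec_put_less:
  assumes "\<forall>l<5. s l = 0" "4 < i" "4 < j" "s i \<le> length x + 1" "s j \<le> length x + 1"
  shows "exec x (put_less i j) (h, s, w) (h, s(0 := of_bool (s i < s j)), w)"
  unfolding put_less_def
proof (intro exec_Seq)
  show "exec x (copy i 2) (h, s, w) (h, s(2 := s i), w)" by (rule exec_copy) (use assms in auto)
  have "exec x (copy j 3) (h, s(2 := s i), w) (h, (s(2 := s i))(3 := (s(2 := s i)) j), w)"
    by (rule exec_copy) (use assms in auto)
  then show "exec x (copy j 3) (h, s(2 := s i), w) (h, s(2 := s i, 3 := s j), w)" using assms by simp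
  let ?S = "\<lambda>m. (h, s(2 := s i - m, 3 := s j - m), w)"
  have "exec x (Loop (NonZero 2) (Do (Dec 2) ;; Cond (NonZero 3) (Do (Dec 3)) Skip)) (?S 0) (?S (s i))"
    by (rule exec_iterate)
      (use assms in \<open>auto intro!: exec_Do_Seq exec_Cond exec_Do exec_Skip_eq simp: fun_eq_iff\<close>)
  then show "exec x (Loop (NonZero 2) (Do (Dec 2) ;; Cond (NonZero 3) (Do (Dec 3)) Skip))
      (h, s(2 := s i, 3 := s j), w) (h, s(2 := 0, 3 := s j - s i), w)" by simp
  show "exec x (Cond (NonZero 3) (Do (Inc 0) ;; clear 3) Skip) (h, s(2 := 0, 3 := s j - s i), w)
      (h, s(0 := of_bool (s i < s j)), w)"
  proof (rule exec_Cond, cases "s i < s j")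
    case True
    have "exec x (clear 3) (h, s(2 := 0, 3 := s j - s i, 0 := 1), w)
        (h, (s(2 := 0, 3 := s j - s i, 0 := 1))(3 := 0), w)" by (rule exec_clear)
    moreover have "(s(2 := 0, 3 := s j - s i, 0 := 1))(3 := 0) = s(0 := 1)"
      using assms(1) by (auto simp: fun_eq_iff)
    ultimately show "exec x (if holds x (NonZero 3) (h, s(2 := 0, 3 := s j - s i), w)
        then Do (Inc 0) ;; clear 3 else Skip) (h, s(2 := 0, 3 := s j - s i), w)
        (h, s(0 := of_bool (s i < s j)), w)"
      using True assms(1) by (auto intro!: exec_Do_Seq)
  next
    case False
    moreover have "s(2 := 0, 3 := 0) = s(0 := 0)" using assms(1) by (auto simp: fun_eq_iff)
    ultimately show "exec x (if holds x (NonZero 3) (h, s(2 := 0, 3 := s j - s i), w)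
        then Do (Inc 0) ;; clear 3 else Skip) (h, s(2 := 0, 3 := s j - s i), w)
        (h, s(0 := of_bool (s i < s j)), w)"
      using assms(1) by (auto intro!: exec_Skip)
  qed
qed

fun emit_all :: "'b list \<Rightarrow> ('a, 'b) com" where
  "emit_all [] = Skip"
| "emit_all (b # bs) = Do (Emit b) ;; emit_all bs"

lemma exec_emit_all: "exec x (emit_all bs) (h, s, w) (h, s, w @ bs)"
proof (induction bs arbitrary: w)
  case Nil
  then show ?case by (simp add: exec_Skip)
next
  case (Cons b bs)
  then show ?case using Cons[of "w @ [b]"] by (auto intro: exec_Do_Seq)
qed

section \<open>Words of named tokens\<close>

text \<open>\<open>bit\<close> writes the bits of names in the input alphabet and \<open>enc\<close>
  in the output alphabet. Names are read and compared only through \<open>bit\<close>, whence its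
  injectivity; \<open>enc\<close> serves for printing copies.\<close>

locale coding =
  fixes bit :: "bool \<Rightarrow> 'a::finite" and enc :: "bool \<Rightarrow> 'b::finite"
  assumes inj_bit: "inj bit"
begin

definition word :: "('a \<times> name) list \<Rightarrow> 'a list" where
  "word ts = concat (map (\<lambda>(m, u). m # map bit u) ts)"

definition marked :: "('a \<times> name) list \<Rightarrow> bool" where
  "marked ts \<longleftrightarrow> (\<forall>t\<in>set ts. fst t \<notin> range bit)"

text \<open>The last condition makes u maximal, so that a scan can recognise the end of the name, be
  it a marker or the right end of the tape.\<close>

definition name_at :: "'a list \<Rightarrow> nat \<Rightarrow> name \<Rightarrow> bool" where
  "name_at x p u \<longleftrightarrow> p + length u \<le> length x \<and>
     (\<forall>m<length u. read_input x (Suc (p + m)) = Symbol (bit (u ! m))) \<and>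
     read_input x (Suc (p + length u)) \<notin> Symbol ` range bit"

lemma bit_eq_iff [simp]: "bit a = bit b \<longleftrightarrow> a = b"
  using inj_bit by (auto simp: inj_eq)

definition put_mark :: "'a set \<Rightarrow> nat \<Rightarrow> ('a, 'b) com" where
  "put_mark A i = ifsym i (Symbol ` A) (Do (Inc 0)) Skip"

lemma exec_put_mark:
  assumes "\<forall>l<5. s l = 0" "4 < i" "s i \<le> length x + 1"
  shows "exec x (put_mark A i) (0, s, w) (0, s(0 := of_bool (read_input x (s i) \<in> Symbol ` A)), w)"
proof -
  have "s(0 := 0) = s" using assms by auto
  then show ?thesis unfolding put_mark_def
    by (intro exec_ifsym) (use assms in \<open>auto intro!: exec_Do exec_Skip\<close>)
qed

definition put_bare :: "nat \<Rightarrow> ('a, 'b) com" where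
  "put_bare i = goto i ;; Do GoRight ;;
     Cond (Head (Symbol ` range bit)) (home i) (home i ;; Do (Inc 0))"

lemma exec_put_bare:
  assumes "\<forall>l<5. s l = 0" "4 < i" "s i \<le> length x" "name_at x (s i) u"
  shows "exec x (put_bare i) (0, s, w) (0, s(0 := of_bool (u = [])), w)"
  unfolding put_bare_def
proof (rule exec_Seq[OF exec_goto])
  have bits: "read_input x (Suc (s i)) \<in> Symbol ` range bit \<longleftrightarrow> u \<noteq> []"
    using assms(4) by (cases u) (auto simp: name_at_def)
  have home: "exec x (home i) (Suc (s i), s(i := 0, 1 := s i), w) (0, s, w)"
    by (rule exec_home_goto) (use assms in auto)
  have 0: "s(0 := 0) = s" using assms by auto
  show "exec x (Do GoRight ;; Cond (Head (Symbol ` range bit)) (home i) (home i ;; Do (Inc 0)))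
     (s i, s(i := 0, 1 := s i), w) (0, s(0 := of_bool (u = [])), w)"
    by (rule exec_Do_Seq, simp, rule exec_Cond)
      (use assms bits home 0 in \<open>auto intro!: exec_Seq[OF home[unfolded One_nat_def]] exec_Do\<close>)
qed (use assms in auto)

definition put_name :: "nat \<Rightarrow> ('a, 'b) com" where
  "put_name i = goto i ;; Do GoRight ;;
     Loop (Head (Symbol ` range bit))
       (Cond (Head {Symbol (bit True)}) (Do (Emit (enc True))) (Do (Emit (enc False))) ;; Do GoRight) ;;
     home i"

lemma exec_put_name:
  assumes "s 1 = 0" "4 < i" "s i \<le> length x" "name_at x (s i) u"
  shows "exec x (put_name i) (0, s, w) (0, s, w @ map enc u)"
  unfolding put_name_def
proof (intro exec_Seq)
  let ?s = "s(i := 0, 1 := s i)"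
  show "exec x (goto i) (0, s, w) (s i, ?s, w)" by (rule exec_goto) (use assms in auto)
  show "exec x (Do GoRight) (s i, ?s, w) (Suc (s i), ?s, w)" by (rule exec_Do) (use assms in auto)
  let ?L = "Loop (Head (Symbol ` range bit))
    (Cond (Head {Symbol (bit True)}) (Do (Emit (enc True))) (Do (Emit (enc False))) ;; Do GoRight)"
  let ?S = "\<lambda>m. (Suc (s i + m), ?s, w @ map enc (take m u))"
  have "exec x ?L (?S 0) (?S (length u))"
  proof (rule exec_iterate, intro conjI)
    fix m assume m: "m < length u"
    then have r: "read_input x (Suc (s i + m)) = Symbol (bit (u ! m))"
      using assms(4) by (simp add: name_at_def)
    then show "holds x (Head (Symbol ` range bit)) (?S m)" by simp
    have t: "map enc (take (Suc m) u) = map enc (take m u) @ [enc (u ! m)]"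
      using m by (simp add: take_Suc_conv_app_nth)
    have le: "Suc (s i + m) \<le> length x" using m assms(4) by (simp add: name_at_def)
    show "exec x (Cond (Head {Symbol (bit True)}) (Do (Emit (enc True))) (Do (Emit (enc False))) ;; Do GoRight)
        (?S m) (?S (Suc m))"
      by (rule exec_Seq[where st' = "(Suc (s i + m), ?s, w @ map enc (take (Suc m) u))"])
        (use r le t in \<open>auto intro!: exec_Cond exec_Do\<close>)
  next
    show "\<not> holds x (Head (Symbol ` range bit)) (?S (length u))"
      using assms(4) by (simp add: name_at_def)
  qed
  then show "exec x ?L (Suc (s i), ?s, w) (Suc (s i + length u), ?s, w @ map enc u)" by simp
  show "exec x (home i) (Suc (s i + length u), ?s, w @ map enc u) (0, s, w @ map enc u)"
    by (rule exec_home_goto) (use assms in auto)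
qed

text \<open>Counter 4 tells whether to go on and counter 0 holds the verdict; both start at 1.
  Different bits, or a name that ends before the other, clear both counters, while a simultaneous
  end clears only counter 4.\<close>

definition same_step :: "('a, 'b) com" where
  "same_step = Do (Inc 2) ;; Do (Inc 3) ;;
     ifsym 2 {Symbol (bit True)} (ifsym 3 {Symbol (bit True)} Skip (Do (Dec 4) ;; Do (Dec 0)))
       (ifsym 2 {Symbol (bit False)} (ifsym 3 {Symbol (bit False)} Skip (Do (Dec 4) ;; Do (Dec 0)))
         (ifsym 3 (Symbol ` range bit) (Do (Dec 4) ;; Do (Dec 0)) (Do (Dec 4))))"

definition put_same :: "nat \<Rightarrow> nat \<Rightarrow> ('a, 'b) com" where
  "put_same i j = copy i 2 ;; copy j 3 ;; Do (Inc 4) ;; Do (Inc 0) ;;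
     Loop (NonZero 4) same_step ;; clear 2 ;; clear 3"

lemma exec_same_step:
  assumes "name_at x p u" "name_at x q v" "m \<le> length u" "m \<le> length v"
    and "s 0 = 1" "s 1 = 0" "s 2 = p + m" "s 3 = q + m" "s 4 = 1"
  shows "exec x same_step (0, s, w) (0, s(2 := Suc (p + m), 3 := Suc (q + m),
    4 := of_bool (m < length u \<and> m < length v \<and> u ! m = v ! m),
    0 := of_bool (m < length u \<and> m < length v \<and> u ! m = v ! m \<or> m = length u \<and> m = length v)), w)"
proof -
  define s' where "s' = s(2 := Suc (p + m), 3 := Suc (q + m))"
  have le: "p + m \<le> length x" "q + m \<le> length x" using assms by (auto simp: name_at_def)
  have u: "read_input x (Suc (p + m)) = (if m < length u then Symbol (bit (u ! m)) else read_input x (Suc (p + m)))"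
    "m \<ge> length u \<Longrightarrow> read_input x (Suc (p + m)) \<notin> Symbol ` range bit"
    using assms by (auto simp: name_at_def)
  have v: "read_input x (Suc (q + m)) = (if m < length v then Symbol (bit (v ! m)) else read_input x (Suc (q + m)))"
    "m \<ge> length v \<Longrightarrow> read_input x (Suc (q + m)) \<notin> Symbol ` range bit"
    using assms by (auto simp: name_at_def)
  have s': "s' 0 = 1" "s' 1 = 0" "s' 2 = Suc (p + m)" "s' 3 = Suc (q + m)" "s' 4 = 1"
    using assms by (auto simp: s'_def)
  let ?e = "m < length u \<and> m < length v \<and> u ! m = v ! m"
  let ?t = "m = length u \<and> m = length v"
  have good: "s'(4 := 1, 0 := 1) = s'" using s' by (auto simp: fun_eq_iff)
  have skip: "exec x Skip (0, s', w) (0, s'(4 := 1, 0 := 1), w)"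
    unfolding good by (rule exec_Skip)
  have bad: "exec x (Do (Dec 4) ;; Do (Dec 0)) (0, s', w) (0, s'(4 := 0, 0 := 0), w)"
    using s' by (auto intro!: exec_Do_Seq exec_Do)
  have "s'(4 := 0, 0 := 1) = s'(4 := 0)" using s' by (auto simp: fun_eq_iff)
  then have fin: "exec x (Do (Dec 4)) (0, s', w) (0, s'(4 := 0, 0 := 1), w)"
    using s' by (auto intro!: exec_Do)
  define G where "G = (0 :: nat, s'(4 := of_bool ?e, 0 := of_bool (?e \<or> ?t)), w)"
  have ifs2: "exec x (ifsym 2 A c d) (0, s', w) st"
    if "exec x (if read_input x (Suc (p + m)) \<in> A then c else d) (0, s', w) st" for A c d st
    by (rule exec_ifsym) (use that s' le in simp_all)
  have ifs3: "exec x (ifsym 3 A c d) (0, s', w) st"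
    if "exec x (if read_input x (Suc (q + m)) \<in> A then c else d) (0, s', w) st" for A c d st
    by (rule exec_ifsym) (use that s' le in simp_all)
  have "exec x (ifsym 2 {Symbol (bit True)} (ifsym 3 {Symbol (bit True)} Skip (Do (Dec 4) ;; Do (Dec 0)))
       (ifsym 2 {Symbol (bit False)} (ifsym 3 {Symbol (bit False)} Skip (Do (Dec 4) ;; Do (Dec 0)))
         (ifsym 3 (Symbol ` range bit) (Do (Dec 4) ;; Do (Dec 0)) (Do (Dec 4)))))
     (0, s', w) G"
  proof (cases "m < length u")
    case True
    then have ru: "read_input x (Suc (p + m)) = Symbol (bit (u ! m))" using u by simp
    have rv: "read_input x (Suc (q + m)) = Symbol (bit b) \<longleftrightarrow> m < length v \<and> v ! m = b" for b
      using v by (cases "m < length v") auto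
    have "exec x (ifsym 3 {Symbol (bit (u ! m))} Skip (Do (Dec 4) ;; Do (Dec 0))) (0, s', w) G"
      unfolding G_def
      by (rule ifs3, cases "m < length v \<and> v ! m = u ! m") (use True rv[of "u ! m"] skip bad in auto)
    then show ?thesis
      by (cases "u ! m") (auto intro!: ifs2 simp: ru)
  next
    case False
    then have ru: "read_input x (Suc (p + m)) \<notin> Symbol ` range bit" using u by simp
    then have ru': "read_input x (Suc (p + m)) \<noteq> Symbol (bit b)" for b by auto
    have rv: "read_input x (Suc (q + m)) \<in> Symbol ` range bit \<longleftrightarrow> m < length v"
      using v by (cases "m < length v") auto
    have "m = length u" using False assms(3) by simp
    then have "exec x (ifsym 3 (Symbol ` range bit) (Do (Dec 4) ;; Do (Dec 0)) (Do (Dec 4))) (0, s', w) G"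
      unfolding G_def
      by (intro ifs3, cases "m < length v") (use rv bad fin assms(4) in auto)
    then show ?thesis using ru' by (auto intro!: ifs2)
  qed
  then show ?thesis unfolding same_step_def G_def s'_def
    by (intro exec_Do_Seq) (use assms le in \<open>auto simp: numeral_eq_Suc\<close>)
qed

text \<open>The loop is entered after m equal bits. The final values of the scanning counters 2 and
  3 depend on the place of the first difference and are left unspecified, because they are cleared
  afterwards.\<close>

lemma exec_same_loop:
  assumes "name_at x p u" "name_at x q v" "m \<le> length u" "m \<le> length v" "take m u = take m v"
    and "s 0 = 1" "s 1 = 0" "s 2 = p + m" "s 3 = q + m" "s 4 = 1"
  shows "\<exists>a b. exec x (Loop (NonZero 4) same_step) (0, s, w)
    (0, s(2 := a, 3 := b, 4 := 0, 0 := of_bool (u = v)), w)"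
  using assms
proof (induction "length u - m" arbitrary: m s)
  case (0 m s)
  then have m: "m = length u" by simp
  then have eq: "u = v \<longleftrightarrow> m = length v" using 0 by auto
  have "exec x same_step (0, s, w) (0, s(2 := Suc (p + m), 3 := Suc (q + m),
      4 := of_bool (m < length u \<and> m < length v \<and> u ! m = v ! m),
      0 := of_bool (m < length u \<and> m < length v \<and> u ! m = v ! m \<or> m = length u \<and> m = length v)), w)"
    by (rule exec_same_step) (use 0 in auto)
  then have "exec x same_step (0, s, w) (0, s(2 := Suc (p + m), 3 := Suc (q + m),
      4 := 0, 0 := of_bool (u = v)), w)"
    using m eq by simp
  then have "exec x (Loop (NonZero 4) same_step) (0, s, w) (0, s(2 := Suc (p + m), 3 := Suc (q + m),
      4 := 0, 0 := of_bool (u = v)), w)"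
    by (rule exec_Loop[rotated]) (use 0 in \<open>auto intro!: exec_Loop_end\<close>)
  then show ?case by blast
next
  case (Suc n m s)
  then have m: "m < length u" by simp
  let ?e = "m < length v \<and> u ! m = v ! m"
  let ?s = "s(2 := Suc (p + m), 3 := Suc (q + m), 4 := of_bool ?e, 0 := of_bool ?e)"
  have "exec x same_step (0, s, w) (0, s(2 := Suc (p + m), 3 := Suc (q + m),
      4 := of_bool (m < length u \<and> m < length v \<and> u ! m = v ! m),
      0 := of_bool (m < length u \<and> m < length v \<and> u ! m = v ! m \<or> m = length u \<and> m = length v)), w)"
    by (rule exec_same_step) (use Suc in auto)
  then have step: "exec x same_step (0, s, w) (0, ?s, w)" using m by simp
  show ?case
  proof (cases ?e)
    case True
    have "\<exists>a b. exec x (Loop (NonZero 4) same_step) (0, ?s, w)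
      (0, ?s(2 := a, 3 := b, 4 := 0, 0 := of_bool (u = v)), w)"
      by (rule Suc.hyps(1)[of "Suc m"])
        (use Suc.hyps(2) Suc.prems True m in \<open>auto simp: take_Suc_conv_app_nth\<close>)
    then obtain a b where "exec x (Loop (NonZero 4) same_step) (0, ?s, w)
      (0, ?s(2 := a, 3 := b, 4 := 0, 0 := of_bool (u = v)), w)" by blast
    moreover have "?s(2 := a, 3 := b, 4 := 0, 0 := of_bool (u = v)) =
        s(2 := a, 3 := b, 4 := 0, 0 := of_bool (u = v))" by (auto simp: fun_eq_iff)
    ultimately have "exec x (Loop (NonZero 4) same_step) (0, ?s, w)
      (0, s(2 := a, 3 := b, 4 := 0, 0 := of_bool (u = v)), w)" by simp
    then show ?thesis using exec_Loop[OF _ step] Suc.prems by (intro exI[of _ a] exI[of _ b]) simp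
  next
    case False
    then have "u \<noteq> v" using m by auto
    moreover have "exec x (Loop (NonZero 4) same_step) (0, ?s, w) (0, ?s, w)"
      using False by (intro exec_Loop_end) auto
    ultimately have "exec x (Loop (NonZero 4) same_step) (0, s, w)
        (0, s(2 := Suc (p + m), 3 := Suc (q + m), 4 := 0, 0 := of_bool (u = v)), w)"
      using exec_Loop[OF _ step] Suc.prems False by simp
    then show ?thesis by blast
  qed
qed

lemma exec_put_same:
  assumes "\<forall>l<5. s l = 0" "4 < i" "4 < j" "name_at x (s i) u" "name_at x (s j) v"
  shows "exec x (put_same i j) (0, s, w) (0, s(0 := of_bool (u = v)), w)"
proof -
  let ?s = "s(2 := s i, 3 := s j, 4 := 1, 0 := 1)"
  have le: "s i \<le> length x" "s j \<le> length x" using assms by (auto simp: name_at_def)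
  have "\<exists>a b. exec x (Loop (NonZero 4) same_step) (0, ?s, w)
      (0, ?s(2 := a, 3 := b, 4 := 0, 0 := of_bool (u = v)), w)"
    by (rule exec_same_loop[where m = 0]) (use assms in auto)
  then obtain a b where loop: "exec x (Loop (NonZero 4) same_step) (0, ?s, w)
      (0, ?s(2 := a, 3 := b, 4 := 0, 0 := of_bool (u = v)), w)" by blast
  show ?thesis unfolding put_same_def
  proof (intro exec_Seq)
    show "exec x (copy i 2) (0, s, w) (0, s(2 := s i), w)" by (rule exec_copy) (use assms le in auto)
    have "exec x (copy j 3) (0, s(2 := s i), w) (0, (s(2 := s i))(3 := (s(2 := s i)) j), w)"
      by (rule exec_copy) (use assms le in auto)
    then show "exec x (copy j 3) (0, s(2 := s i), w) (0, s(2 := s i, 3 := s j), w)" using assms by simp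
    show "exec x (Do (Inc 4)) (0, s(2 := s i, 3 := s j), w) (0, s(2 := s i, 3 := s j, 4 := 1), w)"
      using assms by (intro exec_Do) auto
    show "exec x (Do (Inc 0)) (0, s(2 := s i, 3 := s j, 4 := 1), w) (0, ?s, w)"
      using assms by (intro exec_Do) auto
    show "exec x (Loop (NonZero 4) same_step) (0, ?s, w)
      (0, ?s(2 := a, 3 := b, 4 := 0, 0 := of_bool (u = v)), w)" by (rule loop)
    show "exec x (clear 2) (0, ?s(2 := a, 3 := b, 4 := 0, 0 := of_bool (u = v)), w)
      (0, (?s(2 := a, 3 := b, 4 := 0, 0 := of_bool (u = v)))(2 := 0), w)" by (rule exec_clear)
    have "((?s(2 := a, 3 := b, 4 := 0, 0 := of_bool (u = v)))(2 := 0))(3 := 0) = s(0 := of_bool (u = v))"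
      using assms(1) by (auto simp: fun_eq_iff)
    then show "exec x (clear 3) (0, (?s(2 := a, 3 := b, 4 := 0, 0 := of_bool (u = v)))(2 := 0), w)
      (0, s(0 := of_bool (u = v)), w)"
      using exec_clear[of x 3 0 "(?s(2 := a, 3 := b, 4 := 0, 0 := of_bool (u = v)))(2 := 0)" w] by simp
  qed
qed

section \<open>Positions of tokens and loops over them\<close>

lemma word_simps [simp]:
  "word [] = []" "word ((m, u) # ts) = m # map bit u @ word ts" "word (ts @ ts') = word ts @ word ts'"
  by (auto simp: word_def)

text \<open>The tape position of the marker of token t; the shift by one accounts for the left end
  marker at position 0.\<close>

definition pos :: "('a \<times> name) list \<Rightarrow> nat \<Rightarrow> nat" where
  "pos ts t = Suc (length (word (take t ts)))"

lemma pos_Suc: "t < length ts \<Longrightarrow> pos ts (Suc t) = Suc (pos ts t + length (snd (ts ! t)))"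
  by (cases "ts ! t") (simp add: pos_def take_Suc_conv_app_nth)

lemma pos_mono: "t < t' \<Longrightarrow> t' \<le> length ts \<Longrightarrow> pos ts t < pos ts t'"
proof (induction t' rule: less_induct)
  case (less t')
  then obtain t'' where t'': "t' = Suc t''" by (cases t') auto
  show ?case
  proof (cases "t = t''")
    case True
    then show ?thesis using t'' less.prems pos_Suc[of t'' ts] by simp
  next
    case False
    then have "pos ts t < pos ts t''" using less t'' by auto
    then show ?thesis using t'' less.prems pos_Suc[of t'' ts] by simp
  qed
qed

lemma pos_less_iff: "t < length ts \<Longrightarrow> t' < length ts \<Longrightarrow> pos ts t < pos ts t' \<longleftrightarrow> t < t'"
  using pos_mono[of t t' ts] pos_mono[of t' t ts] by (metis less_imp_le less_irrefl linorder_neqE_nat less_trans)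

lemma word_split:
  "t < length ts \<Longrightarrow> word ts = word (take t ts) @ fst (ts ! t) # map bit (snd (ts ! t)) @ word (drop (Suc t) ts)"
  by (subst id_take_nth_drop[of t ts], assumption) (cases "ts ! t", simp)

lemma word_start: "marked ts \<Longrightarrow> word ts = [] \<or> hd (word ts) \<notin> range bit"
  by (cases ts) (auto simp: marked_def)

lemma marked_drop: "marked ts \<Longrightarrow> marked (drop t ts)"
  by (auto simp: marked_def dest: in_set_dropD)

lemma read_input_word:
  assumes "t < length ts"
  shows "read_input (word ts) (pos ts t) = Symbol (fst (ts ! t))" "pos ts t \<le> length (word ts)"
proof -
  have "word ts = word (take t ts) @ fst (ts ! t) # map bit (snd (ts ! t)) @ word (drop (Suc t) ts)"
    by (rule word_split[OF assms])
  then show "read_input (word ts) (pos ts t) = Symbol (fst (ts ! t))" "pos ts t \<le> length (word ts)"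
    by (auto simp: read_input_def pos_def nth_append)
qed

lemma name_at_word:
  assumes "t < length ts" "marked ts"
  shows "name_at (word ts) (pos ts t) (snd (ts ! t))"
proof -
  let ?a = "word (take t ts)" and ?u = "snd (ts ! t)" and ?r = "word (drop (Suc t) ts)"
  have eq: "word ts = ?a @ fst (ts ! t) # map bit ?u @ ?r" by (rule word_split[OF assms(1)])
  have r: "?r = [] \<or> hd ?r \<notin> range bit" by (rule word_start[OF marked_drop[OF assms(2)]])
  show ?thesis
    unfolding name_at_def eq pos_def
  proof (intro conjI allI impI)
    fix m assume "m < length ?u"
    then show "read_input (?a @ fst (ts ! t) # map bit ?u @ ?r) (Suc (Suc (length ?a) + m)) = Symbol (bit (?u ! m))"
      by (auto simp: read_input_def nth_append)
  next
    show "read_input (?a @ fst (ts ! t) # map bit ?u @ ?r) (Suc (Suc (length ?a) + length ?u)) \<notin> Symbol ` range bit"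
      using r by (cases ?r) (auto simp: read_input_def nth_append)
  qed simp
qed

text \<open>Translates tape positions into token numbers: a scan visits all cells, but its effect
  changes only at markers.\<close>

definition passed :: "('a \<times> name) list \<Rightarrow> nat \<Rightarrow> nat" where
  "passed ts p = card {t. t < length ts \<and> pos ts t \<le> p}"

lemma passed_0: "passed ts 0 = 0"
  by (simp add: passed_def pos_def)

lemma passed_end: "passed ts (Suc (length (word ts))) = length ts"
proof -
  have "{t. t < length ts \<and> pos ts t \<le> Suc (length (word ts))} = {..<length ts}"
    using read_input_word(2) le_SucI by blast
  then show ?thesis by (simp add: passed_def)
qed

lemma passed_Suc:
  assumes "t < length ts" "pos ts t = Suc p"
  shows "passed ts p = t" "passed ts (Suc p) = Suc t"
proof -
  have "pos ts t' \<le> p \<longleftrightarrow> t' < t" if "t' < length ts" for t'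
    using assms that pos_less_iff[of t' ts t] by (simp add: less_Suc_eq_le)
  then have "{t'. t' < length ts \<and> pos ts t' \<le> p} = {..<t}"
    using assms(1) by auto
  then show "passed ts p = t" by (simp add: passed_def)
  have "pos ts t' \<le> Suc p \<longleftrightarrow> t' \<le> t" if "t' < length ts" for t'
    using assms that pos_less_iff[of t ts t'] by (simp flip: not_less)
  then have "{t'. t' < length ts \<and> pos ts t' \<le> Suc p} = {..t}"
    using assms(1) by auto
  then show "passed ts (Suc p) = Suc t" by (simp add: passed_def)
qed

lemma passed_Suc_other:
  assumes "\<And>t. t < length ts \<Longrightarrow> pos ts t \<noteq> Suc p"
  shows "passed ts (Suc p) = passed ts p"
proof -
  have "{t. t < length ts \<and> pos ts t \<le> Suc p} = {t. t < length ts \<and> pos ts t \<le> p}"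
    using assms le_Suc_eq by auto
  then show ?thesis by (simp add: passed_def)
qed

text \<open>The token of the last marker at or before p reaches at least to p. Its cells after the
  marker carry bits, so a symbol that is no bit can only be the marker itself.\<close>

lemma mark_position:
  assumes "marked ts" "1 \<le> p" "read_input (word ts) p \<in> Symbol ` (- range bit)"
  shows "\<exists>t<length ts. p = pos ts t"
proof -
  have "p \<le> length (word ts)" using assms(3) by (auto simp: read_input_def split: if_splits)
  have "pos ts 0 = 1" by (simp add: pos_def)
  have "ts \<noteq> []" using \<open>p \<le> length (word ts)\<close> assms(2) by auto
  define t where "t = (GREATEST t. t < length ts \<and> pos ts t \<le> p)"
  have t: "t < length ts \<and> pos ts t \<le> p" unfolding t_def
    by (rule GreatestI_nat[where k = 0 and b = "length ts"])
      (use \<open>ts \<noteq> []\<close> \<open>pos ts 0 = 1\<close> assms(2) in auto)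
  have max: "t' \<le> t" if "t' < length ts" "pos ts t' \<le> p" for t'
    unfolding t_def by (rule Greatest_le_nat[where b = "length ts"]) (use that in auto)
  have "p \<le> pos ts t + length (snd (ts ! t))"
  proof (cases "Suc t < length ts")
    case True
    then have "\<not> pos ts (Suc t) \<le> p" using max[of "Suc t"] by auto
    then show ?thesis using t pos_Suc[of t ts] by simp
  next
    case False
    then have "Suc t = length ts" using t by simp
    then have "pos ts (Suc t) = Suc (length (word ts))" by (simp add: pos_def)
    then show ?thesis using t pos_Suc[of t ts] \<open>p \<le> length (word ts)\<close> by simp
  qed
  moreover have "read_input (word ts) (Suc (pos ts t + m)) \<in> Symbol ` range bit"
    if "m < length (snd (ts ! t))" for m
    using name_at_word[of t ts] t assms(1) that by (simp add: name_at_def)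
  then have "p \<noteq> Suc (pos ts t + m)" if "m < length (snd (ts ! t))" for m
    using assms(3) that by (metis (no_types, lifting) ComplD cell.inject image_iff)
  then have "\<not> (pos ts t < p \<and> p \<le> pos ts t + length (snd (ts ! t)))"
    by (metis (no_types, lifting) add_Suc_right less_iff_Suc_add Suc_le_lessD nat_add_left_cancel_less add_Suc)
  ultimately show ?thesis using t by auto
qed

text \<open>Variable v owns three counters: its value, the number of remaining rounds of its loop, and
  an accumulator for its existential quantifier.\<close>

definition cur :: "nat \<Rightarrow> nat" where "cur v = 3 * v + 5"
definition rem :: "nat \<Rightarrow> nat" where "rem v = 3 * v + 6"
definition acc :: "nat \<Rightarrow> nat" where "acc v = 3 * v + 7"

lemma counter_simps [simp]:
  "cur u = cur v \<longleftrightarrow> u = v" "rem u = rem v \<longleftrightarrow> u = v" "acc u = acc v \<longleftrightarrow> u = v"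
  "cur u \<noteq> rem v" "cur u \<noteq> acc v" "rem u \<noteq> acc v" "rem u \<noteq> cur v" "acc u \<noteq> cur v" "acc u \<noteq> rem v"
  "4 < cur v" "4 < rem v" "4 < acc v"
  by (auto simp: cur_def rem_def acc_def) presburger+

lemma counter_neq [simp]:
  "i < 5 \<Longrightarrow> cur v \<noteq> i" "i < 5 \<Longrightarrow> rem v \<noteq> i" "i < 5 \<Longrightarrow> acc v \<noteq> i"
  "i < 5 \<Longrightarrow> i \<noteq> cur v" "i < 5 \<Longrightarrow> i \<noteq> rem v" "i < 5 \<Longrightarrow> i \<noteq> acc v"
  by (auto simp: cur_def rem_def acc_def)

text \<open>Walking to the right end sets the number of rounds to \<open>length x + 1\<close>.
  Addressing cells by \<open>cur v\<close> instead of the head leaves the head free for the body.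
  The last round reads the right end, which counts as no marker.\<close>

definition for_marks :: "nat \<Rightarrow> ('a, 'b) com \<Rightarrow> ('a, 'b) com" where
  "for_marks v body = Loop (Head (- {RightEnd})) (Do GoRight ;; Do (Inc (rem v))) ;; rewind ;;
     Loop (NonZero (rem v)) (Do (Inc (cur v)) ;;
       ifsym (cur v) (Symbol ` (- range bit)) body Skip ;; Do (Dec (rem v))) ;;
     clear (cur v)"

text \<open>\<sigma> t and \<omega> t are the store and the output before token t, apart from the
  two counters of the loop. The body must work for every number k of remaining rounds, since this
  number depends on the tape position and not on t alone.\<close>

lemma exec_for_marks:
  assumes "marked ts" "x = word ts"
    and zero: "\<And>t. t \<le> length ts \<Longrightarrow> \<sigma> t 1 = 0 \<and> \<sigma> t (cur v) = 0 \<and> \<sigma> t (rem v) = 0"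
    and body: "\<And>t k. t < length ts \<Longrightarrow>
      exec x body (0, (\<sigma> t)(cur v := pos ts t, rem v := k), \<omega> t)
        (0, (\<sigma> (Suc t))(cur v := pos ts t, rem v := k), \<omega> (Suc t))"
  shows "exec x (for_marks v body) (0, \<sigma> 0, \<omega> 0) (0, \<sigma> (length ts), \<omega> (length ts))"
  unfolding for_marks_def
proof (intro exec_Seq)
  let ?n = "Suc (length x)"
  let ?S = "\<lambda>m. (m, (\<sigma> 0)(rem v := m), \<omega> 0)"
  have "exec x (Loop (Head (- {RightEnd})) (Do GoRight ;; Do (Inc (rem v)))) (?S 0) (?S ?n)"
    by (rule exec_iterate) (auto intro!: exec_Do_Seq exec_Do simp: read_input_RightEnd fun_eq_iff)
  moreover have "(\<sigma> 0)(rem v := 0) = \<sigma> 0" using zero[of 0] by auto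
  ultimately show "exec x (Loop (Head (- {RightEnd})) (Do GoRight ;; Do (Inc (rem v))))
      (0, \<sigma> 0, \<omega> 0) (?n, (\<sigma> 0)(rem v := ?n), \<omega> 0)" by simp
  show "exec x rewind (?n, (\<sigma> 0)(rem v := ?n), \<omega> 0) (0, (\<sigma> 0)(rem v := ?n), \<omega> 0)" by (rule exec_rewind)
  let ?S = "\<lambda>p. (0, (\<sigma> (passed ts p))(cur v := p, rem v := ?n - p), \<omega> (passed ts p))"
  let ?B = "Do (Inc (cur v)) ;; ifsym (cur v) (Symbol ` (- range bit)) body Skip ;; Do (Dec (rem v))"
  have le: "passed ts p \<le> length ts" for p
    using card_mono[of "{..<length ts}" "{t. t < length ts \<and> pos ts t \<le> p}"] by (auto simp: passed_def)
  have "exec x (Loop (NonZero (rem v)) ?B) (?S 0) (?S ?n)"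
  proof (rule exec_iterate, intro conjI)
    fix p assume p: "p < ?n"
    then show "holds x (NonZero (rem v)) (?S p)" by simp
    let ?s = "(\<sigma> (passed ts p))(cur v := Suc p, rem v := ?n - p)"
    have sym: "exec x (if read_input x (Suc p) \<in> Symbol ` (- range bit) then body else Skip)
      (0, ?s, \<omega> (passed ts p))
      (0, (\<sigma> (passed ts (Suc p)))(cur v := Suc p, rem v := ?n - p), \<omega> (passed ts (Suc p)))"
    proof (cases "\<exists>t<length ts. pos ts t = Suc p")
      case True
      then obtain t where t: "t < length ts" "pos ts t = Suc p" by blast
      then have "read_input x (Suc p) = Symbol (fst (ts ! t))"
        using read_input_word(1)[of t ts] assms(2) by simp
      moreover have "fst (ts ! t) \<notin> range bit" using assms(1) t by (simp add: marked_def)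
      ultimately show ?thesis using body[OF t(1), of "?n - p"] t(2) passed_Suc[OF t] by simp
    next
      case False
      then have "read_input x (Suc p) \<notin> Symbol ` (- range bit)"
        using mark_position[OF assms(1), of "Suc p"] assms(2) by (metis One_nat_def Suc_le_mono zero_le)
      moreover have "passed ts (Suc p) = passed ts p" using False passed_Suc_other by blast
      ultimately show ?thesis by (simp add: exec_Skip)
    qed
    have "exec x (ifsym (cur v) (Symbol ` (- range bit)) body Skip) (0, ?s, \<omega> (passed ts p))
      (0, (\<sigma> (passed ts (Suc p)))(cur v := Suc p, rem v := ?n - p), \<omega> (passed ts (Suc p)))"
      by (rule exec_ifsym) (use sym zero[OF le] p in auto)
    moreover have "exec x (Do (Inc (cur v))) (?S p) (0, ?s, \<omega> (passed ts p))"
      using p by (intro exec_Do) (auto simp: fun_eq_iff)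
    moreover have "exec x (Do (Dec (rem v)))
      (0, (\<sigma> (passed ts (Suc p)))(cur v := Suc p, rem v := ?n - p), \<omega> (passed ts (Suc p))) (?S (Suc p))"
      using p by (intro exec_Do) (auto simp: fun_eq_iff)
    ultimately show "exec x ?B (?S p) (?S (Suc p))" using exec_Seq by blast
  qed simp
  moreover have "(\<sigma> 0)(cur v := 0, rem v := ?n - 0) = (\<sigma> 0)(rem v := ?n)"
    using zero[of 0] by (auto simp: fun_eq_iff)
  ultimately show "exec x (Loop (NonZero (rem v)) ?B) (0, (\<sigma> 0)(rem v := ?n), \<omega> 0)
      (0, (\<sigma> (length ts))(cur v := ?n, rem v := 0), \<omega> (length ts))"
    using assms(2) by (simp add: passed_0 passed_end)
  have "((\<sigma> (length ts))(cur v := ?n, rem v := 0))(cur v := 0) = \<sigma> (length ts)"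
    using zero[of "length ts"] by (auto simp: fun_eq_iff)
  then show "exec x (clear (cur v)) (0, (\<sigma> (length ts))(cur v := ?n, rem v := 0), \<omega> (length ts))
      (0, \<sigma> (length ts), \<omega> (length ts))"
    using exec_clear[of x "cur v" 0 "(\<sigma> (length ts))(cur v := ?n, rem v := 0)"] by simp
qed

end

section \<open>First-order queries on token lists\<close>

text \<open>Quantifiers range over tokens, hence each of them costs one loop and a fixed number of
  counters; this is why first-order queries stay within logarithmic space.\<close>

datatype 'a fm =
    Mark "'a set" nat
  | Bare nat
  | Same nat nat
  | Less nat nat
  | Nt "'a fm"
  | An "'a fm" "'a fm"
  | Exi nat "'a fm"

fun sat :: "('a \<times> name) list \<Rightarrow> (nat \<Rightarrow> nat) \<Rightarrow> 'a fm \<Rightarrow> bool" where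
  "sat ts e (Mark A i) \<longleftrightarrow> fst (ts ! e i) \<in> A"
| "sat ts e (Bare i) \<longleftrightarrow> snd (ts ! e i) = []"
| "sat ts e (Same i j) \<longleftrightarrow> snd (ts ! e i) = snd (ts ! e j)"
| "sat ts e (Less i j) \<longleftrightarrow> e i < e j"
| "sat ts e (Nt \<phi>) \<longleftrightarrow> \<not> sat ts e \<phi>"
| "sat ts e (An \<phi> \<psi>) \<longleftrightarrow> sat ts e \<phi> \<and> sat ts e \<psi>"
| "sat ts e (Exi v \<phi>) \<longleftrightarrow> (\<exists>t<length ts. sat ts (e(v := t)) \<phi>)"

text \<open>A bound variable must be new because its counters have to be 0 when its loop starts.\<close>

fun scoped :: "nat set \<Rightarrow> 'a fm \<Rightarrow> bool" where
  "scoped D (Mark A i) \<longleftrightarrow> i \<in> D"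
| "scoped D (Bare i) \<longleftrightarrow> i \<in> D"
| "scoped D (Same i j) \<longleftrightarrow> i \<in> D \<and> j \<in> D"
| "scoped D (Less i j) \<longleftrightarrow> i \<in> D \<and> j \<in> D"
| "scoped D (Nt \<phi>) \<longleftrightarrow> scoped D \<phi>"
| "scoped D (An \<phi> \<psi>) \<longleftrightarrow> scoped D \<phi> \<and> scoped D \<psi>"
| "scoped D (Exi v \<phi>) \<longleftrightarrow> v \<notin> D \<and> scoped (insert v D) \<phi>"

datatype ('a, 'b) printer =
    Out "'b list"
  | Name nat
  | Ite "'a fm" "('a, 'b) printer" "('a, 'b) printer"
  | Then "('a, 'b) printer" "('a, 'b) printer"
  | For nat "('a, 'b) printer"

fun scoped_printer :: "nat set \<Rightarrow> ('a, 'b) printer \<Rightarrow> bool" where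
  "scoped_printer D (Out bs) \<longleftrightarrow> True"
| "scoped_printer D (Name i) \<longleftrightarrow> i \<in> D"
| "scoped_printer D (Ite \<phi> P Q) \<longleftrightarrow> scoped D \<phi> \<and> scoped_printer D P \<and> scoped_printer D Q"
| "scoped_printer D (Then P Q) \<longleftrightarrow> scoped_printer D P \<and> scoped_printer D Q"
| "scoped_printer D (For v P) \<longleftrightarrow> v \<notin> D \<and> scoped_printer (insert v D) P"

context coding
begin

fun printed :: "('a \<times> name) list \<Rightarrow> (nat \<Rightarrow> nat) \<Rightarrow> ('a, 'b) printer \<Rightarrow> 'b list" where
  "printed ts e (Out bs) = bs"
| "printed ts e (Name i) = map enc (snd (ts ! e i))"
| "printed ts e (Ite \<phi> P Q) = (if sat ts e \<phi> then printed ts e P else printed ts e Q)"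
| "printed ts e (Then P Q) = printed ts e P @ printed ts e Q"
| "printed ts e (For v P) = concat (map (\<lambda>t. printed ts (e(v := t)) P) [0..<length ts])"

text \<open>The verdict is left in counter 0, which is 0 at the start, and every other counter ends
  as it began. The accumulator of a quantifier is set to 1 rather than increased for each witness,
  so that a single decrement resets it.\<close>

fun test_com :: "'a fm \<Rightarrow> ('a, 'b) com" where
  "test_com (Mark A i) = put_mark A (cur i)"
| "test_com (Bare i) = put_bare (cur i)"
| "test_com (Same i j) = put_same (cur i) (cur j)"
| "test_com (Less i j) = put_less (cur i) (cur j)"
| "test_com (Nt \<phi>) = test_com \<phi> ;; Cond (NonZero 0) (Do (Dec 0)) (Do (Inc 0))"
| "test_com (An \<phi> \<psi>) = test_com \<phi> ;; Cond (NonZero 0) (Do (Dec 0) ;; test_com \<psi>) Skip"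
| "test_com (Exi v \<phi>) = for_marks v (test_com \<phi> ;;
       Cond (NonZero 0) (Do (Dec 0) ;; clear (acc v) ;; Do (Inc (acc v))) Skip) ;;
     Cond (NonZero (acc v)) (Do (Dec (acc v)) ;; Do (Inc 0)) Skip"

fun print_com :: "('a, 'b) printer \<Rightarrow> ('a, 'b) com" where
  "print_com (Out bs) = emit_all bs"
| "print_com (Name i) = put_name (cur i)"
| "print_com (Ite \<phi> P Q) = test_com \<phi> ;; Cond (NonZero 0) (Do (Dec 0) ;; print_com P) (print_com Q)"
| "print_com (Then P Q) = print_com P ;; print_com Q"
| "print_com (For v P) = for_marks v (print_com P)"

text \<open>Nothing is said about \<open>rem\<close> and \<open>acc\<close> of variables in D,
  because their loops are in progress.\<close>

definition fits :: "('a \<times> name) list \<Rightarrow> nat set \<Rightarrow> (nat \<Rightarrow> nat) \<Rightarrow> (nat \<Rightarrow> nat) \<Rightarrow> bool" where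
  "fits ts D e s \<longleftrightarrow> (\<forall>i<5. s i = 0) \<and> (\<forall>v\<in>D. e v < length ts \<and> s (cur v) = pos ts (e v)) \<and>
     (\<forall>v. v \<notin> D \<longrightarrow> s (cur v) = 0 \<and> s (rem v) = 0 \<and> s (acc v) = 0)"

lemma fits_bind:
  assumes "fits ts D e s" "v \<notin> D" "t < length ts"
  shows "fits ts (insert v D) (e(v := t)) (s(acc v := a, cur v := pos ts t, rem v := k))"
  using assms unfolding fits_def by (auto)

lemma exec_test_com:
  assumes "marked ts" "x = word ts" "fits ts D e s" "scoped D \<phi>"
  shows "exec x (test_com \<phi>) (0, s, w) (0, s(0 := of_bool (sat ts e \<phi>)), w)"
  using assms(3,4)
proof (induction \<phi> arbitrary: D e s)
  case (Mark A i)
  then have i: "\<forall>l<5. s l = 0" "e i < length ts" "s (cur i) = pos ts (e i)" by (auto simp: fits_def)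
  have "exec x (put_mark A (cur i)) (0, s, w)
      (0, s(0 := of_bool (read_input x (s (cur i)) \<in> Symbol ` A)), w)"
    by (rule exec_put_mark) (use i read_input_word(2)[of "e i" ts] assms(2) in auto)
  moreover have "read_input x (s (cur i)) \<in> Symbol ` A \<longleftrightarrow> fst (ts ! e i) \<in> A"
    using i read_input_word(1)[of "e i" ts] assms(2) by auto
  ultimately show ?case by (simp only: test_com.simps sat.simps)
next
  case (Bare i)
  then have i: "\<forall>l<5. s l = 0" "e i < length ts" "s (cur i) = pos ts (e i)" by (auto simp: fits_def)
  have "exec x (put_bare (cur i)) (0, s, w) (0, s(0 := of_bool (snd (ts ! e i) = [])), w)"
    by (rule exec_put_bare)
      (use i read_input_word(2)[of "e i" ts] name_at_word[of "e i" ts] assms(1,2) in auto)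
  then show ?case by (simp only: test_com.simps sat.simps)
next
  case (Same i j)
  then have i: "\<forall>l<5. s l = 0" "e i < length ts" "s (cur i) = pos ts (e i)"
    "e j < length ts" "s (cur j) = pos ts (e j)" by (auto simp: fits_def)
  have "exec x (put_same (cur i) (cur j)) (0, s, w)
      (0, s(0 := of_bool (snd (ts ! e i) = snd (ts ! e j))), w)"
    by (rule exec_put_same)
      (use i name_at_word[of "e i" ts] name_at_word[of "e j" ts] assms(1,2) in auto)
  then show ?case by (simp only: test_com.simps sat.simps)
next
  case (Less i j)
  then have i: "\<forall>l<5. s l = 0" "e i < length ts" "s (cur i) = pos ts (e i)"
    "e j < length ts" "s (cur j) = pos ts (e j)" by (auto simp: fits_def)
  have "exec x (put_less (cur i) (cur j)) (0, s, w) (0, s(0 := of_bool (s (cur i) < s (cur j))), w)"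
    by (rule exec_put_less)
      (use i read_input_word(2)[of "e i" ts] read_input_word(2)[of "e j" ts] assms(2) in auto)
  moreover have "s (cur i) < s (cur j) \<longleftrightarrow> e i < e j"
    using i pos_less_iff[of "e i" ts "e j"] by simp
  ultimately show ?case by (simp only: test_com.simps sat.simps)
next
  case (Nt \<phi>)
  then have 0: "s 0 = 0" by (simp add: fits_def)
  have "exec x (test_com \<phi>) (0, s, w) (0, s(0 := of_bool (sat ts e \<phi>)), w)"
    by (rule Nt.IH[OF Nt.prems(1)]) (use Nt.prems in simp)
  moreover have "exec x (Cond (NonZero 0) (Do (Dec 0)) (Do (Inc 0)))
     (0, s(0 := of_bool (sat ts e \<phi>)), w) (0, s(0 := of_bool (\<not> sat ts e \<phi>)), w)"
    by (rule exec_Cond) (use 0 in \<open>auto intro!: exec_Do\<close>)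
  ultimately show ?case unfolding test_com.simps sat.simps by (rule exec_Seq)
next
  case (An \<phi> \<psi>)
  then have 0: "s 0 = 0" "s(0 := 0) = s" by (auto simp: fits_def)
  have 1: "exec x (test_com \<phi>) (0, s, w) (0, s(0 := of_bool (sat ts e \<phi>)), w)"
    by (rule An.IH(1)[OF An.prems(1)]) (use An.prems in simp)
  have 2: "exec x (test_com \<psi>) (0, s, w) (0, s(0 := of_bool (sat ts e \<psi>)), w)"
    by (rule An.IH(2)[OF An.prems(1)]) (use An.prems in simp)
  have "exec x (Cond (NonZero 0) (Do (Dec 0) ;; test_com \<psi>) Skip)
     (0, s(0 := of_bool (sat ts e \<phi>)), w) (0, s(0 := of_bool (sat ts e (An \<phi> \<psi>))), w)"
    by (rule exec_Cond, cases "sat ts e \<phi>") (use 0 2 in \<open>auto intro!: exec_Do_Seq exec_Skip\<close>)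
  then show ?case unfolding test_com.simps by (rule exec_Seq[OF 1])
next
  case (Exi v \<phi>)
  then have 0: "s(0 := 0) = s" "s(acc v := 0) = s" and s_0: "s 0 = 0" by (auto simp: fits_def)
  let ?\<sigma> = "\<lambda>t. s(acc v := of_bool (\<exists>t'<t. sat ts (e(v := t')) \<phi>))"
  let ?body = "test_com \<phi> ;; Cond (NonZero 0) (Do (Dec 0) ;; clear (acc v) ;; Do (Inc (acc v))) Skip"
  have "exec x (for_marks v ?body) (0, ?\<sigma> 0, w) (0, ?\<sigma> (length ts), w)"
  proof (rule exec_for_marks[OF assms(1,2), where \<sigma> = ?\<sigma> and \<omega> = "\<lambda>_. w"])
    show "?\<sigma> t 1 = 0 \<and> ?\<sigma> t (cur v) = 0 \<and> ?\<sigma> t (rem v) = 0" for t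
      using Exi.prems by (auto simp: fits_def)
    fix t k assume t: "t < length ts"
    let ?s = "\<lambda>a. s(acc v := a, cur v := pos ts t, rem v := k)"
    let ?a = "of_bool (\<exists>t'<t. sat ts (e(v := t')) \<phi>) :: nat"
    let ?b = "sat ts (e(v := t)) \<phi>"
    have s0: "(?s a)(0 := 0) = ?s a" for a
    proof -
      have "?s a 0 = 0" using Exi.prems by (simp add: fits_def)
      then show ?thesis by (metis fun_upd_triv)
    qed
    have 1: "exec x (test_com \<phi>) (0, ?s ?a, w) (0, (?s ?a)(0 := of_bool ?b), w)"
      by (rule Exi.IH[OF fits_bind]) (use Exi.prems t in auto)
    have 2: "exec x (Cond (NonZero 0) (Do (Dec 0) ;; clear (acc v) ;; Do (Inc (acc v))) Skip)
       (0, (?s ?a)(0 := of_bool ?b), w) (0, ?s (of_bool (\<exists>t'<Suc t. sat ts (e(v := t')) \<phi>)), w)"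
    proof (rule exec_Cond, cases ?b)
      case True
      have "exec x (clear (acc v)) (0, ?s ?a, w) (0, (?s ?a)(acc v := 0), w)" by (rule exec_clear)
      moreover have "(?s ?a)(acc v := 0) = ?s 0" by (auto simp: fun_eq_iff)
      moreover have "exec x (Do (Inc (acc v))) (0, ?s 0, w) (0, ?s 1, w)"
        by (rule exec_Do) (auto simp: fun_eq_iff)
      ultimately have "exec x (clear (acc v) ;; Do (Inc (acc v))) (0, ?s ?a, w) (0, ?s 1, w)"
        using exec_Seq[of x "clear (acc v)" "(0, ?s ?a, w)" "(0, ?s 0, w)" "Do (Inc (acc v))" "(0, ?s 1, w)"]
        by (simp only:)
      moreover have "(\<exists>t'<Suc t. sat ts (e(v := t')) \<phi>)" using True by blast
      ultimately show "exec x (if holds x (NonZero 0) (0, (?s ?a)(0 := of_bool ?b), w)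
          then Do (Dec 0) ;; clear (acc v) ;; Do (Inc (acc v)) else Skip)
          (0, (?s ?a)(0 := of_bool ?b), w) (0, ?s (of_bool (\<exists>t'<Suc t. sat ts (e(v := t')) \<phi>)), w)"
        using True exec_Do_Seq[of x "Dec 0" "(0, (?s ?a)(0 := 1), w)" "(0, ?s ?a, w)"] s0[of ?a] by simp
    next
      case False
      then have "(\<exists>t'<Suc t. sat ts (e(v := t')) \<phi>) \<longleftrightarrow> (\<exists>t'<t. sat ts (e(v := t')) \<phi>)"
        using less_Suc_eq by auto
      then show "exec x (if holds x (NonZero 0) (0, (?s ?a)(0 := of_bool ?b), w)
          then Do (Dec 0) ;; clear (acc v) ;; Do (Inc (acc v)) else Skip)
          (0, (?s ?a)(0 := of_bool ?b), w) (0, ?s (of_bool (\<exists>t'<Suc t. sat ts (e(v := t')) \<phi>)), w)"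
        using False s0[of ?a] s_0 by (simp add: exec_Skip)
    qed
    show "exec x ?body (0, (?\<sigma> t)(cur v := pos ts t, rem v := k), w)
        (0, (?\<sigma> (Suc t))(cur v := pos ts t, rem v := k), w)"
      using exec_Seq[OF 1 2] .
  qed
  moreover have "exec x (Cond (NonZero (acc v)) (Do (Dec (acc v)) ;; Do (Inc 0)) Skip)
      (0, ?\<sigma> (length ts), w) (0, s(0 := of_bool (sat ts e (Exi v \<phi>))), w)"
    by (rule exec_Cond) (use 0 Exi.prems in
      \<open>auto intro!: exec_Do_Seq exec_Do exec_Skip_eq simp: fits_def fun_eq_iff\<close>)
  ultimately have "exec x (test_com (Exi v \<phi>)) (0, ?\<sigma> 0, w) (0, s(0 := of_bool (sat ts e (Exi v \<phi>))), w)"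
    unfolding test_com.simps by (rule exec_Seq)
  moreover have "?\<sigma> 0 = s" using 0(2) by simp
  ultimately show ?case by (simp only:)
qed

lemma exec_print_com:
  assumes "marked ts" "x = word ts" "fits ts D e s" "scoped_printer D P"
  shows "exec x (print_com P) (0, s, w) (0, s, w @ printed ts e P)"
  using assms(3,4)
proof (induction P arbitrary: D e s w)
  case (Out bs)
  then show ?case by (simp add: exec_emit_all)
next
  case (Name i)
  then have i: "\<forall>l<5. s l = 0" "e i < length ts" "s (cur i) = pos ts (e i)" by (auto simp: fits_def)
  then show ?case
    using exec_put_name[of s "cur i" x "snd (ts ! e i)" w] read_input_word(2)[of "e i" ts]
      name_at_word[of "e i" ts] assms(1,2) by simp
next
  case (Ite \<phi> P Q)
  have 0: "s 0 = 0" "s(0 := 0) = s" using Ite by (auto simp: fits_def)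
  have "exec x (test_com \<phi>) (0, s, w) (0, s(0 := of_bool (sat ts e \<phi>)), w)"
    using exec_test_com assms(1,2) Ite.prems by simp
  moreover have "exec x (Cond (NonZero 0) (Do (Dec 0) ;; print_com P) (print_com Q))
     (0, s(0 := of_bool (sat ts e \<phi>)), w) (0, s, w @ printed ts e (Ite \<phi> P Q))"
    by (rule exec_Cond, cases "sat ts e \<phi>") (use 0 Ite in \<open>auto intro!: exec_Do_Seq\<close>)
  ultimately show ?case by (auto intro: exec_Seq)
next
  case (Then P Q)
  then show ?case using exec_Seq by fastforce
next
  case (For v P)
  let ?\<omega> = "\<lambda>t. w @ concat (map (\<lambda>t'. printed ts (e(v := t')) P) [0..<t])"
  have "exec x (for_marks v (print_com P)) (0, s, ?\<omega> 0) (0, s, ?\<omega> (length ts))"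
  proof (rule exec_for_marks[OF assms(1,2), where \<sigma> = "\<lambda>_. s" and \<omega> = ?\<omega>])
    show "s 1 = 0 \<and> s (cur v) = 0 \<and> s (rem v) = 0"
      using For.prems by (auto simp: fits_def)
    fix t k assume t: "t < length ts"
    have "s(acc v := 0) = s" using For.prems by (auto simp: fits_def)
    then have "fits ts (insert v D) (e(v := t)) (s(cur v := pos ts t, rem v := k))"
      using fits_bind[OF For.prems(1) _ t, of v 0 k] For.prems(2) by simp
    then have "exec x (print_com P) (0, s(cur v := pos ts t, rem v := k), ?\<omega> t)
       (0, s(cur v := pos ts t, rem v := k), ?\<omega> t @ printed ts (e(v := t)) P)"
      using For.IH For.prems(2) by (simp only: scoped_printer.simps)
    then show "exec x (print_com P) (0, s(cur v := pos ts t, rem v := k), ?\<omega> t)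
       (0, s(cur v := pos ts t, rem v := k), ?\<omega> (Suc t))" by simp
  qed
  then show ?case by simp
qed

text \<open>Building the word from its right end splits it into the bits before the first marker and
  a list of tokens; it is a word of tokens unless there are such bits.\<close>

lemma word_cases:
  obtains ts where "x = word ts" "marked ts" | b y where "x = bit b # y"
proof -
  have "\<exists>u ts. x = map bit u @ word ts \<and> marked ts"
  proof (induction x)
    case Nil
    then show ?case by (intro exI[of _ "[]"]) (simp add: marked_def)
  next
    case (Cons a x)
    then obtain u ts where *: "x = map bit u @ word ts" "marked ts" by blast
    show ?case
    proof (cases "a \<in> range bit")
      case True
      then obtain b where "a = bit b" by blast
      then show ?thesis using * by (intro exI[of _ "b # u"] exI[of _ ts]) simp
    next
      case False
      then show ?thesis using * by (intro exI[of _ "[]"] exI[of _ "(a, u) # ts"]) (simp add: marked_def)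
    qed
  qed
  then obtain u ts where "x = map bit u @ word ts" "marked ts" by blast
  then show ?thesis using that by (cases u) auto
qed

text \<open>A look at the first symbol separates the words of tokens from all others, which receive
  the constant output \<open>bad\<close>.\<close>

theorem logspace_polytime_computable_printer:
  assumes "scoped_printer {} P"
    and "\<And>ts. marked ts \<Longrightarrow> f (word ts) = printed ts (\<lambda>_. 0) P"
    and "\<And>b y. f (bit b # y) = bad"
  shows "logspace_polytime_computable f"
proof (rule logspace_polytime_computable_com)
  let ?c = "Do GoRight ;; Cond (Head (Symbol ` range bit)) (emit_all bad) (Do GoLeft ;; print_com P)"
  fix x
  have "exec x ?c (0, \<lambda>_. 0, []) (if x \<noteq> [] \<and> hd x \<in> range bit then 1 else 0, \<lambda>_. 0, f x)"
  proof (rule exec_Do_Seq, simp, rule exec_Cond)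
    have r: "read_input x (Suc 0) \<in> Symbol ` range bit \<longleftrightarrow> x \<noteq> [] \<and> hd x \<in> range bit"
      by (cases x) (auto simp: read_input_def)
    show "exec x (if holds x (Head (Symbol ` range bit)) (Suc 0, \<lambda>_. 0, []) then emit_all bad
        else Do GoLeft ;; print_com P) (Suc 0, \<lambda>_. 0, [])
        (if x \<noteq> [] \<and> hd x \<in> range bit then 1 else 0, \<lambda>_. 0, f x)"
    proof (cases x rule: word_cases)
      case (1 ts)
      have "exec x (print_com P) (0, \<lambda>_. 0, []) (0, \<lambda>_. 0, [] @ printed ts (\<lambda>_. 0) P)"
        by (rule exec_print_com[OF 1(2,1) _ assms(1)]) (simp add: fits_def)
      then show ?thesis
        using r word_start[OF 1(2)] 1 assms(2)[OF 1(2)] by (auto intro!: exec_Do_Seq)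
    next
      case (2 b y)
      then show ?thesis using r assms(3) exec_emit_all[of x bad "Suc 0" "\<lambda>_. 0" "[]"] by auto
    qed
  qed
  then show "\<exists>t h s. ends x ?c (0, \<lambda>_. 0, []) t (h, s, f x)" unfolding exec_def by blast
qed

end

section \<open>Occurrences of names\<close>

context coding
begin

lemma word_inj: "word ts = word ts' \<Longrightarrow> marked ts \<Longrightarrow> marked ts' \<Longrightarrow> ts = ts'"
proof (induction ts arbitrary: ts')
  case Nil
  then show ?case by (cases ts') auto
next
  case (Cons t ts)
  obtain m u where t: "t = (m, u)" by (cases t)
  obtain m' u' us where ts': "ts' = (m', u') # us" using Cons.prems(1) t by (cases ts') auto
  have m: "marked ts" "marked us" using Cons.prems ts' by (auto simp: marked_def)
  have "m = m'" "map bit u @ word ts = map bit u' @ word us" using Cons.prems(1) t ts' by auto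
  then have "u = u' \<and> word ts = word us"
    using bits_append_eqD[OF _ inj_bit] word_start m by blast
  then show ?case using Cons.IH m t ts' \<open>m = m'\<close> by simp
qed

end

text \<open>The rank of token t among the tokens with a marker in A and the same name. Ranks tell
  the occurrences of a name apart and replace the counting of degrees and occurrences, which queries
  cannot do directly.\<close>

definition slot :: "'a set \<Rightarrow> ('a \<times> name) list \<Rightarrow> nat \<Rightarrow> nat" where
  "slot A ts t = card {s. s < t \<and> fst (ts ! s) \<in> A \<and> snd (ts ! s) = snd (ts ! t)}"

definition occs :: "'a set \<Rightarrow> ('a \<times> name) list \<Rightarrow> nat set" where
  "occs A ts = {t. t < length ts \<and> fst (ts ! t) \<in> A}"

lemma occs_iff: "t \<in> occs A ts \<longleftrightarrow> t < length ts \<and> fst (ts ! t) \<in> A"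
  by (simp add: occs_def)

lemma finite_occs: "finite (occs A ts)"
  by (simp add: occs_def)

lemma slot_less:
  assumes "s < t" "fst (ts ! s) \<in> A" "snd (ts ! s) = snd (ts ! t)"
  shows "slot A ts s < slot A ts t"
  unfolding slot_def by (rule psubset_card_mono) (use assms in auto)

lemma slot_inj:
  assumes "s \<in> occs A ts" "t \<in> occs A ts" "snd (ts ! s) = snd (ts ! t)" "slot A ts s = slot A ts t"
  shows "s = t"
  using assms slot_less[of s t ts A] slot_less[of t s ts A]
  by (cases s t rule: linorder_cases) (auto simp: occs_iff)

text \<open>For s the last earlier occurrence is taken: all others precede it, so the rank drops by
  exactly one. This recursion makes lower bounds on ranks first-order.\<close>

lemma Suc_le_slot_iff:
  "Suc n \<le> slot A ts t \<longleftrightarrow>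
    (\<exists>s<t. fst (ts ! s) \<in> A \<and> snd (ts ! s) = snd (ts ! t) \<and> n \<le> slot A ts s)"
proof
  assume n: "Suc n \<le> slot A ts t"
  let ?S = "\<lambda>t. {s. s < t \<and> fst (ts ! s) \<in> A \<and> snd (ts ! s) = snd (ts ! t)}"
  have "?S t \<noteq> {}" using n by (auto simp: slot_def simp del: Collect_empty_eq)
  define s where "s = Max (?S t)"
  have s: "s \<in> ?S t" unfolding s_def using \<open>?S t \<noteq> {}\<close> by (intro Max_in) auto
  have "?S t \<subseteq> insert s (?S s)"
  proof
    fix r assume r: "r \<in> ?S t"
    then have "r \<le> s" unfolding s_def by (intro Max_ge) auto
    then show "r \<in> insert s (?S s)" using r s by auto
  qed
  then have "card (?S t) \<le> card (insert s (?S s))" by (rule card_mono[rotated]) simp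
  also have "\<dots> \<le> Suc (card (?S s))" by (simp add: card_insert_if)
  finally have "card (?S t) \<le> Suc (card (?S s))" .
  then show "\<exists>s<t. fst (ts ! s) \<in> A \<and> snd (ts ! s) = snd (ts ! t) \<and> n \<le> slot A ts s"
    using s n unfolding slot_def by (intro exI[of _ s]) simp
next
  assume "\<exists>s<t. fst (ts ! s) \<in> A \<and> snd (ts ! s) = snd (ts ! t) \<and> n \<le> slot A ts s"
  then show "Suc n \<le> slot A ts t" using slot_less by fastforce
qed

lemma first_occurrence:
  assumes "t \<in> occs A ts"
  shows "\<exists>s\<in>occs A ts. snd (ts ! s) = snd (ts ! t) \<and> slot A ts s = 0"
  using assms
proof (induction t rule: less_induct)
  case (less t)
  show ?case
  proof (cases "slot A ts t")
    case (Suc n)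
    then obtain s where s: "s < t" "fst (ts ! s) \<in> A" "snd (ts ! s) = snd (ts ! t)"
      using Suc_le_slot_iff[of n A ts t] by auto
    then have "s \<in> occs A ts" using less.prems by (simp add: occs_iff)
    then show ?thesis using less.IH[OF s(1)] s(3) by auto
  qed (use less.prems in auto)
qed

text \<open>The ranks of the occurrences of a name are distinct and smaller than their number, so a
  bound on every rank and a bound on the number amount to the same.\<close>

lemma card_occs_le_iff:
  "card {t \<in> occs A ts. snd (ts ! t) = v} \<le> n \<longleftrightarrow> (\<forall>t\<in>occs A ts. snd (ts ! t) = v \<longrightarrow> slot A ts t < n)"
proof
  assume n: "card {t \<in> occs A ts. snd (ts ! t) = v} \<le> n"
  show "\<forall>t\<in>occs A ts. snd (ts ! t) = v \<longrightarrow> slot A ts t < n"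
  proof (intro ballI impI)
    fix t assume t: "t \<in> occs A ts" "snd (ts ! t) = v"
    have "slot A ts t < card {t \<in> occs A ts. snd (ts ! t) = v}"
      unfolding slot_def
      by (rule psubset_card_mono) (use t finite_occs[of A ts] in \<open>auto simp: occs_iff\<close>)
    then show "slot A ts t < n" using n by simp
  qed
next
  assume *: "\<forall>t\<in>occs A ts. snd (ts ! t) = v \<longrightarrow> slot A ts t < n"
  have "inj_on (slot A ts) {t \<in> occs A ts. snd (ts ! t) = v}"
  proof (rule inj_onI)
    fix s t assume "s \<in> {t \<in> occs A ts. snd (ts ! t) = v}" "t \<in> {t \<in> occs A ts. snd (ts ! t) = v}"
      "slot A ts s = slot A ts t"
    then show "s = t" using slot_inj[of s A ts t] by simp
  qed
  then have "card {t \<in> occs A ts. snd (ts ! t) = v} \<le> card {..<n}"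
    by (rule card_inj_on_le) (use * in auto)
  then show "card {t \<in> occs A ts. snd (ts ! t) = v} \<le> n" by simp
qed

text \<open>One representative token for every name, which lets a printer treat each vertex or
  variable once.\<close>

definition firsts :: "'a set \<Rightarrow> ('a \<times> name) list \<Rightarrow> nat list" where
  "firsts A ts = filter (\<lambda>t. fst (ts ! t) \<in> A \<and> slot A ts t = 0) [0..<length ts]"

lemma set_firsts: "set (firsts A ts) = {t \<in> occs A ts. slot A ts t = 0}"
  by (auto simp: firsts_def occs_def)

lemma inj_firsts: "inj_on (\<lambda>t. snd (ts ! t)) (set (firsts A ts))"
proof (rule inj_onI)
  fix s t assume "s \<in> set (firsts A ts)" "t \<in> set (firsts A ts)" "snd (ts ! s) = snd (ts ! t)"
  then show "s = t" using slot_inj[of s A ts t] by (simp add: set_firsts)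
qed

lemma distinct_firsts: "distinct (firsts A ts)" "distinct (map (\<lambda>t. snd (ts ! t)) (firsts A ts))"
  using inj_firsts[of ts A] by (auto simp: firsts_def distinct_map)

lemma names_firsts: "(\<lambda>t. snd (ts ! t)) ` set (firsts A ts) = (\<lambda>t. snd (ts ! t)) ` occs A ts"
proof
  show "(\<lambda>t. snd (ts ! t)) ` occs A ts \<subseteq> (\<lambda>t. snd (ts ! t)) ` set (firsts A ts)"
  proof
    fix v assume "v \<in> (\<lambda>t. snd (ts ! t)) ` occs A ts"
    then obtain t where t: "t \<in> occs A ts" "v = snd (ts ! t)" by auto
    from first_occurrence[OF t(1)] obtain s where "s \<in> occs A ts" "snd (ts ! s) = v" "slot A ts s = 0"
      using t(2) by auto
    then show "v \<in> (\<lambda>t. snd (ts ! t)) ` set (firsts A ts)" by (auto simp: set_firsts)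
  qed
qed (auto simp: set_firsts)

abbreviation Imp :: "'a fm \<Rightarrow> 'a fm \<Rightarrow> 'a fm" where
  "Imp \<phi> \<psi> \<equiv> Nt (An \<phi> (Nt \<psi>))"

abbreviation Or :: "'a fm \<Rightarrow> 'a fm \<Rightarrow> 'a fm" where
  "Or \<phi> \<psi> \<equiv> Nt (An (Nt \<phi>) (Nt \<psi>))"

abbreviation Al :: "nat \<Rightarrow> 'a fm \<Rightarrow> 'a fm" where
  "Al v \<phi> \<equiv> Nt (Exi v (Nt \<phi>))"

definition adjacent :: "nat \<Rightarrow> nat \<Rightarrow> nat \<Rightarrow> 'a fm" where
  "adjacent i j k = An (Less i j) (Nt (Exi k (An (Less i k) (Less k j))))"

lemma sat_adjacent [simp]:
  assumes "e i < length ts" "e j < length ts" "k \<noteq> i" "k \<noteq> j"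
  shows "sat ts e (adjacent i j k) \<longleftrightarrow> e j = Suc (e i)"
proof -
  have "\<exists>t<length ts. e i < t \<and> t < e j" if "e i < e j" "e j \<noteq> Suc (e i)"
    using that assms by (intro exI[of _ "Suc (e i)"]) auto
  then show ?thesis using assms by (auto simp: adjacent_def)
qed

lemma scoped_adjacent [simp]:
  "scoped D (adjacent i j k) \<longleftrightarrow> i \<in> D \<and> j \<in> D \<and> k \<notin> D"
  by (auto simp: adjacent_def)

text \<open>\<open>Suc_le_slot_iff\<close> unfolded n times with the new variables k, k + 1 and so
  on; the base case is a tautology that mentions only i.\<close>

fun slot_ge :: "'a set \<Rightarrow> nat \<Rightarrow> nat \<Rightarrow> nat \<Rightarrow> 'a fm" where
  "slot_ge A 0 i k = Nt (Less i i)"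
| "slot_ge A (Suc n) i k =
     Exi k (An (Less k i) (An (Mark A k) (An (Same k i) (slot_ge A n k (Suc k)))))"

lemma sat_slot_ge:
  "e i < length ts \<Longrightarrow> i < k \<Longrightarrow> sat ts e (slot_ge A n i k) \<longleftrightarrow> n \<le> slot A ts (e i)"
proof (induction n arbitrary: e i k)
  case (Suc n)
  have "sat ts (e(k := t)) (slot_ge A n k (Suc k)) \<longleftrightarrow> n \<le> slot A ts t" if "t < length ts" for t
    by (subst Suc.IH) (use that in auto)
  then show ?case using Suc.prems unfolding Suc_le_slot_iff by (auto; metis less_trans)
qed simp

lemma scoped_slot_ge: "i \<in> D \<Longrightarrow> \<forall>j\<in>D. j < k \<Longrightarrow> scoped D (slot_ge A n i k)"
  by (induction n arbitrary: D i k) (auto simp: less_Suc_eq)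

lemma concat_filter: "concat (map (\<lambda>i. if P i then F i else []) xs) = concat (map F (filter P xs))"
  by (induction xs) auto

lemma concat_eq_index:
  "concat (map (\<lambda>j. if j = k then F j else []) [0..<n]) = (if k < n then F k else [])"
  by (induction n) auto

section \<open>Words of graphs\<close>

interpretation GG: coding GBit GBit
  by standard (auto intro: injI)

definition vertex_list :: "(gsym \<times> name) list \<Rightarrow> name list" where
  "vertex_list ts = map (\<lambda>i. snd (ts ! i)) (filter (\<lambda>i. fst (ts ! i) = GVertex) [0..<length ts])"

text \<open>The second end of an edge is taken from the next token whatever its marker is;
  \<open>graph_shape\<close> ensures that it exists and is a separator.\<close>

definition edge_list :: "(gsym \<times> name) list \<Rightarrow> (name \<times> name) list" where
  "edge_list ts = map (\<lambda>i. (snd (ts ! i), snd (ts ! Suc i)))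
     (filter (\<lambda>i. fst (ts ! i) = GEdge) [0..<length ts])"

definition graph_tokens :: "name list \<Rightarrow> (name \<times> name) list \<Rightarrow> (gsym \<times> name) list" where
  "graph_tokens vs es = map (Pair GVertex) vs @ concat (map (\<lambda>(u, v). [(GEdge, u), (GSep, v)]) es)"

lemma word_graph_tokens: "GG.word (graph_tokens vs es) = graph_word vs es"
proof -
  have "GG.word (concat (map (\<lambda>(u, v). [(GEdge, u), (GSep, v)]) es)) = concat (map edge_word es)"
    by (induction es) (auto simp: edge_word_def)
  moreover have "GG.word (map (Pair GVertex) vs) = concat (map vertex_word vs)"
    by (induction vs) (auto simp: vertex_word_def)
  ultimately show ?thesis by (simp add: graph_tokens_def graph_word_def)
qed

lemma marked_graph_tokens: "GG.marked (graph_tokens vs es)"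
  by (auto simp: graph_tokens_def GG.marked_def)

lemma filter_upt_Suc:
  "filter P [0..<Suc n] = (if P 0 then [0] else []) @ map Suc (filter (\<lambda>i. P (Suc i)) [0..<n])"
  by (simp add: upt_conv_Cons filter_map o_def flip: map_Suc_upt del: upt_Suc)

lemma vertex_list_Cons:
  "vertex_list (t # ts) = (if fst t = GVertex then [snd t] else []) @ vertex_list ts"
  unfolding vertex_list_def list.size(4) add_Suc_right add_0_right filter_upt_Suc by (auto simp: o_def)

lemma edge_list_Cons:
  "edge_list (t # ts) = (if fst t = GEdge then [(snd t, snd (ts ! 0))] else []) @ edge_list ts"
  unfolding edge_list_def list.size(4) add_Suc_right add_0_right filter_upt_Suc by (auto simp: o_def)

lemma lists_graph_tokens:
  "vertex_list (graph_tokens vs es) = vs" "edge_list (graph_tokens vs es) = es"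
proof -
  have *: "vertex_list (graph_tokens vs es) = vs \<and> edge_list (graph_tokens vs es) = es"
  proof (induction vs)
    case Nil
    show ?case
    proof (induction es)
      case Nil
      then show ?case by (simp add: graph_tokens_def vertex_list_def edge_list_def)
    next
      case (Cons e es)
      then show ?case
        by (cases e) (auto simp: graph_tokens_def vertex_list_Cons edge_list_Cons)
    qed
  next
    case (Cons v vs)
    then show ?case by (auto simp: graph_tokens_def vertex_list_Cons edge_list_Cons)
  qed
  then show "vertex_list (graph_tokens vs es) = vs" "edge_list (graph_tokens vs es) = es" by auto
qed

section \<open>Local syntax of graph words\<close>

definition graph_shape :: "(gsym \<times> name) list \<Rightarrow> bool" where
  "graph_shape ts \<longleftrightarrow>
     (\<forall>j<length ts. \<forall>i<j. fst (ts ! j) = GVertex \<longrightarrow> fst (ts ! i) = GVertex) \<and>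
     (\<forall>i<length ts. fst (ts ! i) = GEdge \<longrightarrow> Suc i < length ts \<and> fst (ts ! Suc i) = GSep) \<and>
     (\<forall>j<length ts. fst (ts ! j) = GSep \<longrightarrow> (\<exists>i. j = Suc i \<and> fst (ts ! i) = GEdge))"

lemma graph_shape_graph_tokens: "graph_shape (graph_tokens vs es)"
proof (induction vs)
  case Nil
  show ?case
  proof (induction es)
    case Nil
    then show ?case by (simp add: graph_shape_def graph_tokens_def)
  next
    case (Cons e es)
    obtain u v where e: "e = (u, v)" by (cases e)
    let ?ts = "graph_tokens [] es"
    have "fst t \<noteq> GVertex" if "t \<in> set ?ts" for t using that by (auto simp: graph_tokens_def)
    then have nv: "fst (?ts ! i) \<noteq> GVertex" if "i < length ?ts" for i using that by simp
    have eq: "graph_tokens [] (e # es) = (GEdge, u) # (GSep, v) # ?ts" by (simp add: graph_tokens_def e)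
    show ?case
      using Cons nv unfolding eq graph_shape_def
      by (auto simp: nth_Cons split: nat.splits)
  qed
next
  case (Cons v vs)
  have eq: "graph_tokens (v # vs) es = (GVertex, v) # graph_tokens vs es" by (simp add: graph_tokens_def)
  show ?case
    using Cons unfolding eq graph_shape_def
    by (auto simp: nth_Cons split: nat.splits)
qed

text \<open>A vertex token or a pair of edge tokens is removed from the front. If the list starts
  with an edge, no vertex can follow, so the decomposition of the rest has no vertices and can be
  extended.\<close>

lemma graph_shape_eq:
  assumes "GG.marked ts" "graph_shape ts"
  shows "ts = graph_tokens (vertex_list ts) (edge_list ts)"
proof -
  have "\<exists>vs es. ts = graph_tokens vs es"
    using assms
  proof (induction "length ts" arbitrary: ts rule: less_induct)
    case less
    show ?case
    proof (cases ts)
      case Nil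
      then show ?thesis by (intro exI[of _ "[]"]) (simp add: graph_tokens_def)
    next
      case (Cons t us)
      obtain m u where t: "t = (m, u)" by (cases t)
      have m: "m \<in> {GVertex, GEdge, GSep}"
        using less.prems(1) Cons t by (cases m) (auto simp: GG.marked_def)
      have "m \<noteq> GSep" using less.prems(2) Cons t by (auto simp: graph_shape_def)
      show ?thesis
      proof (cases "m = GVertex")
        case True
        have "graph_shape us" unfolding graph_shape_def
        proof (intro conjI allI impI)
          fix j i assume "j < length us" "i < j" "fst (us ! j) = GVertex"
          then show "fst (us ! i) = GVertex"
            using less.prems(2) Cons unfolding graph_shape_def
            by (metis Suc_less_eq length_Cons nth_Cons_Suc)
        next
          fix i assume "i < length us" "fst (us ! i) = GEdge"
          then have "Suc (Suc i) < length ts \<and> fst (ts ! Suc (Suc i)) = GSep"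
            using less.prems(2) Cons unfolding graph_shape_def
            by (metis Suc_less_eq length_Cons nth_Cons_Suc)
          then show "Suc i < length us" "fst (us ! Suc i) = GSep" using Cons by auto
        next
          fix j assume "j < length us" "fst (us ! j) = GSep"
          then obtain i where "Suc j = Suc i" "fst (ts ! i) = GEdge"
            using less.prems(2) Cons unfolding graph_shape_def
            by (metis Suc_less_eq length_Cons nth_Cons_Suc)
          then show "\<exists>i. j = Suc i \<and> fst (us ! i) = GEdge"
            using Cons t True by (cases j) auto
        qed
        moreover have "GG.marked us" using less.prems(1) Cons by (simp add: GG.marked_def)
        ultimately obtain vs es where "us = graph_tokens vs es" using less.hyps Cons by force
        then have "ts = graph_tokens (u # vs) es" using Cons t True by (simp add: graph_tokens_def)
        then show ?thesis by blast
      next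
        case False
        then have "m = GEdge" using m \<open>m \<noteq> GSep\<close> by simp
        then have "Suc 0 < length ts \<and> fst (ts ! Suc 0) = GSep"
          using less.prems(2) Cons t unfolding graph_shape_def
          by (metis fst_conv length_Cons nth_Cons_0 zero_less_Suc)
        then obtain v ws where us: "us = (GSep, v) # ws" using Cons by (cases us) auto
        have nv: "fst (ws ! j) \<noteq> GVertex" if "j < length ws" for j
        proof
          assume "fst (ws ! j) = GVertex"
          then have "fst (ts ! Suc (Suc j)) = GVertex" using Cons us by simp
          moreover have "Suc (Suc j) < length ts" using that Cons us by simp
          ultimately have "fst (ts ! 0) = GVertex"
            using less.prems(2) unfolding graph_shape_def by (metis zero_less_Suc)
          then show False using Cons t False by simp
        qed
        have "graph_shape ws" unfolding graph_shape_def
        proof (intro conjI allI impI)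
          fix j i assume "j < length ws" "i < j" "fst (ws ! j) = GVertex"
          then show "fst (ws ! i) = GVertex" using nv by blast
        next
          fix i assume i: "i < length ws" "fst (ws ! i) = GEdge"
          then have "Suc (Suc i) < length ts" "fst (ts ! Suc (Suc i)) = GEdge" using Cons us by auto
          then have "Suc (Suc (Suc i)) < length ts \<and> fst (ts ! Suc (Suc (Suc i))) = GSep"
            using less.prems(2) unfolding graph_shape_def by blast
          then show "Suc i < length ws" "fst (ws ! Suc i) = GSep" using Cons us by auto
        next
          fix j assume "j < length ws" "fst (ws ! j) = GSep"
          then have "Suc (Suc j) < length ts" "fst (ts ! Suc (Suc j)) = GSep" using Cons us by auto
          then obtain i where "Suc (Suc j) = Suc i" "fst (ts ! i) = GEdge"
            using less.prems(2) unfolding graph_shape_def by blast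
          then show "\<exists>i. j = Suc i \<and> fst (ws ! i) = GEdge"
            using Cons us by (cases j) auto
        qed
        moreover have "GG.marked ws" using less.prems(1) Cons us by (simp add: GG.marked_def)
        ultimately obtain vs es where ws: "ws = graph_tokens vs es" using less.hyps Cons us by force
        have "vs = []"
        proof (cases vs)
          case (Cons v' vs')
          then show ?thesis using nv[of 0] ws by (simp add: graph_tokens_def)
        qed simp
        then have "ts = graph_tokens [] ((u, v) # es)"
          using Cons t us ws \<open>m = GEdge\<close> by (simp add: graph_tokens_def)
        then show ?thesis by blast
      qed
    qed
  qed
  then show ?thesis using lists_graph_tokens by metis
qed

lemma encodes_graph_word:
  assumes "GG.marked ts"
  shows "encodes_graph (GG.word ts) V E \<longleftrightarrow> graph_shape ts \<and> ugraph V E \<and>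
     distinct (vertex_list ts) \<and> V = set (vertex_list ts) \<and>
     distinct (map (\<lambda>(u, v). {u, v}) (edge_list ts)) \<and> E = (\<lambda>(u, v). {u, v}) ` set (edge_list ts)"
proof
  assume "encodes_graph (GG.word ts) V E"
  then obtain vs es where *: "ugraph V E" "GG.word ts = graph_word vs es" "distinct vs" "set vs = V"
    "distinct (map (\<lambda>(u, v). {u, v}) es)" "(\<lambda>(u, v). {u, v}) ` set es = E"
    unfolding encodes_graph_def by blast
  have "ts = graph_tokens vs es"
    using GG.word_inj[OF _ assms marked_graph_tokens] *(2) word_graph_tokens by metis
  then show "graph_shape ts \<and> ugraph V E \<and>
     distinct (vertex_list ts) \<and> V = set (vertex_list ts) \<and>
     distinct (map (\<lambda>(u, v). {u, v}) (edge_list ts)) \<and> E = (\<lambda>(u, v). {u, v}) ` set (edge_list ts)"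
    using * lists_graph_tokens graph_shape_graph_tokens by auto
next
  assume *: "graph_shape ts \<and> ugraph V E \<and>
     distinct (vertex_list ts) \<and> V = set (vertex_list ts) \<and>
     distinct (map (\<lambda>(u, v). {u, v}) (edge_list ts)) \<and> E = (\<lambda>(u, v). {u, v}) ` set (edge_list ts)"
  then have "GG.word ts = graph_word (vertex_list ts) (edge_list ts)"
    using graph_shape_eq[OF assms] word_graph_tokens by metis
  then show "encodes_graph (GG.word ts) V E" using * unfolding encodes_graph_def by blast
qed

definition graph_vertices :: "(gsym \<times> name) list \<Rightarrow> name set" where
  "graph_vertices ts = (\<lambda>i. snd (ts ! i)) ` occs {GVertex} ts"

definition edge_at :: "(gsym \<times> name) list \<Rightarrow> nat \<Rightarrow> name set" where
  "edge_at ts i = {snd (ts ! i), snd (ts ! Suc i)}"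

definition graph_edges :: "(gsym \<times> name) list \<Rightarrow> name set set" where
  "graph_edges ts = edge_at ts ` occs {GEdge} ts"

abbreviation end_marks :: "gsym set" where
  "end_marks \<equiv> {GEdge, GSep}"

definition end_names :: "(gsym \<times> name) list \<Rightarrow> name set" where
  "end_names ts = (\<lambda>i. snd (ts ! i)) ` occs end_marks ts"

text \<open>The conditions speak of tokens only, so that they can be queried; the degree bound
  appears as the restriction of the ranks of edge ends to 0, 1 and 2.\<close>

definition good_graph :: "(gsym \<times> name) list \<Rightarrow> bool" where
  "good_graph ts \<longleftrightarrow> graph_shape ts \<and> inj_on (\<lambda>i. snd (ts ! i)) (occs {GVertex} ts) \<and>
     (\<forall>t\<in>occs end_marks ts. snd (ts ! t) \<in> graph_vertices ts) \<and>
     (\<forall>i\<in>occs {GEdge} ts. snd (ts ! i) \<noteq> snd (ts ! Suc i)) \<and>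
     inj_on (edge_at ts) (occs {GEdge} ts) \<and>
     (\<forall>t\<in>occs end_marks ts. slot end_marks ts t < 3)"

lemma set_vertex_list: "set (vertex_list ts) = graph_vertices ts"
  by (auto simp: vertex_list_def graph_vertices_def occs_def)

lemma distinct_vertex_list:
  "distinct (vertex_list ts) \<longleftrightarrow> inj_on (\<lambda>i. snd (ts ! i)) (occs {GVertex} ts)"
proof -
  have "set (filter (\<lambda>i. fst (ts ! i) = GVertex) [0..<length ts]) = occs {GVertex} ts"
    by (auto simp: occs_def)
  then show ?thesis by (simp add: vertex_list_def distinct_map del: set_filter)
qed

lemma set_edge_list: "(\<lambda>(u, v). {u, v}) ` set (edge_list ts) = graph_edges ts"
  by (force simp: edge_list_def graph_edges_def occs_def edge_at_def)

lemma distinct_edge_list: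
  "distinct (map (\<lambda>(u, v). {u, v}) (edge_list ts)) \<longleftrightarrow> inj_on (edge_at ts) (occs {GEdge} ts)"
proof -
  have "set (filter (\<lambda>i. fst (ts ! i) = GEdge) [0..<length ts]) = occs {GEdge} ts"
    by (auto simp: occs_def)
  moreover have "(\<lambda>(u, v). {u, v}) \<circ> (\<lambda>i. (snd (ts ! i), snd (ts ! Suc i))) = edge_at ts"
    by (auto simp: edge_at_def fun_eq_iff)
  ultimately show ?thesis by (simp add: edge_list_def distinct_map del: set_filter)
qed

lemma occs_end_marks:
  assumes "graph_shape ts"
  shows "occs end_marks ts = occs {GEdge} ts \<union> Suc ` occs {GEdge} ts"
    and "occs {GEdge} ts \<inter> Suc ` occs {GEdge} ts = {}"
proof -
  have 1: "Suc i < length ts \<and> fst (ts ! Suc i) = GSep" if "i < length ts" "fst (ts ! i) = GEdge" for i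
    using assms that unfolding graph_shape_def by blast
  have 2: "\<exists>i. j = Suc i \<and> fst (ts ! i) = GEdge" if "j < length ts" "fst (ts ! j) = GSep" for j
    using assms that unfolding graph_shape_def by blast
  have "Suc i \<notin> occs {GEdge} ts" if "i \<in> occs {GEdge} ts" for i
    using 1[of i] that by (simp add: occs_def)
  then show "occs {GEdge} ts \<inter> Suc ` occs {GEdge} ts = {}" by blast
  show "occs end_marks ts = occs {GEdge} ts \<union> Suc ` occs {GEdge} ts"
  proof (intro equalityI subsetI)
    fix t assume "t \<in> occs end_marks ts"
    then show "t \<in> occs {GEdge} ts \<union> Suc ` occs {GEdge} ts"
      using 2[of t] by (auto simp: occs_def)
  qed (use 1 in \<open>auto simp: occs_def\<close>)
qed

text \<open>Every edge contributes two consecutive tokens, and no token is both the first end of an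
  edge and the second end of another. This is the double counting of edge ends.\<close>

lemma sum_occs_end_marks:
  assumes "graph_shape ts"
  shows "sum f (occs end_marks ts) = (\<Sum>i\<in>occs {GEdge} ts. f i + f (Suc i))"
  unfolding occs_end_marks(1)[OF assms] sum.distrib
  by (subst sum.union_disjoint) (auto simp: finite_occs occs_end_marks(2)[OF assms] sum.reindex)

text \<open>Without loops an edge names v at most once, and without repetitions edges correspond to
  their first tokens, so counting ends with name v counts edges at v.\<close>

lemma degree_graph_edges:
  assumes "graph_shape ts" "\<forall>i\<in>occs {GEdge} ts. snd (ts ! i) \<noteq> snd (ts ! Suc i)"
    and "inj_on (edge_at ts) (occs {GEdge} ts)"
  shows "degree (graph_edges ts) v = card {t \<in> occs end_marks ts. snd (ts ! t) = v}"
proof -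
  have "{e \<in> graph_edges ts. v \<in> e} = edge_at ts ` {i \<in> occs {GEdge} ts. v \<in> edge_at ts i}"
    by (auto simp: graph_edges_def)
  then have "degree (graph_edges ts) v = card {i \<in> occs {GEdge} ts. v \<in> edge_at ts i}"
    unfolding degree_def by (simp add: card_image inj_on_subset[OF assms(3)])
  also have "\<dots> = (\<Sum>i\<in>occs {GEdge} ts. of_bool (v \<in> edge_at ts i))"
    by (simp add: finite_occs of_bool_def sum.If_cases Collect_conj_eq Int_commute)
  also have "\<dots> = (\<Sum>i\<in>occs {GEdge} ts. of_bool (snd (ts ! i) = v) + of_bool (snd (ts ! Suc i) = v))"
    by (rule sum.cong) (use assms(2) in \<open>auto simp: edge_at_def\<close>)
  also have "\<dots> = (\<Sum>t\<in>occs end_marks ts. of_bool (snd (ts ! t) = v))"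
    by (simp add: sum_occs_end_marks[OF assms(1)])
  also have "\<dots> = card {t \<in> occs end_marks ts. snd (ts ! t) = v}"
    by (simp add: finite_occs of_bool_def sum.If_cases Collect_conj_eq Int_commute)
  finally show ?thesis .
qed

lemma degree_good_graph:
  "good_graph ts \<Longrightarrow> degree (graph_edges ts) v = card {t \<in> occs end_marks ts. snd (ts ! t) = v}"
  by (rule degree_graph_edges) (auto simp: good_graph_def)

lemma good_graph_ugraph: "good_graph ts \<Longrightarrow> ugraph (graph_vertices ts) (graph_edges ts)"
  using occs_end_marks(1)[of ts]
  by (auto simp: ugraph_def good_graph_def graph_vertices_def finite_occs graph_edges_def edge_at_def)

lemma good_graph_encodes:
  "GG.marked ts \<Longrightarrow> good_graph ts \<Longrightarrow> encodes_graph (GG.word ts) (graph_vertices ts) (graph_edges ts)"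
  using good_graph_ugraph
  by (auto simp: encodes_graph_word set_vertex_list set_edge_list distinct_vertex_list
      distinct_edge_list good_graph_def)

lemma good_graph_iff:
  assumes "GG.marked ts"
  shows "good_graph ts \<longleftrightarrow> (\<exists>V E. encodes_graph (GG.word ts) V E \<and> (\<forall>v\<in>V. degree E v \<le> 3))"
proof
  assume "good_graph ts"
  then have "degree (graph_edges ts) v \<le> 3" for v
    unfolding degree_good_graph[OF \<open>good_graph ts\<close>] card_occs_le_iff by (auto simp: good_graph_def)
  then show "\<exists>V E. encodes_graph (GG.word ts) V E \<and> (\<forall>v\<in>V. degree E v \<le> 3)"
    using good_graph_encodes[OF assms \<open>good_graph ts\<close>] by blast
next
  assume "\<exists>V E. encodes_graph (GG.word ts) V E \<and> (\<forall>v\<in>V. degree E v \<le> 3)"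
  then have *: "graph_shape ts" "ugraph (graph_vertices ts) (graph_edges ts)"
    "inj_on (\<lambda>i. snd (ts ! i)) (occs {GVertex} ts)" "inj_on (edge_at ts) (occs {GEdge} ts)"
    "\<forall>v\<in>graph_vertices ts. degree (graph_edges ts) v \<le> 3"
    by (auto simp: encodes_graph_word[OF assms] set_vertex_list set_edge_list distinct_vertex_list
        distinct_edge_list)
  have e: "edge_at ts i \<subseteq> graph_vertices ts" "card (edge_at ts i) = 2" if "i \<in> occs {GEdge} ts" for i
    using *(2) that by (auto simp: ugraph_def graph_edges_def)
  have ne: "\<forall>i\<in>occs {GEdge} ts. snd (ts ! i) \<noteq> snd (ts ! Suc i)"
    using e(2) by (fastforce simp: edge_at_def)
  have V: "\<forall>t\<in>occs end_marks ts. snd (ts ! t) \<in> graph_vertices ts"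
    using e(1) unfolding occs_end_marks(1)[OF *(1)] by (auto simp: edge_at_def)
  have "slot end_marks ts t < 3" if t: "t \<in> occs end_marks ts" for t
  proof -
    have "card {s \<in> occs end_marks ts. snd (ts ! s) = snd (ts ! t)} \<le> 3"
      using *(5) V t degree_graph_edges[OF *(1) ne *(4)] by auto
    then show ?thesis using t unfolding card_occs_le_iff by blast
  qed
  then show "good_graph ts" using * ne V by (simp add: good_graph_def)
qed

lemma TwoCVC3_word_iff:
  assumes "GG.marked ts"
  shows "GG.word ts \<in> TwoCVC3 \<longleftrightarrow> good_graph ts \<and>
    (\<exists>C. vertex_cover (graph_vertices ts) (graph_edges ts) C \<and> two_checkered (graph_edges ts) C)"
  using good_graph_iff[OF assms] good_graph_encodes[OF assms] encodes_graph_unique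
  unfolding TwoCVC3_def by blast

text \<open>An edge end is determined by its name and its rank below 3, which limits the number of
  ends by three times the number of vertices.\<close>

lemma card_graph_edges:
  assumes "good_graph ts"
  shows "card (graph_edges ts) \<le> 3 * card (graph_vertices ts)"
    and "card (end_names ts) \<le> 2 * card (graph_edges ts)"
    and "card (end_names ts) \<le> card (graph_vertices ts)"
proof -
  have shape: "graph_shape ts" using assms by (simp add: good_graph_def)
  have E: "card (graph_edges ts) = card (occs {GEdge} ts)"
    using assms by (simp add: graph_edges_def card_image good_graph_def)
  have fin: "finite (graph_vertices ts)" by (simp add: graph_vertices_def finite_occs)
  show "card (end_names ts) \<le> card (graph_vertices ts)"
    using assms fin by (intro card_mono) (auto simp: good_graph_def end_names_def)
  have "card (end_names ts) \<le> card (occs end_marks ts)"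
    unfolding end_names_def by (rule card_image_le) (rule finite_occs)
  also have "\<dots> \<le> card (occs {GEdge} ts) + card (Suc ` occs {GEdge} ts)"
    unfolding occs_end_marks(1)[OF shape] by (rule card_Un_le)
  also have "\<dots> = 2 * card (graph_edges ts)" by (simp add: card_image E)
  finally show "card (end_names ts) \<le> 2 * card (graph_edges ts)" .
  have "card (occs {GEdge} ts) \<le> card (occs end_marks ts)"
    by (rule card_mono) (auto simp: occs_def)
  also have "\<dots> \<le> card (graph_vertices ts \<times> {..<3 :: nat})"
  proof (rule card_inj_on_le)
    show "inj_on (\<lambda>t. (snd (ts ! t), slot end_marks ts t)) (occs end_marks ts)"
    proof (rule inj_onI)
      fix s t assume "s \<in> occs end_marks ts" "t \<in> occs end_marks ts"
        "(snd (ts ! s), slot end_marks ts s) = (snd (ts ! t), slot end_marks ts t)"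
      then show "s = t" using slot_inj[of s end_marks ts t] by simp
    qed
    show "(\<lambda>t. (snd (ts ! t), slot end_marks ts t)) ` occs end_marks ts \<subseteq> graph_vertices ts \<times> {..<3}"
      using assms by (auto simp: good_graph_def)
  qed (use fin in simp)
  finally show "card (graph_edges ts) \<le> 3 * card (graph_vertices ts)"
    using E by (simp add: card_cartesian_product)
qed

text \<open>The empty conjunction has to be a closed tautology, hence the quantifier; since it binds
  variable 0, conjunctions are used only where 0 is not yet bound.\<close>

fun conjunction :: "'a fm list \<Rightarrow> 'a fm" where
  "conjunction [] = Nt (Exi 0 (Nt (Mark UNIV 0)))"
| "conjunction (\<phi> # \<phi>s) = An \<phi> (conjunction \<phi>s)"

lemma sat_conjunction: "sat ts e (conjunction \<phi>s) \<longleftrightarrow> (\<forall>\<phi>\<in>set \<phi>s. sat ts e \<phi>)"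
  by (induction \<phi>s) auto

lemma scoped_conjunction: "0 \<notin> D \<Longrightarrow> scoped D (conjunction \<phi>s) \<longleftrightarrow> (\<forall>\<phi>\<in>set \<phi>s. scoped D \<phi>)"
  by (induction \<phi>s) auto

section \<open>Recognising admissible graph words by a query\<close>

definition good_graph_fm :: "gsym fm" where
  "good_graph_fm = conjunction
    [Al 0 (Al 1 (Imp (An (Less 1 0) (Mark {GVertex} 0)) (Mark {GVertex} 1))),
     Al 0 (Imp (Mark {GEdge} 0) (Exi 1 (An (adjacent 0 1 2) (Mark {GSep} 1)))),
     Al 0 (Imp (Mark {GSep} 0) (Exi 1 (An (adjacent 1 0 2) (Mark {GEdge} 1)))),
     Al 0 (Al 1 (Imp (An (Mark {GVertex} 0) (An (Mark {GVertex} 1) (Same 0 1))) (Nt (Less 0 1)))),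
     Al 0 (Imp (Mark end_marks 0) (Exi 1 (An (Mark {GVertex} 1) (Same 0 1)))),
     Al 0 (Al 1 (Imp (An (Mark {GEdge} 0) (adjacent 0 1 2)) (Nt (Same 0 1)))),
     Al 0 (Al 1 (Imp (An (Mark {GEdge} 0) (An (Mark {GEdge} 1) (Less 0 1)))
       (Al 2 (Al 3 (Imp (An (adjacent 0 2 4) (adjacent 1 3 4))
         (Nt (Or (An (Same 0 1) (Same 2 3)) (An (Same 0 3) (Same 2 1))))))))),
     Al 0 (Imp (Mark end_marks 0) (Nt (slot_ge end_marks 3 0 1)))]"

lemma scoped_good_graph_fm: "scoped {} good_graph_fm"
  unfolding good_graph_fm_def by (subst scoped_conjunction) (auto intro!: scoped_slot_ge simp del: slot_ge.simps)

lemma inj_on_nat_iff: "inj_on f (A :: nat set) \<longleftrightarrow> (\<forall>i\<in>A. \<forall>j\<in>A. f i = f j \<longrightarrow> \<not> i < j)"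
  unfolding inj_on_def by (metis linorder_neqE_nat less_irrefl)

lemma sat_good_graph_fm: "sat ts e good_graph_fm \<longleftrightarrow> good_graph ts"
proof -
  have 1: "sat ts e (Al 0 (Al 1 (Imp (An (Less 1 0) (Mark {GVertex} 0)) (Mark {GVertex} 1)))) \<longleftrightarrow>
      (\<forall>j<length ts. \<forall>i<j. fst (ts ! j) = GVertex \<longrightarrow> fst (ts ! i) = GVertex)"
    by (auto intro: less_trans)
  have 2: "sat ts e (Al 0 (Imp (Mark {GEdge} 0) (Exi 1 (An (adjacent 0 1 2) (Mark {GSep} 1))))) \<longleftrightarrow>
     (\<forall>i<length ts. fst (ts ! i) = GEdge \<longrightarrow> Suc i < length ts \<and> fst (ts ! Suc i) = GSep)"
    by auto
  have 3: "sat ts e (Al 0 (Imp (Mark {GSep} 0) (Exi 1 (An (adjacent 1 0 2) (Mark {GEdge} 1))))) \<longleftrightarrow>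
     (\<forall>j<length ts. fst (ts ! j) = GSep \<longrightarrow> (\<exists>i. j = Suc i \<and> fst (ts ! i) = GEdge))"
    by (simp cong: conj_cong) (meson Suc_lessD)
  have 4: "sat ts e (Al 0 (Al 1 (Imp (An (Mark {GVertex} 0) (An (Mark {GVertex} 1) (Same 0 1)))
      (Nt (Less 0 1))))) \<longleftrightarrow> inj_on (\<lambda>i. snd (ts ! i)) (occs {GVertex} ts)"
    by (auto simp: inj_on_nat_iff occs_def)
  have 5: "sat ts e (Al 0 (Imp (Mark end_marks 0) (Exi 1 (An (Mark {GVertex} 1) (Same 0 1))))) \<longleftrightarrow>
      (\<forall>t\<in>occs end_marks ts. snd (ts ! t) \<in> graph_vertices ts)"
    by (auto simp: graph_vertices_def occs_def image_iff)
  have 6: "sat ts e (Al 0 (Al 1 (Imp (An (Mark {GEdge} 0) (adjacent 0 1 2)) (Nt (Same 0 1))))) \<longleftrightarrow>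
      (\<forall>i\<in>occs {GEdge} ts. snd (ts ! i) \<noteq> snd (ts ! Suc i))" if "graph_shape ts"
  proof -
    have "Suc i < length ts" if "i < length ts" "fst (ts ! i) = GEdge" for i
      using that \<open>graph_shape ts\<close> unfolding graph_shape_def by blast
    moreover have "sat ts (e(0 := i)) (Al 1 (Imp (An (Mark {GEdge} 0) (adjacent 0 1 2)) (Nt (Same 0 1)))) \<longleftrightarrow>
        (fst (ts ! i) = GEdge \<longrightarrow> snd (ts ! i) \<noteq> snd (ts ! Suc i))"
      if "i < length ts" "fst (ts ! i) = GEdge \<longrightarrow> Suc i < length ts" for i
      using that by (auto cong: conj_cong)
    ultimately show ?thesis by (auto simp: occs_def)
  qed
  have 7: "sat ts e (Al 0 (Al 1 (Imp (An (Mark {GEdge} 0) (An (Mark {GEdge} 1) (Less 0 1)))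
       (Al 2 (Al 3 (Imp (An (adjacent 0 2 4) (adjacent 1 3 4))
         (Nt (Or (An (Same 0 1) (Same 2 3)) (An (Same 0 3) (Same 2 1)))))))))) \<longleftrightarrow>
      inj_on (edge_at ts) (occs {GEdge} ts)" if "graph_shape ts"
  proof -
    have "Suc i < length ts" if "i < length ts" "fst (ts ! i) = GEdge" for i
      using that \<open>graph_shape ts\<close> unfolding graph_shape_def by blast
    moreover define \<psi> :: "gsym fm" where "\<psi> = Al 2 (Al 3 (Imp (An (adjacent 0 2 4) (adjacent 1 3 4))
         (Nt (Or (An (Same 0 1) (Same 2 3)) (An (Same 0 3) (Same 2 1))))))"
    have "sat ts (e(0 := i, 1 := j)) \<psi> \<longleftrightarrow> edge_at ts i \<noteq> edge_at ts j"
      if "Suc i < length ts" "Suc j < length ts" for i j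
      using that by (auto simp: \<psi>_def edge_at_def doubleton_eq_iff)
    ultimately have "sat ts e (Al 0 (Al 1 (Imp (An (Mark {GEdge} 0) (An (Mark {GEdge} 1) (Less 0 1))) \<psi>)))
        \<longleftrightarrow> (\<forall>i\<in>occs {GEdge} ts. \<forall>j\<in>occs {GEdge} ts. edge_at ts i = edge_at ts j \<longrightarrow> \<not> i < j)"
      by (auto simp: occs_def simp del: One_nat_def)
    then show ?thesis unfolding inj_on_nat_iff \<psi>_def .
  qed
  have 8: "sat ts e (Al 0 (Imp (Mark end_marks 0) (Nt (slot_ge end_marks 3 0 1)))) \<longleftrightarrow>
      (\<forall>t\<in>occs end_marks ts. slot end_marks ts t < 3)"
    by (auto simp: occs_def sat_slot_ge not_le simp del: slot_ge.simps)
  show ?thesis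
  \<comment> \<open>Formulas 6 and 7 quantify universally over the next token and would hold
    vacuously if it were missing, so their meaning is known only under \<open>graph_shape\<close>.
    If that fails, formulas 1 to 3 already make both sides false.\<close>
  proof (cases "graph_shape ts")
    case True
    show ?thesis
      unfolding good_graph_fm_def sat_conjunction list.set ball_simps 1 2 3 4 5 6[OF True] 7[OF True] 8
        good_graph_def
      using True unfolding graph_shape_def by blast
  next
    case False
    then show ?thesis
      unfolding good_graph_fm_def sat_conjunction list.set ball_simps 1 2 3 good_graph_def graph_shape_def
      by blast
  qed
qed

section \<open>Reductions computed by printers\<close>

context coding
begin

definition transduce :: "('a, 'b) printer \<Rightarrow> 'b list \<Rightarrow> 'a list \<Rightarrow> 'b list" where
  "transduce P bad x = (if \<exists>ts. marked ts \<and> x = word ts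
     then printed (THE ts. marked ts \<and> x = word ts) (\<lambda>_. 0) P else bad)"

lemma transduce_word: "marked ts \<Longrightarrow> transduce P bad (word ts) = printed ts (\<lambda>_. 0) P"
proof -
  assume "marked ts"
  then have "(THE ts'. marked ts' \<and> word ts = word ts') = ts"
    using word_inj by (intro the_equality) auto
  then show ?thesis using \<open>marked ts\<close> by (auto simp: transduce_def)
qed

lemma transduce_bit: "transduce P bad (bit b # y) = bad"
proof -
  have "bit b # y \<noteq> word ts" if "marked ts" for ts
    using word_start[OF that] by (metis list.distinct(1) list.sel(1) rangeI)
  then show ?thesis by (auto simp: transduce_def)
qed

text \<open>Turns a short reduction into a statement about lists of tokens. Words that begin with a
  bit go to \<open>bad\<close>, whose size 1 is covered by the additive constant.\<close>

lemma reducible_by_printer: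
  assumes "scoped_printer {} P"
    and "\<And>ts. marked ts \<Longrightarrow> (word ts \<in> fst X \<longleftrightarrow> printed ts (\<lambda>_. 0) P \<in> fst Y) \<and>
      snd Y (printed ts (\<lambda>_. 0) P) \<le> k * snd X (word ts) + 1"
    and "\<And>b y. bit b # y \<notin> fst X" and "bad \<notin> fst Y" "snd Y bad = 1" and "0 < k"
  shows "X \<le>\<^sub>s\<^sub>L Y"
  unfolding sL_reducible_def
proof (intro exI conjI allI)
  show "logspace_polytime_computable (transduce P bad)"
    by (rule logspace_polytime_computable_printer[OF assms(1)]) (simp_all add: transduce_word transduce_bit)
  show "real k > 0" "(1 :: real) > 0" using assms(6) by auto
  fix x
  have "(x \<in> fst X \<longleftrightarrow> transduce P bad x \<in> fst Y) \<and> snd Y (transduce P bad x) \<le> k * snd X x + 1"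
  proof (cases x rule: word_cases)
    case (1 ts)
    then show ?thesis using assms(2)[of ts] by (simp add: transduce_word)
  next
    case (2 b y)
    then show ?thesis using assms(3-5) by (simp add: transduce_bit)
  qed
  moreover have "real (snd Y (transduce P bad x)) \<le> real k * real (snd X x) + 1
      \<longleftrightarrow> snd Y (transduce P bad x) \<le> k * snd X x + 1"
    by (simp flip: of_nat_mult of_nat_Suc add: add.commute)
  ultimately show "x \<in> fst X \<longleftrightarrow> transduce P bad x \<in> fst Y"
    "real (snd Y (transduce P bad x)) \<le> real k * real (snd X x) + 1" by auto
qed

definition series :: "('a, 'b) printer list \<Rightarrow> ('a, 'b) printer" where
  "series Ps = foldr Then Ps (Out [])"

lemma printed_series: "printed ts e (series Ps) = concat (map (printed ts e) Ps)"
  unfolding series_def by (induction Ps) auto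

lemma scoped_series: "scoped_printer D (series Ps) \<longleftrightarrow> (\<forall>P\<in>set Ps. scoped_printer D P)"
  unfolding series_def by (induction Ps) auto

definition for_firsts :: "'a set \<Rightarrow> ('a, 'b) printer \<Rightarrow> ('a, 'b) printer" where
  "for_firsts A P = For 0 (Ite (An (Mark A 0) (Nt (slot_ge A 1 0 1))) P (Out []))"

lemma printed_for_firsts:
  "printed ts e (for_firsts A P) = concat (map (\<lambda>t. printed ts (e(0 := t)) P) (firsts A ts))"
proof -
  have "sat ts (e(0 := t)) (An (Mark A 0) (Nt (slot_ge A 1 0 1))) \<longleftrightarrow>
      fst (ts ! t) \<in> A \<and> slot A ts t = 0" if "t < length ts" for t
    using that sat_slot_ge[of "e(0 := t)" 0 ts 1 A 1] by (simp del: slot_ge.simps add: Suc_le_eq)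
  then have "printed ts e (for_firsts A P) = concat (map (\<lambda>t. if fst (ts ! t) \<in> A \<and> slot A ts t = 0
      then printed ts (e(0 := t)) P else []) [0..<length ts])"
    unfolding for_firsts_def printed.simps by (intro arg_cong[of _ _ concat] map_cong) auto
  then show ?thesis unfolding firsts_def concat_filter .
qed

lemma scoped_for_firsts: "scoped_printer {} (for_firsts A P) \<longleftrightarrow> scoped_printer {0} P"
  by (auto simp: for_firsts_def scoped_slot_ge simp del: slot_ge.simps)

definition for_next :: "('a, 'b) printer \<Rightarrow> ('a, 'b) printer" where
  "for_next P = For 1 (Ite (adjacent 0 1 2) P (Out []))"

lemma printed_for_next:
  assumes "e 0 < length ts"
  shows "printed ts e (for_next P) =
    (if Suc (e 0) < length ts then printed ts (e(1 := Suc (e 0))) P else [])"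
proof -
  have "printed ts e (for_next P) = concat (map (\<lambda>j. if j = Suc (e 0)
      then printed ts (e(1 := j)) P else []) [0..<length ts])"
    unfolding for_next_def printed.simps by (intro arg_cong[of _ _ concat] map_cong) (use assms in auto)
  then show ?thesis unfolding concat_eq_index .
qed

lemma scoped_for_next: "scoped_printer {0} (for_next P) \<longleftrightarrow> scoped_printer {1, 0} P"
  by (auto simp: for_next_def)

text \<open>Output consists of constants and copied names, so output that depends on a rank requires
  a case distinction over the three possible ranks.\<close>

definition by_slot :: "'a set \<Rightarrow> nat \<Rightarrow> nat \<Rightarrow> (nat \<Rightarrow> ('a, 'b) printer) \<Rightarrow> ('a, 'b) printer" where
  "by_slot A i k F = Ite (slot_ge A 2 i k) (F 2) (Ite (slot_ge A 1 i k) (F 1) (F 0))"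

lemma printed_by_slot:
  assumes "e i < length ts" "i < k" "slot A ts (e i) < 3"
  shows "printed ts e (by_slot A i k F) = printed ts e (F (slot A ts (e i)))"
proof -
  consider "slot A ts (e i) = 0" | "slot A ts (e i) = 1" | "slot A ts (e i) = 2"
    using assms(3) by linarith
  then show ?thesis
    using assms(1,2) by cases (auto simp: by_slot_def sat_slot_ge simp del: slot_ge.simps)
qed

lemma scoped_by_slot:
  assumes "i \<in> D" "\<forall>j\<in>D. j < k"
  shows "scoped_printer D (by_slot A i k F) \<longleftrightarrow> (\<forall>n\<in>{0, 1, 2}. scoped_printer D (F n))"
  using assms by (auto simp: by_slot_def scoped_slot_ge simp del: slot_ge.simps)

end

text \<open>The prefix is k in unary with a terminating 0. It is self-delimiting, which gives
  injectivity, and a printer can emit it as a constant before copying the name.\<close>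

definition tag :: "nat \<Rightarrow> name \<Rightarrow> name" where
  "tag k v = replicate k True @ False # v"

lemma tag_inj [simp]: "tag k v = tag k' v' \<longleftrightarrow> k = k' \<and> v = v'"
proof -
  have "replicate k True @ False # v = replicate k' True @ False # v' \<Longrightarrow> k = k' \<and> v = v'"
  proof (induction k arbitrary: k')
    case 0
    then show ?case by (cases k') auto
  next
    case (Suc k)
    then show ?case by (cases k') auto
  qed
  then show ?thesis by (auto simp: tag_def)
qed

lemma encodes_graph_graph_word:
  assumes "distinct vs" "distinct (map (\<lambda>(u, v). {u, v}) es)"
    and "\<And>u v. (u, v) \<in> set es \<Longrightarrow> u \<noteq> v \<and> u \<in> set vs \<and> v \<in> set vs"
  shows "encodes_graph (graph_word vs es) (set vs) ((\<lambda>(u, v). {u, v}) ` set es)"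
  unfolding encodes_graph_def ugraph_def using assms by fastforce

text \<open>Used for the constant output \<open>[GSep]\<close> and for the inputs that begin with a
  bit.\<close>

lemma not_graph_word:
  assumes "w \<noteq> []" "hd w \<notin> {GVertex, GEdge}"
  shows "w \<notin> TwoCVC3" "m_ver w = 1" "m_edg w = 1"
proof -
  have "\<not> encodes_graph w V E" for V E
    unfolding encodes_graph_def using assms graph_word_start by blast
  then show "w \<notin> TwoCVC3" "m_ver w = 1" "m_edg w = 1"
    by (auto simp: TwoCVC3_def m_ver_def m_edg_def)
qed

lemma not_cnf_word:
  assumes "w \<noteq> []" "hd w \<noteq> FClause"
  shows "w \<notin> TwoSAT3" "m_vbl w = 1"
proof -
  have "cnf_word \<phi> = [] \<or> hd (cnf_word \<phi>) = FClause" for \<phi>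
    by (cases \<phi>) (auto simp: cnf_word_def clause_word_def)
  then have "\<not> encodes_2cnf w \<phi>" for \<phi>
    unfolding encodes_2cnf_def using assms by metis
  then show "w \<notin> TwoSAT3" "m_vbl w = 1"
    by (auto simp: TwoSAT3_def m_vbl_def)
qed

section \<open>Removing isolated vertices\<close>

definition edge_indices :: "(gsym \<times> name) list \<Rightarrow> nat list" where
  "edge_indices ts = filter (\<lambda>i. fst (ts ! i) \<in> {GEdge}) [0..<length ts]"

lemma edge_list_eq: "edge_list ts = map (\<lambda>i. (snd (ts ! i), snd (ts ! Suc i))) (edge_indices ts)"
  by (simp add: edge_list_def edge_indices_def)

lemma set_edge_indices: "set (edge_indices ts) = occs {GEdge} ts"
  by (auto simp: edge_indices_def occs_def)

lemma distinct_edge_indices: "distinct (edge_indices ts)"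
  by (simp add: edge_indices_def)

lemma TwoCVC3_encodes:
  "encodes_graph w V E \<Longrightarrow> w \<in> TwoCVC3 \<longleftrightarrow>
    (\<forall>v\<in>V. degree E v \<le> 3) \<and> (\<exists>C. vertex_cover V E C \<and> two_checkered E C)"
  unfolding TwoCVC3_def using encodes_graph_unique by blast

context coding
begin

definition for_pairs :: "'a set \<Rightarrow> ('a, 'b) printer \<Rightarrow> ('a, 'b) printer" where
  "for_pairs A P = For 0 (Ite (Mark A 0) (for_next P) (Out []))"

lemma printed_for_pairs:
  assumes "\<And>i. i < length ts \<Longrightarrow> fst (ts ! i) \<in> A \<Longrightarrow> Suc i < length ts"
  shows "printed ts e (for_pairs A P) = concat (map (\<lambda>i. printed ts (e(0 := i, 1 := Suc i)) P)
    (filter (\<lambda>i. fst (ts ! i) \<in> A) [0..<length ts]))"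
proof -
  have "printed ts e (for_pairs A P) = concat (map (\<lambda>i. if fst (ts ! i) \<in> A
      then printed ts (e(0 := i, 1 := Suc i)) P else []) [0..<length ts])"
    unfolding for_pairs_def printed.simps
    by (intro arg_cong[of _ _ concat] map_cong) (use assms in \<open>auto simp: printed_for_next\<close>)
  then show ?thesis unfolding concat_filter .
qed

lemma scoped_for_pairs: "scoped_printer {} (for_pairs A P) \<longleftrightarrow> scoped_printer {1, 0} P"
  by (auto simp: for_pairs_def scoped_for_next)

end

lemma good_graph_Suc:
  "good_graph ts \<Longrightarrow> i < length ts \<Longrightarrow> fst (ts ! i) \<in> {GEdge} \<Longrightarrow> Suc i < length ts"
  unfolding good_graph_def graph_shape_def by blast

lemma GG_printed_for_edges:
  assumes "good_graph ts"
  shows "GG.printed ts e (GG.for_pairs {GEdge} P) =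
    concat (map (\<lambda>i. GG.printed ts (e(0 := i, 1 := Suc i)) P) (edge_indices ts))"
  unfolding edge_indices_def by (rule GG.printed_for_pairs) (rule good_graph_Suc[OF assms])

text \<open>The same map reduces in both directions. From vertices to edges the identity would not
  do: a graph with vertices of large degree may have too many edges for the linear bound, although
  it is no positive instance.\<close>

definition prune_printer :: "(gsym, gsym) printer" where
  "prune_printer = Ite good_graph_fm
     (Then (GG.for_firsts end_marks (Then (Out [GVertex]) (Name 0)))
       (GG.for_pairs {GEdge} (GG.series [Out [GEdge], Name 0, Out [GSep], Name 1])))
     (Out [GSep])"

lemma scoped_prune_printer: "scoped_printer {} prune_printer"
  by (simp add: prune_printer_def scoped_good_graph_fm GG.scoped_for_firsts GG.scoped_for_pairs GG.scoped_series)

lemma printed_prune_printer: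
  "GG.printed ts e prune_printer = (if good_graph ts
     then graph_word (map (\<lambda>t. snd (ts ! t)) (firsts end_marks ts)) (edge_list ts) else [GSep])"
proof (cases "good_graph ts")
  case True
  have "GG.printed ts e prune_printer =
      concat (map (\<lambda>t. GVertex # map GBit (snd (ts ! t))) (firsts end_marks ts)) @
      concat (map (\<lambda>i. GEdge # map GBit (snd (ts ! i)) @ GSep # map GBit (snd (ts ! Suc i))) (edge_indices ts))"
    using True
    by (simp add: prune_printer_def sat_good_graph_fm GG.printed_for_firsts
        GG_printed_for_edges GG.printed_series)
  then show ?thesis
    using True by (simp add: graph_word_def vertex_word_def[abs_def] edge_word_def[abs_def] edge_list_eq o_def)
qed (simp add: prune_printer_def sat_good_graph_fm)

lemma edge_at_end_names: "graph_shape ts \<Longrightarrow> i \<in> occs {GEdge} ts \<Longrightarrow> edge_at ts i \<subseteq> end_names ts"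
  using occs_end_marks(1)[of ts] by (auto simp: end_names_def edge_at_def)

lemma pruned_encodes:
  assumes "good_graph ts"
  shows "encodes_graph (graph_word (map (\<lambda>t. snd (ts ! t)) (firsts end_marks ts)) (edge_list ts))
    (end_names ts) (graph_edges ts)"
proof -
  let ?vs = "map (\<lambda>t. snd (ts ! t)) (firsts end_marks ts)"
  have shape: "graph_shape ts" using assms by (simp add: good_graph_def)
  have vs: "set ?vs = end_names ts" by (simp add: names_firsts end_names_def)
  have "encodes_graph (graph_word ?vs (edge_list ts)) (set ?vs) ((\<lambda>(u, v). {u, v}) ` set (edge_list ts))"
  proof (rule encodes_graph_graph_word)
    show "distinct (map (\<lambda>(u, v). {u, v}) (edge_list ts))"
      using assms by (simp add: distinct_edge_list good_graph_def)
    fix u v assume "(u, v) \<in> set (edge_list ts)"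
    then obtain i where "i \<in> occs {GEdge} ts" "u = snd (ts ! i)" "v = snd (ts ! Suc i)"
      by (auto simp: edge_list_eq set_edge_indices)
    then show "u \<noteq> v \<and> u \<in> set ?vs \<and> v \<in> set ?vs"
      using assms edge_at_end_names[OF shape, of i] unfolding vs by (auto simp: good_graph_def edge_at_def)
  qed (rule distinct_firsts)
  then show ?thesis unfolding vs set_edge_list .
qed

text \<open>A cover may be intersected with the vertices that lie on edges, since both properties of
  it, including the degrees in the definition of a grip, depend on the edges alone.\<close>

lemma cover_end_names:
  assumes "good_graph ts"
  shows "(\<exists>C. vertex_cover (graph_vertices ts) (graph_edges ts) C \<and> two_checkered (graph_edges ts) C) \<longleftrightarrow>
    (\<exists>C. vertex_cover (end_names ts) (graph_edges ts) C \<and> two_checkered (graph_edges ts) C)"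
proof
  assume "\<exists>C. vertex_cover (graph_vertices ts) (graph_edges ts) C \<and> two_checkered (graph_edges ts) C"
  then obtain C where C: "vertex_cover (graph_vertices ts) (graph_edges ts) C" "two_checkered (graph_edges ts) C"
    by blast
  have sub: "e \<subseteq> end_names ts" if "e \<in> graph_edges ts" for e
    using that assms edge_at_end_names[of ts] by (auto simp: graph_edges_def good_graph_def)
  have "vertex_cover (end_names ts) (graph_edges ts) (C \<inter> end_names ts)"
    using C(1) sub unfolding vertex_cover_def by blast
  moreover have "two_checkered (graph_edges ts) (C \<inter> end_names ts)"
    using C(2) unfolding two_checkered_def by blast
  ultimately show "\<exists>C. vertex_cover (end_names ts) (graph_edges ts) C \<and> two_checkered (graph_edges ts) C"
    by blast
next
  have "end_names ts \<subseteq> graph_vertices ts" using assms by (auto simp: good_graph_def end_names_def)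
  then show "\<exists>C. vertex_cover (end_names ts) (graph_edges ts) C \<and> two_checkered (graph_edges ts) C \<Longrightarrow>
      \<exists>C. vertex_cover (graph_vertices ts) (graph_edges ts) C \<and> two_checkered (graph_edges ts) C"
    unfolding vertex_cover_def by blast
qed

lemma prune_correct:
  assumes "GG.marked ts"
  shows "GG.word ts \<in> TwoCVC3 \<longleftrightarrow> GG.printed ts e prune_printer \<in> TwoCVC3"
proof (cases "good_graph ts")
  case True
  have "degree (graph_edges ts) v \<le> 3" for v
    unfolding degree_good_graph[OF True] card_occs_le_iff using True by (auto simp: good_graph_def)
  then show ?thesis
    using True TwoCVC3_word_iff[OF assms] TwoCVC3_encodes[OF pruned_encodes[OF True]]
      cover_end_names[OF True] by (simp add: printed_prune_printer)
next
  case False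
  then show ?thesis
    using TwoCVC3_word_iff[OF assms] not_graph_word(1)[of "[GSep]"] by (simp add: printed_prune_printer)
qed

lemma prune_sizes:
  assumes "GG.marked ts"
  shows "m_ver (GG.printed ts e prune_printer) \<le> 2 * m_edg (GG.word ts) + 1"
    and "m_edg (GG.printed ts e prune_printer) \<le> 3 * m_ver (GG.word ts) + 1"
proof -
  have "m_ver (GG.printed ts e prune_printer) \<le> 2 * m_edg (GG.word ts) + 1 \<and>
      m_edg (GG.printed ts e prune_printer) \<le> 3 * m_ver (GG.word ts) + 1"
  proof (cases "good_graph ts")
    case True
    have "m_ver (GG.word ts) = card (graph_vertices ts)" "m_edg (GG.word ts) = card (graph_edges ts)"
      using m_ver_eq m_edg_eq good_graph_encodes[OF assms True] by auto
    moreover have "m_ver (GG.printed ts e prune_printer) = card (end_names ts)"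
      "m_edg (GG.printed ts e prune_printer) = card (graph_edges ts)"
      using m_ver_eq m_edg_eq pruned_encodes[OF True] True by (auto simp: printed_prune_printer)
    ultimately show ?thesis using card_graph_edges[OF True] by simp
  next
    case False
    then show ?thesis using not_graph_word[of "[GSep]"] by (simp add: printed_prune_printer)
  qed
  then show "m_ver (GG.printed ts e prune_printer) \<le> 2 * m_edg (GG.word ts) + 1"
    "m_edg (GG.printed ts e prune_printer) \<le> 3 * m_ver (GG.word ts) + 1" by auto
qed

lemma TwoCVC3_ver_edg: "(TwoCVC3, m_ver) \<equiv>\<^sub>s\<^sub>L (TwoCVC3, m_edg)"
  unfolding sL_equivalent_def
proof
  show "(TwoCVC3, m_ver) \<le>\<^sub>s\<^sub>L (TwoCVC3, m_edg)"
    by (rule GG.reducible_by_printer[OF scoped_prune_printer, where k = 3 and bad = "[GSep]"])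
      (use prune_correct prune_sizes not_graph_word in auto)
  show "(TwoCVC3, m_edg) \<le>\<^sub>s\<^sub>L (TwoCVC3, m_ver)"
    by (rule GG.reducible_by_printer[OF scoped_prune_printer, where k = 2 and bad = "[GSep]"])
      (use prune_correct prune_sizes not_graph_word in auto)
qed

section \<open>From covers to satisfiability\<close>

interpretation GF: coding GBit FBit
  by standard (auto intro: injI)

lemma GF_printed_for_edges:
  assumes "good_graph ts"
  shows "GF.printed ts e (GF.for_pairs {GEdge} P) =
    concat (map (\<lambda>i. GF.printed ts (e(0 := i, 1 := Suc i)) P) (edge_indices ts))"
  unfolding edge_indices_def by (rule GF.printed_for_pairs) (rule good_graph_Suc[OF assms])

text \<open>A closed chain of implications makes all six copies equivalent and uses every copy only
  twice, once in each polarity.\<close>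

definition implication_cycle :: "name \<Rightarrow> name cnf" where
  "implication_cycle v = map (\<lambda>k. [Neg (tag k v), Pos (tag (Suc k mod 6) v)]) [0..<6]"

text \<open>Rank 2 belongs to a third edge end, so this detects degree at least 3; an edge is a grip
  exactly if neither of its ends is branching.\<close>

definition branching :: "(gsym \<times> name) list \<Rightarrow> name \<Rightarrow> bool" where
  "branching ts v \<longleftrightarrow> (\<exists>t\<in>occs end_marks ts. snd (ts ! t) = v \<and> 2 \<le> slot end_marks ts t)"

text \<open>The end of an edge in slot s of its vertex uses copies 2 s and 2 s + 1 of the vertex.\<close>

definition edge_clauses :: "(gsym \<times> name) list \<Rightarrow> nat \<Rightarrow> name cnf" where
  "edge_clauses ts i = (let copy = (\<lambda>b j. tag (2 * slot end_marks ts j + b) (snd (ts ! j))) in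
     [Pos (copy 0 i), Pos (copy 0 (Suc i))] #
     (if branching ts (snd (ts ! i)) \<or> branching ts (snd (ts ! Suc i))
      then [[Neg (copy 1 i), Neg (copy 1 (Suc i))]] else []))"

text \<open>Only vertices on edges receive a cycle, which bounds the number of variables by the
  number of edges as well.\<close>

definition cover_cnf :: "(gsym \<times> name) list \<Rightarrow> name cnf" where
  "cover_cnf ts = concat (map (\<lambda>t. implication_cycle (snd (ts ! t))) (firsts end_marks ts)) @
     concat (map (edge_clauses ts) (edge_indices ts))"

definition print_literal :: "fsym \<Rightarrow> nat \<Rightarrow> nat \<Rightarrow> (gsym, fsym) printer" where
  "print_literal a k i = Then (Out (a # map FBit (tag k []))) (Name i)"

definition branching_fm :: "nat \<Rightarrow> gsym fm" where
  "branching_fm i = Exi 2 (An (Mark end_marks 2) (An (Same 2 i) (slot_ge end_marks 2 2 3)))"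

definition cover_printer :: "(gsym, fsym) printer" where
  "cover_printer = Ite good_graph_fm
     (Then (GF.for_firsts end_marks (GF.series (map (\<lambda>k. GF.series
         [Out [FClause], print_literal FNeg k 0, print_literal FPos (Suc k mod 6) 0]) [0..<6])))
       (GF.for_pairs {GEdge} (GF.series
         [Out [FClause], GF.by_slot end_marks 0 2 (\<lambda>s. print_literal FPos (2 * s) 0),
            GF.by_slot end_marks 1 2 (\<lambda>s. print_literal FPos (2 * s) 1),
          Ite (Or (branching_fm 0) (branching_fm 1)) (GF.series
            [Out [FClause], GF.by_slot end_marks 0 2 (\<lambda>s. print_literal FNeg (2 * s + 1) 0),
               GF.by_slot end_marks 1 2 (\<lambda>s. print_literal FNeg (2 * s + 1) 1)]) (Out [])])))
     (Out [FBit True])"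

lemma printed_print_literal:
  "GF.printed ts e (print_literal FPos k i) = literal_word (Pos (tag k (snd (ts ! e i))))"
  "GF.printed ts e (print_literal FNeg k i) = literal_word (Neg (tag k (snd (ts ! e i))))"
  by (auto simp: print_literal_def tag_def)

lemma scoped_cover_printer: "scoped_printer {} cover_printer"
  unfolding cover_printer_def
  by (auto simp: scoped_good_graph_fm GF.scoped_for_firsts GF.scoped_for_pairs GF.scoped_series
      GF.scoped_by_slot print_literal_def branching_fm_def scoped_slot_ge simp del: slot_ge.simps)

lemma sat_branching_fm:
  assumes "e i < length ts" "i \<noteq> 2"
  shows "sat ts e (branching_fm i) \<longleftrightarrow> branching ts (snd (ts ! e i))"
proof -
  have "sat ts (e(2 := t)) (slot_ge end_marks 2 2 3) \<longleftrightarrow> 2 \<le> slot end_marks ts t" if "t < length ts" for t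
    by (subst sat_slot_ge) (use that in auto)
  then show ?thesis
    using assms by (auto simp: branching_fm_def branching_def occs_def simp del: slot_ge.simps)
qed

lemma good_graph_slot:
  assumes "good_graph ts" "i \<in> occs {GEdge} ts"
  shows "slot end_marks ts i < 3" "slot end_marks ts (Suc i) < 3"
  using assms occs_end_marks(1)[of ts] by (auto simp: good_graph_def)

lemma printed_cover_printer:
  "GF.printed ts e cover_printer = (if good_graph ts then cnf_word (cover_cnf ts) else [FBit True])"
proof (cases "good_graph ts")
  case True
  let ?Q = "GF.series
         [Out [FClause], GF.by_slot end_marks 0 2 (\<lambda>s. print_literal FPos (2 * s) 0),
            GF.by_slot end_marks 1 2 (\<lambda>s. print_literal FPos (2 * s) 1),
          Ite (Or (branching_fm 0) (branching_fm 1)) (GF.series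
            [Out [FClause], GF.by_slot end_marks 0 2 (\<lambda>s. print_literal FNeg (2 * s + 1) 0),
               GF.by_slot end_marks 1 2 (\<lambda>s. print_literal FNeg (2 * s + 1) 1)]) (Out [])]"
  have 1: "GF.printed ts (e(0 := i, 1 := Suc i)) ?Q = cnf_word (edge_clauses ts i)"
    if "i \<in> occs {GEdge} ts" for i
  proof -
    have "i < length ts" "Suc i < length ts" using that good_graph_Suc[OF True, of i] by (auto simp: occs_def)
    then show ?thesis
      using good_graph_slot[OF True that]
      by (auto simp: GF.printed_series GF.printed_by_slot printed_print_literal sat_branching_fm
          edge_clauses_def Let_def cnf_word_def clause_word_def simp del: literal_word.simps)
  qed
  have 2: "GF.printed ts (e(0 := t)) (GF.series (map (\<lambda>k. GF.series
         [Out [FClause], print_literal FNeg k 0, print_literal FPos (Suc k mod 6) 0]) [0..<6])) =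
      cnf_word (implication_cycle (snd (ts ! t)))" for t
    by (simp add: GF.printed_series printed_print_literal implication_cycle_def cnf_word_def
        clause_word_def o_def del: literal_word.simps)
  have cnf: "cnf_word (\<phi> @ \<psi>) = cnf_word \<phi> @ cnf_word \<psi>"
    "cnf_word (concat \<phi>s) = concat (map cnf_word \<phi>s)" for \<phi> \<psi> \<phi>s
    by (auto simp: cnf_word_def map_concat) (induction \<phi>s, auto simp: cnf_word_def)
  have "GF.printed ts e cover_printer =
      concat (map (\<lambda>t. cnf_word (implication_cycle (snd (ts ! t)))) (firsts end_marks ts)) @
      concat (map (\<lambda>i. cnf_word (edge_clauses ts i)) (edge_indices ts))"
  proof -
    have "map (\<lambda>i. GF.printed ts (e(0 := i, 1 := Suc i)) ?Q) (edge_indices ts) =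
        map (\<lambda>i. cnf_word (edge_clauses ts i)) (edge_indices ts)"
      by (rule map_cong[OF refl]) (use 1 in \<open>simp add: set_edge_indices\<close>)
    then show ?thesis
      using True unfolding cover_printer_def GF.printed.simps GF.printed_for_firsts 2
        GF_printed_for_edges[OF True]
      by (simp only: sat_good_graph_fm if_True)
  qed
  then show ?thesis using True by (simp add: cover_cnf_def cnf o_def)
next
  case False
  then show ?thesis by (simp add: cover_printer_def sat_good_graph_fm)
qed

lemma occurrences_append: "occurrences (\<phi> @ \<psi>) x = occurrences \<phi> x + occurrences \<psi> x"
  by (simp add: occurrences_def)

lemma occurrences_concat: "occurrences (concat \<phi>s) x = sum_list (map (\<lambda>\<phi>. occurrences \<phi> x) \<phi>s)"
  by (induction \<phi>s) (auto simp: occurrences_def)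

lemma upt_6: "[0..<6] = [0, 1, 2, 3, 4, 5]"
  by code_simp

lemma occurrences_implication_cycle:
  "occurrences (implication_cycle v) x \<le> (if \<exists>k. x = tag k v then 2 else 0)"
proof (cases "\<exists>k. x = tag k v")
  case True
  then obtain k where "x = tag k v" by blast
  then show ?thesis by (auto simp: implication_cycle_def upt_6 occurrences_def)
next
  case False
  then have "tag k v \<noteq> x" for k by blast
  then show ?thesis by (auto simp: implication_cycle_def upt_6 occurrences_def)
qed

text \<open>The positive clause uses copies with even numbers and the negative one copies with odd
  numbers, so a fixed variable is used at most once at each end of the edge.\<close>

lemma occurrences_edge_clauses:
  fixes ts x
  defines "g \<equiv> \<lambda>j. of_bool (\<exists>b<2. x = tag (2 * slot end_marks ts j + b) (snd (ts ! j))) :: nat"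
  shows "occurrences (edge_clauses ts i) x \<le> g i + g (Suc i)"
proof -
  let ?c = "\<lambda>b j. of_bool (x = tag (2 * slot end_marks ts j + b) (snd (ts ! j))) :: nat"
  have "occurrences (edge_clauses ts i) x \<le> (?c 0 i + ?c 1 i) + (?c 0 (Suc i) + ?c 1 (Suc i))"
    by (auto simp: edge_clauses_def Let_def occurrences_def)
  moreover have "?c 0 j + ?c 1 j \<le> g j" for j
  proof -
    have "\<not> (x = tag (2 * slot end_marks ts j + 0) (snd (ts ! j)) \<and>
        x = tag (2 * slot end_marks ts j + 1) (snd (ts ! j)))" by auto
    moreover have "(0 :: nat) < 2" "(1 :: nat) < 2" by auto
    ultimately show ?thesis unfolding g_def by (simp only: of_bool_def) (auto split: if_splits)
  qed
  ultimately show ?thesis by (meson add_mono le_trans)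
qed

lemma card_le_1: "(\<And>s t. s \<in> S \<Longrightarrow> t \<in> S \<Longrightarrow> s = t) \<Longrightarrow> card S \<le> 1"
  by (metis card_le_Suc0_iff_eq One_nat_def card.infinite zero_le_one)

text \<open>A copy occurs twice in the cycle of its own vertex, which is printed once, and at most
  once in edge clauses, because its vertex and number determine a single edge end. The sum is
  3.\<close>

lemma occurrences_cover_cnf: "graph_shape ts \<Longrightarrow> occurrences (cover_cnf ts) x \<le> 3"
proof -
  assume shape: "graph_shape ts"
  have "occurrences (concat (map (\<lambda>t. implication_cycle (snd (ts ! t))) (firsts end_marks ts))) x
      = (\<Sum>t\<in>set (firsts end_marks ts). occurrences (implication_cycle (snd (ts ! t))) x)"
    by (simp add: occurrences_concat o_def sum_list_distinct_conv_sum_set distinct_firsts)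
  also have "\<dots> \<le> (\<Sum>t\<in>set (firsts end_marks ts). if \<exists>k. x = tag k (snd (ts ! t)) then 2 else 0)"
    by (rule sum_mono) (rule occurrences_implication_cycle)
  also have "\<dots> = 2 * card {t \<in> set (firsts end_marks ts). \<exists>k. x = tag k (snd (ts ! t))}"
    by (simp add: sum.If_cases Collect_conj_eq Int_commute)
  also have "card {t \<in> set (firsts end_marks ts). \<exists>k. x = tag k (snd (ts ! t))} \<le> 1"
  proof (rule card_le_1)
    fix s t assume "s \<in> {t \<in> set (firsts end_marks ts). \<exists>k. x = tag k (snd (ts ! t))}"
      "t \<in> {t \<in> set (firsts end_marks ts). \<exists>k. x = tag k (snd (ts ! t))}"
    then show "s = t" using inj_onD[OF inj_firsts, of ts s t end_marks] by auto
  qed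
  finally have 1: "occurrences (concat (map (\<lambda>t. implication_cycle (snd (ts ! t))) (firsts end_marks ts))) x \<le> 2"
    by simp
  define g where "g = (\<lambda>j. of_bool (\<exists>b<2. x = tag (2 * slot end_marks ts j + b) (snd (ts ! j))) :: nat)"
  have "occurrences (concat (map (edge_clauses ts) (edge_indices ts))) x
      = (\<Sum>i\<in>occs {GEdge} ts. occurrences (edge_clauses ts i) x)"
    by (simp add: occurrences_concat o_def sum_list_distinct_conv_sum_set distinct_edge_indices set_edge_indices)
  also have "\<dots> \<le> (\<Sum>i\<in>occs {GEdge} ts. g i + g (Suc i))"
    unfolding g_def by (rule sum_mono) (rule occurrences_edge_clauses)
  also have "\<dots> = sum g (occs end_marks ts)" by (simp add: sum_occs_end_marks[OF shape])
  also have "\<dots> = card {t \<in> occs end_marks ts. \<exists>b<2. x = tag (2 * slot end_marks ts t + b) (snd (ts ! t))}"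
    unfolding g_def by (simp add: finite_occs of_bool_def sum.If_cases Collect_conj_eq Int_commute)
  also have "\<dots> \<le> 1"
  proof (rule card_le_1)
    fix s t
    assume "s \<in> {t \<in> occs end_marks ts. \<exists>b<2. x = tag (2 * slot end_marks ts t + b) (snd (ts ! t))}"
      and "t \<in> {t \<in> occs end_marks ts. \<exists>b<2. x = tag (2 * slot end_marks ts t + b) (snd (ts ! t))}"
    then obtain b c where *: "s \<in> occs end_marks ts" "t \<in> occs end_marks ts" "b < 2" "c < 2"
      "tag (2 * slot end_marks ts s + b) (snd (ts ! s)) = tag (2 * slot end_marks ts t + c) (snd (ts ! t))"
      by auto
    then have "slot end_marks ts s = slot end_marks ts t" "snd (ts ! s) = snd (ts ! t)" by auto
    then show "s = t" using slot_inj *(1,2) by blast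
  qed
  finally have 2: "occurrences (concat (map (edge_clauses ts) (edge_indices ts))) x \<le> 1" .
  show ?thesis using 1 2 by (simp add: cover_cnf_def occurrences_append)
qed

lemma two_cnf_cover_cnf: "two_cnf (cover_cnf ts)"
  by (auto simp: two_cnf_def cover_cnf_def implication_cycle_def edge_clauses_def Let_def split: if_splits)

lemma card_cnf_vars_cover_cnf:
  assumes "good_graph ts"
  shows "card (cnf_vars (cover_cnf ts)) \<le> 6 * card (end_names ts)"
proof -
  have shape: "graph_shape ts" using assms by (simp add: good_graph_def)
  define T where "T = (\<lambda>(k, v). tag k v) ` ({..<6 :: nat} \<times> end_names ts)"
  have copy: "tag (2 * slot end_marks ts t + b) (snd (ts ! t)) \<in> T"
    if "t \<in> occs end_marks ts" "b < 2" for t b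
  proof -
    have "slot end_marks ts t < 3" using assms that by (auto simp: good_graph_def)
    then show ?thesis using that by (auto simp: end_names_def T_def)
  qed
  have "cnf_vars (cover_cnf ts) \<subseteq> T"
  proof
    fix x assume "x \<in> cnf_vars (cover_cnf ts)"
    then obtain l c where l: "c \<in> set (cover_cnf ts)" "l \<in> set c" "x = var_of l"
      by (auto simp: cnf_vars_def)
    then consider t where "t \<in> set (firsts end_marks ts)" "c \<in> set (implication_cycle (snd (ts ! t)))"
      | i where "i \<in> occs {GEdge} ts" "c \<in> set (edge_clauses ts i)"
      by (auto simp: cover_cnf_def set_edge_indices)
    then show "x \<in> T"
    proof cases
      case 1
      then have "snd (ts ! t) \<in> end_names ts" by (auto simp: end_names_def set_firsts)
      then have "tag k (snd (ts ! t)) \<in> T" if "k < 6" for k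
        using that by (auto simp: T_def)
      then show ?thesis using 1 l by (auto simp: implication_cycle_def)
    next
      case 2
      then have o: "i \<in> occs end_marks ts" "Suc i \<in> occs end_marks ts"
        unfolding occs_end_marks(1)[OF shape] by auto
      show ?thesis
        using 2 l copy[OF o(1), of 0] copy[OF o(1), of 1] copy[OF o(2), of 0] copy[OF o(2), of 1]
        by (auto simp: edge_clauses_def Let_def split: if_splits)
    qed
  qed
  then have "card (cnf_vars (cover_cnf ts)) \<le> card T"
    by (rule card_mono[rotated]) (simp add: T_def end_names_def finite_occs)
  also have "\<dots> \<le> card ({..<6 :: nat} \<times> end_names ts)"
    unfolding T_def by (rule card_image_le) (simp add: end_names_def finite_occs)
  finally show ?thesis by (simp add: card_cartesian_product)
qed

lemma branching_iff: "good_graph ts \<Longrightarrow> branching ts v \<longleftrightarrow> \<not> degree (graph_edges ts) v \<le> 2"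
  unfolding degree_good_graph card_occs_le_iff branching_def by (auto simp: not_less)

lemma two_checkered_graph_edges:
  assumes "good_graph ts"
  shows "two_checkered (graph_edges ts) C \<longleftrightarrow>
    (\<forall>i\<in>occs {GEdge} ts. branching ts (snd (ts ! i)) \<or> branching ts (snd (ts ! Suc i)) \<longrightarrow>
      \<not> (snd (ts ! i) \<in> C \<and> snd (ts ! Suc i) \<in> C))"
  using branching_iff[OF assms]
  by (auto simp: two_checkered_def graph_edges_def grip_def edge_at_def)

lemma satisfiable_cover_cnf:
  assumes "good_graph ts"
  shows "satisfiable (cover_cnf ts) \<longleftrightarrow>
    (\<exists>C. vertex_cover (end_names ts) (graph_edges ts) C \<and> two_checkered (graph_edges ts) C)"
proof
  assume "satisfiable (cover_cnf ts)"
  then obtain \<sigma> where \<sigma>: "\<And>c. c \<in> set (cover_cnf ts) \<Longrightarrow> \<exists>l\<in>set c. lit_true \<sigma> l"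
    by (auto simp: satisfiable_def)
  \<comment> \<open>The six implications are followed once around the cycle.\<close>
  have eq: "\<sigma> (tag k v) = \<sigma> (tag 0 v)" if "v \<in> end_names ts" "k < 6" for v k
  proof -
    from that(1) obtain t where "t \<in> set (firsts end_marks ts)" "v = snd (ts ! t)"
      unfolding end_names_def names_firsts[symmetric] by blast
    then have mem: "[Neg (tag j v), Pos (tag (Suc j mod 6) v)] \<in> set (cover_cnf ts)" if "j < 6" for j
      using that unfolding cover_cnf_def
      by (intro set_append[THEN equalityD2, THEN subsetD] UnI1)
        (auto simp: implication_cycle_def intro!: bexI[of _ t])
    have imp: "\<sigma> (tag j v) \<longrightarrow> \<sigma> (tag (Suc j mod 6) v)" if "j < 6" for j
      using \<sigma>[OF mem[OF that]] by simp
    have "\<sigma> (tag 0 v) \<longrightarrow> \<sigma> (tag 1 v)" using imp[of 0] by simp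
    moreover have "\<sigma> (tag 1 v) \<longrightarrow> \<sigma> (tag 2 v)" using imp[of 1] by (simp add: numeral_2_eq_2)
    moreover have "\<sigma> (tag 2 v) \<longrightarrow> \<sigma> (tag 3 v)" using imp[of 2] by simp
    moreover have "\<sigma> (tag 3 v) \<longrightarrow> \<sigma> (tag 4 v)" using imp[of 3] by simp
    moreover have "\<sigma> (tag 4 v) \<longrightarrow> \<sigma> (tag 5 v)" using imp[of 4] by simp
    moreover have "\<sigma> (tag 5 v) \<longrightarrow> \<sigma> (tag 0 v)" using imp[of 5] by simp
    ultimately have "\<sigma> (tag 1 v) = \<sigma> (tag 0 v) \<and> \<sigma> (tag 2 v) = \<sigma> (tag 0 v) \<and> \<sigma> (tag 3 v) = \<sigma> (tag 0 v) \<and>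
        \<sigma> (tag 4 v) = \<sigma> (tag 0 v) \<and> \<sigma> (tag 5 v) = \<sigma> (tag 0 v)" by argo
    moreover have "k = 0 \<or> k = 1 \<or> k = 2 \<or> k = 3 \<or> k = 4 \<or> k = 5" using that(2) by linarith
    ultimately show ?thesis by (elim disjE) (simp_all only:)
  qed
  define C where "C = {v \<in> end_names ts. \<sigma> (tag 0 v)}"
  have shape: "graph_shape ts" using assms by (simp add: good_graph_def)
  have copy: "\<sigma> (tag (2 * slot end_marks ts t + b) (snd (ts ! t))) \<longleftrightarrow> snd (ts ! t) \<in> C"
    if "t \<in> occs end_marks ts" "b < 2" for t b
  proof -
    have "slot end_marks ts t < 3" using assms that by (simp add: good_graph_def)
    then have lt: "2 * slot end_marks ts t + b < 6" using that(2) by linarith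
    have v: "snd (ts ! t) \<in> end_names ts" using that by (auto simp: end_names_def)
    show ?thesis using eq[OF v lt] v by (simp add: C_def)
  qed
  have edge: "(snd (ts ! i) \<in> C \<or> snd (ts ! Suc i) \<in> C) \<and>
      (branching ts (snd (ts ! i)) \<or> branching ts (snd (ts ! Suc i)) \<longrightarrow>
        \<not> (snd (ts ! i) \<in> C \<and> snd (ts ! Suc i) \<in> C))" if i: "i \<in> occs {GEdge} ts" for i
  proof -
    have o: "i \<in> occs end_marks ts" "Suc i \<in> occs end_marks ts"
      using i unfolding occs_end_marks(1)[OF shape] by auto
    have mem: "c \<in> set (cover_cnf ts)" if "c \<in> set (edge_clauses ts i)" for c
      using that i by (auto simp: cover_cnf_def set_edge_indices)
    let ?c = "\<lambda>b j. tag (2 * slot end_marks ts j + b) (snd (ts ! j))"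
    have "[Pos (?c 0 i), Pos (?c 0 (Suc i))] \<in> set (edge_clauses ts i)"
      by (simp add: edge_clauses_def Let_def)
    from \<sigma>[OF mem[OF this]] have 1: "snd (ts ! i) \<in> C \<or> snd (ts ! Suc i) \<in> C"
      using copy[OF o(1), of 0] copy[OF o(2), of 0] by simp
    have "\<not> (snd (ts ! i) \<in> C \<and> snd (ts ! Suc i) \<in> C)"
      if "branching ts (snd (ts ! i)) \<or> branching ts (snd (ts ! Suc i))"
    proof -
      have "[Neg (?c 1 i), Neg (?c 1 (Suc i))] \<in> set (edge_clauses ts i)"
        using that by (simp add: edge_clauses_def Let_def)
      from \<sigma>[OF mem[OF this]] show ?thesis
        using copy[OF o(1), of 1] copy[OF o(2), of 1] by simp
    qed
    with 1 show ?thesis by blast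
  qed
  have "vertex_cover (end_names ts) (graph_edges ts) C"
    using edge by (auto simp: vertex_cover_def graph_edges_def edge_at_def C_def)
  moreover have "two_checkered (graph_edges ts) C"
    using edge unfolding two_checkered_graph_edges[OF assms] by blast
  ultimately show "\<exists>C. vertex_cover (end_names ts) (graph_edges ts) C \<and> two_checkered (graph_edges ts) C"
    by blast
next
  assume "\<exists>C. vertex_cover (end_names ts) (graph_edges ts) C \<and> two_checkered (graph_edges ts) C"
  then obtain C where C: "vertex_cover (end_names ts) (graph_edges ts) C" "two_checkered (graph_edges ts) C"
    by blast
  define \<sigma> where "\<sigma> = (\<lambda>x. \<exists>k v. x = tag k v \<and> v \<in> C)"
  have \<sigma>: "\<sigma> (tag k v) \<longleftrightarrow> v \<in> C" for k v by (auto simp: \<sigma>_def)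
  have "\<exists>l\<in>set c. lit_true \<sigma> l" if "c \<in> set (implication_cycle v)" for c v
    using that \<sigma> by (auto simp: implication_cycle_def)
  moreover have "\<exists>l\<in>set c. lit_true \<sigma> l" if "i \<in> occs {GEdge} ts" "c \<in> set (edge_clauses ts i)" for c i
  proof -
    have "edge_at ts i \<in> graph_edges ts" using that by (auto simp: graph_edges_def)
    then have "snd (ts ! i) \<in> C \<or> snd (ts ! Suc i) \<in> C"
      using C(1) by (auto simp: vertex_cover_def edge_at_def)
    then show ?thesis
      using that C(2) \<sigma> unfolding two_checkered_graph_edges[OF assms]
      by (auto simp: edge_clauses_def Let_def split: if_splits)
  qed
  ultimately have "\<forall>c\<in>set (cover_cnf ts). \<exists>l\<in>set c. lit_true \<sigma> l"
    by (auto simp: cover_cnf_def set_edge_indices)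
  then show "satisfiable (cover_cnf ts)" unfolding satisfiable_def by blast
qed

lemma TwoSAT3_encodes:
  assumes "encodes_2cnf w \<phi>"
  shows "w \<in> TwoSAT3 \<longleftrightarrow> (\<forall>x. occurrences \<phi> x \<le> 3) \<and> satisfiable \<phi>"
proof -
  have "\<psi> = \<phi>" if "encodes_2cnf w \<psi>" for \<psi>
    using that assms cnf_word_inj unfolding encodes_2cnf_def by metis
  then show ?thesis using assms unfolding TwoSAT3_def by blast
qed

lemma cover_cnf_correct:
  assumes "GG.marked ts"
  shows "GG.word ts \<in> TwoCVC3 \<longleftrightarrow> GF.printed ts e cover_printer \<in> TwoSAT3"
proof (cases "good_graph ts")
  case True
  have "encodes_2cnf (cnf_word (cover_cnf ts)) (cover_cnf ts)"
    by (simp add: encodes_2cnf_def two_cnf_cover_cnf)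
  from TwoSAT3_encodes[OF this] show ?thesis
    using True TwoCVC3_word_iff[OF assms] satisfiable_cover_cnf[OF True] cover_end_names[OF True]
      occurrences_cover_cnf[of ts]
    by (simp add: printed_cover_printer good_graph_def)
next
  case False
  then show ?thesis
    using TwoCVC3_word_iff[OF assms] not_cnf_word(1)[of "[FBit True]"] by (simp add: printed_cover_printer)
qed

text \<open>Six copies for each of at most two vertices per edge give 12; for the number of vertices
  6 would suffice, but one factor serves both bounds.\<close>

lemma cover_cnf_sizes:
  assumes "GG.marked ts"
  shows "m_vbl (GF.printed ts e cover_printer) \<le> 12 * m_edg (GG.word ts) + 1"
    and "m_vbl (GF.printed ts e cover_printer) \<le> 12 * m_ver (GG.word ts) + 1"
proof -
  have "m_vbl (GF.printed ts e cover_printer) \<le> 12 * m_edg (GG.word ts) + 1 \<and>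
      m_vbl (GF.printed ts e cover_printer) \<le> 12 * m_ver (GG.word ts) + 1"
  proof (cases "good_graph ts")
    case True
    have "m_ver (GG.word ts) = card (graph_vertices ts)" "m_edg (GG.word ts) = card (graph_edges ts)"
      using m_ver_eq m_edg_eq good_graph_encodes[OF assms True] by auto
    moreover have "m_vbl (GF.printed ts e cover_printer) = card (cnf_vars (cover_cnf ts))"
      using True m_vbl_eq[of "cnf_word (cover_cnf ts)" "cover_cnf ts"]
      by (simp add: printed_cover_printer encodes_2cnf_def two_cnf_cover_cnf)
    ultimately show ?thesis
      using card_graph_edges[OF True] card_cnf_vars_cover_cnf[OF True] by linarith
  next
    case False
    then show ?thesis using not_cnf_word[of "[FBit True]"] by (simp add: printed_cover_printer)
  qed
  then show "m_vbl (GF.printed ts e cover_printer) \<le> 12 * m_edg (GG.word ts) + 1"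
    "m_vbl (GF.printed ts e cover_printer) \<le> 12 * m_ver (GG.word ts) + 1" by auto
qed

lemma TwoCVC3_le_TwoSAT3:
  "(TwoCVC3, m_edg) \<le>\<^sub>s\<^sub>L (TwoSAT3, m_vbl)" "(TwoCVC3, m_ver) \<le>\<^sub>s\<^sub>L (TwoSAT3, m_vbl)"
  by (rule GF.reducible_by_printer[OF scoped_cover_printer, where k = 12 and bad = "[FBit True]"];
      use cover_cnf_correct cover_cnf_sizes not_graph_word not_cnf_word in auto)+

section \<open>Words of formulas\<close>

interpretation FG: coding FBit GBit
  by standard (auto intro: injI)

abbreviation literal_marks :: "fsym set" where
  "literal_marks \<equiv> {FPos, FNeg}"

fun literal_token :: "name literal \<Rightarrow> fsym \<times> name" where
  "literal_token (Pos x) = (FPos, x)"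
| "literal_token (Neg x) = (FNeg, x)"

definition cnf_tokens :: "name cnf \<Rightarrow> (fsym \<times> name) list" where
  "cnf_tokens \<phi> = concat (map (\<lambda>c. (FClause, []) # map literal_token c) \<phi>)"

lemma cnf_tokens_simps [simp]:
  "cnf_tokens [] = []" "cnf_tokens (c # \<phi>) = (FClause, []) # map literal_token c @ cnf_tokens \<phi>"
  by (auto simp: cnf_tokens_def)

lemma literal_token_props [simp]:
  "fst (literal_token l) \<in> literal_marks" "snd (literal_token l) = var_of l"
  "fst (literal_token l) = FPos \<or> fst (literal_token l) = FNeg" "fst (literal_token l) \<noteq> FClause"
  by (cases l; simp)+

lemma word_cnf_tokens: "FG.word (cnf_tokens \<phi>) = cnf_word \<phi>"
proof -
  have "FG.word (map literal_token c) = concat (map literal_word c)" for c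
  proof (induction c)
    case (Cons l c)
    then show ?case by (cases l) auto
  qed simp
  then show ?thesis by (induction \<phi>) (auto simp: cnf_word_def clause_word_def)
qed

lemma marked_cnf_tokens: "FG.marked (cnf_tokens \<phi>)"
proof -
  have "fst (literal_token l) \<notin> range FBit" for l by (cases l) auto
  then show ?thesis by (auto simp: cnf_tokens_def FG.marked_def)
qed

section \<open>Clauses and local syntax of formula words\<close>

definition literal_at :: "(fsym \<times> name) list \<Rightarrow> nat \<Rightarrow> name literal" where
  "literal_at ts i = (if fst (ts ! i) = FPos then Pos (snd (ts ! i)) else Neg (snd (ts ! i)))"

definition binary_at :: "(fsym \<times> name) list \<Rightarrow> nat \<Rightarrow> bool" where
  "binary_at ts i \<longleftrightarrow> Suc (Suc i) < length ts \<and> fst (ts ! Suc (Suc i)) \<in> literal_marks"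

definition clause_indices :: "(fsym \<times> name) list \<Rightarrow> nat list" where
  "clause_indices ts = filter (\<lambda>i. fst (ts ! i) \<in> {FClause}) [0..<length ts]"

definition clause_at :: "(fsym \<times> name) list \<Rightarrow> nat \<Rightarrow> name literal list" where
  "clause_at ts i = literal_at ts (Suc i) # (if binary_at ts i then [literal_at ts (Suc (Suc i))] else [])"

definition clause_list :: "(fsym \<times> name) list \<Rightarrow> name cnf" where
  "clause_list ts = map (clause_at ts) (clause_indices ts)"

lemma set_clause_indices: "set (clause_indices ts) = occs {FClause} ts"
  by (auto simp: clause_indices_def occs_def)

lemma distinct_clause_indices: "distinct (clause_indices ts)"
  by (simp add: clause_indices_def)

lemma clause_list_Cons:
  "clause_list (t # ts) = (if fst t = FClause then [clause_at (t # ts) 0] else []) @ clause_list ts"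
proof -
  have "clause_at (t # ts) (Suc i) = clause_at ts i" for i
    by (simp add: clause_at_def literal_at_def binary_at_def)
  then show ?thesis
    unfolding clause_list_def clause_indices_def list.size(4) add_Suc_right add_0_right filter_upt_Suc
    by (auto simp: o_def)
qed

lemma cnf_tokens_start: "cnf_tokens \<phi> \<noteq> [] \<Longrightarrow> fst (cnf_tokens \<phi> ! 0) = FClause"
  by (cases \<phi>) auto

lemma literal_at_token: "ts ! i = literal_token l \<Longrightarrow> literal_at ts i = l"
  by (cases l) (auto simp: literal_at_def)

lemma clause_list_cnf_tokens: "two_cnf \<phi> \<Longrightarrow> clause_list (cnf_tokens \<phi>) = \<phi>"
proof (induction \<phi>)
  case Nil
  then show ?case by (simp add: clause_list_def clause_indices_def)
next
  case (Cons c \<phi>)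
  then have IH: "clause_list (cnf_tokens \<phi>) = \<phi>" by (simp add: two_cnf_def)
  have "c \<noteq> []" "length c \<le> 2" using Cons.prems by (auto simp: two_cnf_def)
  then consider l where "c = [l]" | l l' where "c = [l, l']"
    by (cases c; cases "tl c") auto
  then show ?case
  proof cases
    case 1
    have "\<not> binary_at (cnf_tokens (c # \<phi>)) 0"
      using cnf_tokens_start[of \<phi>] 1 by (auto simp: binary_at_def)
    then show ?thesis
      using 1 IH by (simp add: clause_list_Cons clause_at_def literal_at_token)
  next
    case 2
    have "binary_at (cnf_tokens (c # \<phi>)) 0" using 2 by (simp add: binary_at_def)
    then show ?thesis
      using 2 IH by (simp add: clause_list_Cons clause_at_def literal_at_token)
  qed
qed

text \<open>The first condition excludes empty clauses; the second one puts every literal at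
  distance one or two from a clause marker and so limits the length of clauses. The name of a clause
  token must be empty because the token format allows bits after any marker.\<close>

definition cnf_shape :: "(fsym \<times> name) list \<Rightarrow> bool" where
  "cnf_shape ts \<longleftrightarrow>
     (\<forall>i<length ts. fst (ts ! i) = FClause \<longrightarrow>
        snd (ts ! i) = [] \<and> Suc i < length ts \<and> fst (ts ! Suc i) \<in> literal_marks) \<and>
     (\<forall>i<length ts. fst (ts ! i) \<in> literal_marks \<longrightarrow> (\<exists>j. i = Suc j \<and>
        (fst (ts ! j) = FClause \<or>
         fst (ts ! j) \<in> literal_marks \<and> (\<exists>k. j = Suc k \<and> fst (ts ! k) = FClause))))"

lemma cnf_shape_D1:
  "cnf_shape ts \<Longrightarrow> i < length ts \<Longrightarrow> fst (ts ! i) = FClause \<Longrightarrow>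
    snd (ts ! i) = [] \<and> Suc i < length ts \<and> fst (ts ! Suc i) \<in> literal_marks"
  unfolding cnf_shape_def by blast

lemma cnf_shape_D2:
  "cnf_shape ts \<Longrightarrow> i < length ts \<Longrightarrow> fst (ts ! i) \<in> literal_marks \<Longrightarrow>
    \<exists>j. i = Suc j \<and> (fst (ts ! j) = FClause \<or>
      fst (ts ! j) \<in> literal_marks \<and> (\<exists>k. j = Suc k \<and> fst (ts ! k) = FClause))"
  unfolding cnf_shape_def by blast

lemma cnf_shape_cnf_tokens: "two_cnf \<phi> \<Longrightarrow> cnf_shape (cnf_tokens \<phi>)"
proof (induction \<phi>)
  case Nil
  then show ?case by (simp add: cnf_shape_def)
next
  case (Cons c \<phi>)
  let ?ts = "cnf_tokens \<phi>"
  have IH: "cnf_shape ?ts" using Cons by (simp add: two_cnf_def)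
  have "c \<noteq> []" "length c \<le> 2" using Cons.prems by (auto simp: two_cnf_def)
  then obtain l ls where c: "c = l # ls" "ls = [] \<or> (\<exists>l'. ls = [l'])"
    by (cases c; cases "tl c") auto
  define us where "us = (FClause, []) # map literal_token c"
  have us: "length us = Suc (length c)" "us ! 0 = (FClause, [])"
    "\<And>i. i < length c \<Longrightarrow> us ! Suc i = literal_token (c ! i)" by (auto simp: us_def)
  have eq: "cnf_tokens (c # \<phi>) = us @ ?ts" by (simp add: us_def)
  show ?case unfolding eq cnf_shape_def
  proof (intro conjI allI impI)
    fix i assume i: "i < length (us @ ?ts)" "fst ((us @ ?ts) ! i) = FClause"
    have "snd ((us @ ?ts) ! i) = [] \<and> Suc i < length (us @ ?ts) \<and> fst ((us @ ?ts) ! Suc i) \<in> literal_marks"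
    proof (cases "i < length us")
      case True
      then have "i = 0" using i(2) us by (cases i) (auto simp: nth_append)
      then show ?thesis using us(2) us(3)[of 0] c by (auto simp: nth_append us(1))
    next
      case False
      then obtain k where k: "i = length us + k" by (metis le_add_diff_inverse not_less)
      then show ?thesis using cnf_shape_D1[OF IH, of k] i by (simp add: nth_append)
    qed
    then show "snd ((us @ ?ts) ! i) = []" "Suc i < length (us @ ?ts)"
      "fst ((us @ ?ts) ! Suc i) \<in> literal_marks" by auto
  next
    fix i assume i: "i < length (us @ ?ts)" "fst ((us @ ?ts) ! i) \<in> literal_marks"
    show "\<exists>j. i = Suc j \<and> (fst ((us @ ?ts) ! j) = FClause \<or>
        fst ((us @ ?ts) ! j) \<in> literal_marks \<and> (\<exists>k. j = Suc k \<and> fst ((us @ ?ts) ! k) = FClause))"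
    proof (cases "i < length us")
      case True
      then consider "i = 0" | "i = 1" | "i = 2" "length c = 2" using c us(1) by fastforce
      then show ?thesis
      proof cases
        case 3
        then show ?thesis using us(2) us(3)[of 0] us(1) by (auto simp: nth_append numeral_2_eq_2)
      qed (use i us in \<open>auto simp: nth_append\<close>)
    next
      case False
      then obtain i' where i': "i = length us + i'" by (metis le_add_diff_inverse not_less)
      have nth: "(us @ ?ts) ! (length us + k) = ?ts ! k" for k by simp
      from cnf_shape_D2[OF IH, of i'] obtain j where j: "i' = Suc j" "fst (?ts ! j) = FClause \<or>
          fst (?ts ! j) \<in> literal_marks \<and> (\<exists>k. j = Suc k \<and> fst (?ts ! k) = FClause)"
        using i unfolding i' nth by auto
      show ?thesis
      proof (intro exI[of _ "length us + j"] conjI)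
        show "i = Suc (length us + j)" using i' j(1) by simp
        show "fst ((us @ ?ts) ! (length us + j)) = FClause \<or>
          fst ((us @ ?ts) ! (length us + j)) \<in> literal_marks \<and>
          (\<exists>k. length us + j = Suc k \<and> fst ((us @ ?ts) ! k) = FClause)"
          using j(2) unfolding nth by (metis add_Suc_right nth)
      qed
    qed
  qed
qed

text \<open>If the remainder began with a literal, its clause marker would be cut off. Otherwise the
  markers required for its literals lie within the remainder.\<close>

lemma cnf_shape_append:
  assumes "cnf_shape (us @ ws)" "ws \<noteq> [] \<Longrightarrow> fst (ws ! 0) \<notin> literal_marks"
  shows "cnf_shape ws"
  unfolding cnf_shape_def
proof (intro conjI allI impI)
  have nth: "(us @ ws) ! (length us + k) = ws ! k" for k by simp
  fix i assume i: "i < length ws"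
  {
    assume "fst (ws ! i) = FClause"
    then have "snd (ws ! i) = [] \<and> Suc i < length ws \<and> fst (ws ! Suc i) \<in> literal_marks"
      using cnf_shape_D1[OF assms(1), of "length us + i"] i nth[of "Suc i"] by simp
    then show "snd (ws ! i) = []" "Suc i < length ws" "fst (ws ! Suc i) \<in> literal_marks" by auto
  }
  assume lit: "fst (ws ! i) \<in> literal_marks"
  then obtain i' where i': "i = Suc i'" using assms(2) i by (cases i) auto
  obtain j where j: "length us + i = Suc j" "fst ((us @ ws) ! j) = FClause \<or>
      fst ((us @ ws) ! j) \<in> literal_marks \<and> (\<exists>k. j = Suc k \<and> fst ((us @ ws) ! k) = FClause)"
    using cnf_shape_D2[OF assms(1), of "length us + i"] lit i by auto
  have j': "j = length us + i'" using i' j(1) by simp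
  have "fst (ws ! i') = FClause \<or> fst (ws ! i') \<in> literal_marks \<and> (\<exists>k. i' = Suc k \<and> fst (ws ! k) = FClause)"
  proof (cases i')
    case 0
    \<comment> \<open>The preceding token is the first one of \<open>ws\<close> and no literal, so
      it can only be a clause marker.\<close>
    then have "fst (ws ! i') \<notin> literal_marks" using assms(2) i by fastforce
    then show ?thesis using j(2) unfolding j' nth by simp
  next
    case (Suc k)
    then have "k' = length us + k" if "j = Suc k'" for k' using j' that by simp
    then show ?thesis using j(2) Suc unfolding j' nth by (metis j' nth)
  qed
  then show "\<exists>j. i = Suc j \<and> (fst (ws ! j) = FClause \<or>
      fst (ws ! j) \<in> literal_marks \<and> (\<exists>k. j = Suc k \<and> fst (ws ! k) = FClause))"
    using i' by blast
qed

lemma literal_token_surj: "fst t \<in> literal_marks \<Longrightarrow> \<exists>l. t = literal_token l"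
  by (cases t) (auto intro: exI[of _ "Pos (snd t)"] exI[of _ "Neg (snd t)"])

text \<open>The first clause is removed, with one literal or with two. A third literal in a row
  would be three tokens away from the marker, so the remainder always satisfies the condition of
  \<open>cnf_shape_append\<close>.\<close>

lemma cnf_shape_eq:
  assumes "FG.marked ts" "cnf_shape ts"
  shows "\<exists>\<phi>. two_cnf \<phi> \<and> ts = cnf_tokens \<phi>"
  using assms
proof (induction "length ts" arbitrary: ts rule: less_induct)
  case less
  show ?case
  proof (cases ts)
    case Nil
    then show ?thesis by (intro exI[of _ "[]"]) (simp add: two_cnf_def)
  next
    case (Cons t us)
    have "fst t \<notin> literal_marks" using cnf_shape_D2[OF less.prems(2), of 0] Cons by auto
    moreover have "fst t \<notin> range FBit" using less.prems(1) Cons by (auto simp: FG.marked_def)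
    ultimately have t: "fst t = FClause" by (cases "fst t") auto
    then have u: "snd t = []" "us \<noteq> []" "fst (us ! 0) \<in> literal_marks"
      using cnf_shape_D1[OF less.prems(2), of 0] Cons by auto
    then obtain l ws where us: "us = literal_token l # ws"
      using literal_token_surj by (cases us) auto
    have t_eq: "t = (FClause, [])" using t u(1) by (cases t) simp
    show ?thesis
    proof (cases "ws \<noteq> [] \<and> fst (ws ! 0) \<in> literal_marks")
      case False
      have "cnf_shape ws"
        using cnf_shape_append[of "[t, literal_token l]" ws] less.prems(2) Cons us False by auto
      moreover have "FG.marked ws" using less.prems(1) Cons us by (simp add: FG.marked_def)
      ultimately obtain \<phi> where "two_cnf \<phi>" "ws = cnf_tokens \<phi>"
        using less.hyps[of ws] Cons us by auto
      then have "two_cnf ([l] # \<phi>) \<and> ts = cnf_tokens ([l] # \<phi>)"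
        using Cons us t_eq by (simp add: two_cnf_def)
      then show ?thesis by blast
    next
      case True
      then obtain l' vs where ws: "ws = literal_token l' # vs"
        using literal_token_surj by (cases ws) auto
      have "fst (vs ! 0) \<notin> literal_marks" if "vs \<noteq> []"
      proof
        assume "fst (vs ! 0) \<in> literal_marks"
        then have "fst (ts ! 3) \<in> literal_marks" "3 < length ts"
          using Cons us ws that by (auto simp: numeral_3_eq_3)
        from cnf_shape_D2[OF less.prems(2) this(2,1)]
        have "fst (ts ! 2) = FClause \<or> fst (ts ! 1) = FClause"
          by (auto simp: numeral_3_eq_3 numeral_2_eq_2)
        then show False using Cons us ws by (simp add: numeral_2_eq_2)
      qed
      then have "cnf_shape vs"
        using cnf_shape_append[of "[t, literal_token l, literal_token l']" vs] less.prems(2) Cons us ws by auto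
      moreover have "FG.marked vs" using less.prems(1) Cons us ws by (simp add: FG.marked_def)
      ultimately obtain \<phi> where "two_cnf \<phi>" "vs = cnf_tokens \<phi>"
        using less.hyps[of vs] Cons us ws by auto
      then have "two_cnf ([l, l'] # \<phi>) \<and> ts = cnf_tokens ([l, l'] # \<phi>)"
        using Cons us ws t_eq by (simp add: two_cnf_def)
      then show ?thesis by blast
    qed
  qed
qed

lemma cnf_shape_clause_list:
  assumes "FG.marked ts" "cnf_shape ts"
  shows "two_cnf (clause_list ts)" "ts = cnf_tokens (clause_list ts)"
proof -
  obtain \<phi> where \<phi>: "two_cnf \<phi>" "ts = cnf_tokens \<phi>" using cnf_shape_eq[OF assms] by blast
  then have "clause_list ts = \<phi>" using clause_list_cnf_tokens by simp
  then show "two_cnf (clause_list ts)" "ts = cnf_tokens (clause_list ts)" using \<phi> by auto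
qed

lemma encodes_2cnf_word:
  assumes "FG.marked ts"
  shows "encodes_2cnf (FG.word ts) \<phi> \<longleftrightarrow> cnf_shape ts \<and> \<phi> = clause_list ts"
proof
  assume "encodes_2cnf (FG.word ts) \<phi>"
  then have *: "two_cnf \<phi>" "FG.word ts = FG.word (cnf_tokens \<phi>)"
    by (auto simp: encodes_2cnf_def word_cnf_tokens)
  then have "ts = cnf_tokens \<phi>" using FG.word_inj[OF _ assms marked_cnf_tokens] by blast
  then show "cnf_shape ts \<and> \<phi> = clause_list ts"
    using *(1) clause_list_cnf_tokens cnf_shape_cnf_tokens by simp
next
  assume "cnf_shape ts \<and> \<phi> = clause_list ts"
  then show "encodes_2cnf (FG.word ts) \<phi>"
    unfolding encodes_2cnf_def using cnf_shape_clause_list[OF assms] word_cnf_tokens by metis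
qed

lemma card_occs_filter:
  "card {t \<in> occs A ts. snd (ts ! t) = x} = length (filter (\<lambda>t. fst t \<in> A \<and> snd t = x) ts)"
  by (simp add: length_filter_conv_card occs_def conj_assoc)

lemma occurrences_clause_list:
  assumes "FG.marked ts" "cnf_shape ts"
  shows "occurrences (clause_list ts) x = card {t \<in> occs literal_marks ts. snd (ts ! t) = x}"
proof -
  have "length (filter (\<lambda>t. fst t \<in> literal_marks \<and> snd t = x) (map literal_token c)) =
      length (filter (\<lambda>l. var_of l = x) c)" for c
    by (induction c) auto
  then have "occurrences \<phi> x = length (filter (\<lambda>t. fst t \<in> literal_marks \<and> snd t = x) (cnf_tokens \<phi>))" for \<phi>
    by (induction \<phi>) (auto simp: occurrences_def)
  then show ?thesis using cnf_shape_clause_list(2)[OF assms] card_occs_filter by metis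
qed

lemma cnf_vars_clause_list:
  assumes "FG.marked ts" "cnf_shape ts"
  shows "cnf_vars (clause_list ts) = (\<lambda>t. snd (ts ! t)) ` occs literal_marks ts"
proof -
  have "filter (\<lambda>t. fst t \<in> literal_marks) (map literal_token c) = map literal_token c" for c
    by (rule filter_True) auto
  then have "map snd (filter (\<lambda>t. fst t \<in> literal_marks) (cnf_tokens \<phi>)) = map var_of (concat \<phi>)" for \<phi>
    by (induction \<phi>) (auto simp del: insert_iff simp add: singleton_iff)
  then have "cnf_vars (clause_list ts) = set (map snd (filter (\<lambda>t. fst t \<in> literal_marks) ts))"
    using cnf_shape_clause_list(2)[OF assms] unfolding cnf_vars_def by (metis set_map)
  also have "\<dots> = (\<lambda>t. snd (ts ! t)) ` occs literal_marks ts"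
  proof -
    have "set (filter (\<lambda>t. fst t \<in> literal_marks) ts) = (!) ts ` occs literal_marks ts"
      by (fastforce simp: occs_def in_set_conv_nth image_iff)
    then show ?thesis by (simp add: image_image)
  qed
  finally show ?thesis .
qed

definition good_cnf :: "(fsym \<times> name) list \<Rightarrow> bool" where
  "good_cnf ts \<longleftrightarrow> cnf_shape ts \<and> (\<forall>t\<in>occs literal_marks ts. slot literal_marks ts t < 3)"

lemma TwoSAT3_word_iff:
  assumes "FG.marked ts"
  shows "FG.word ts \<in> TwoSAT3 \<longleftrightarrow> good_cnf ts \<and> satisfiable (clause_list ts)"
proof -
  have "(\<forall>x. occurrences (clause_list ts) x \<le> 3) \<longleftrightarrow> (\<forall>t\<in>occs literal_marks ts. slot literal_marks ts t < 3)"
    if "cnf_shape ts"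
    unfolding occurrences_clause_list[OF assms that] card_occs_le_iff by blast
  note bound = this
  show ?thesis
  proof (cases "cnf_shape ts")
    case True
    then have "encodes_2cnf (FG.word ts) (clause_list ts)" by (simp add: encodes_2cnf_word[OF assms])
    from TwoSAT3_encodes[OF this] show ?thesis using bound[OF True] True by (simp add: good_cnf_def)
  next
    case False
    then show ?thesis by (simp add: TwoSAT3_def encodes_2cnf_word[OF assms] good_cnf_def)
  qed
qed

definition good_cnf_fm :: "fsym fm" where
  "good_cnf_fm = conjunction
    [Al 0 (Imp (Mark {FClause} 0) (An (Bare 0) (Exi 1 (An (adjacent 0 1 2) (Mark literal_marks 1))))),
     Al 0 (Imp (Mark literal_marks 0) (Exi 1 (An (adjacent 1 0 2) (Or (Mark {FClause} 1)
       (An (Mark literal_marks 1) (Exi 2 (An (adjacent 2 1 3) (Mark {FClause} 2)))))))),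
     Al 0 (Imp (Mark literal_marks 0) (Nt (slot_ge literal_marks 3 0 1)))]"

lemma scoped_good_cnf_fm: "scoped {} good_cnf_fm"
  unfolding good_cnf_fm_def by (subst scoped_conjunction) (auto intro!: scoped_slot_ge simp del: slot_ge.simps)

lemma sat_good_cnf_fm: "sat ts e good_cnf_fm \<longleftrightarrow> good_cnf ts"
proof -
  have 1: "sat ts e (Al 0 (Imp (Mark {FClause} 0)
      (An (Bare 0) (Exi 1 (An (adjacent 0 1 2) (Mark literal_marks 1)))))) \<longleftrightarrow>
     (\<forall>i<length ts. fst (ts ! i) = FClause \<longrightarrow>
        snd (ts ! i) = [] \<and> Suc i < length ts \<and> fst (ts ! Suc i) \<in> literal_marks)"
    by (simp cong: conj_cong) blast
  have 2: "sat ts e (Al 0 (Imp (Mark literal_marks 0) (Exi 1 (An (adjacent 1 0 2) (Or (Mark {FClause} 1)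
       (An (Mark literal_marks 1) (Exi 2 (An (adjacent 2 1 3) (Mark {FClause} 2))))))))) \<longleftrightarrow>
     (\<forall>i<length ts. fst (ts ! i) \<in> literal_marks \<longrightarrow> (\<exists>j. i = Suc j \<and>
        (fst (ts ! j) = FClause \<or>
         fst (ts ! j) \<in> literal_marks \<and> (\<exists>k. j = Suc k \<and> fst (ts ! k) = FClause))))"
  proof -
    have "sat ts (e(0 := i, 1 := j)) (Exi 2 (An (adjacent 2 1 3) (Mark {FClause} 2))) \<longleftrightarrow>
        (\<exists>k. j = Suc k \<and> fst (ts ! k) = FClause)" if "j < length ts" for i j
      using that by (auto cong: conj_cong)
    moreover define \<psi> where "\<psi> = (Exi 2 (An (adjacent 2 1 3) (Mark {FClause} 2)) :: fsym fm)"
    ultimately have "sat ts (e(0 := i, 1 := j)) \<psi> \<longleftrightarrow> (\<exists>k. j = Suc k \<and> fst (ts ! k) = FClause)"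
      if "j < length ts" for i j using that by simp
    then show ?thesis unfolding \<psi>_def[symmetric]
      by (simp cong: conj_cong add: singleton_iff del: One_nat_def insert_iff) (meson Suc_lessD)
  qed
  have 3: "sat ts e (Al 0 (Imp (Mark literal_marks 0) (Nt (slot_ge literal_marks 3 0 1)))) \<longleftrightarrow>
      (\<forall>t\<in>occs literal_marks ts. slot literal_marks ts t < 3)"
    by (auto simp: occs_def sat_slot_ge not_le simp del: slot_ge.simps)
  show ?thesis
    unfolding good_cnf_fm_def sat_conjunction list.set ball_simps 1 2 3 good_cnf_def cnf_shape_def
    by blast
qed

section \<open>From satisfiability to covers\<close>

text \<open>Every variable is represented by a ring of twelve vertices of degree 3, each of which has a
  leaf attached to it.  No edge of this gadget is a grip, so a 2-checkered vertex cover alternates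
  along the ring, and the leaves 12 + k with even k show the value of the variable while those with
  odd k show its negation.\<close>

definition gadget :: "(nat \<times> nat) list" where
  "gadget = map (\<lambda>k. (k, Suc k mod 12)) [0..<12] @ map (\<lambda>k. (k, 12 + k)) [0..<12]"

text \<open>The indicator function of the alternating vertex set of a gadget in which the leaves
  with even number have value b and the ring vertices they hang on the opposite value.\<close>

definition cover_value :: "bool \<Rightarrow> nat \<Rightarrow> bool" where
  "cover_value b k \<longleftrightarrow> (if k < 12 then even k \<noteq> b else even k = b)"

lemma gadget_code:
  "gadget = [(0, 1), (1, 2), (2, 3), (3, 4), (4, 5), (5, 6), (6, 7), (7, 8), (8, 9), (9, 10), (10, 11), (11, 0),
     (0, 12), (1, 13), (2, 14), (3, 15), (4, 16), (5, 17), (6, 18), (7, 19), (8, 20), (9, 21), (10, 22), (11, 23)]"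
  by code_simp

lemma distinct_gadget: "distinct (map (\<lambda>(a, b). {a, b}) gadget)"
  unfolding gadget_code by code_simp

lemma gadget_range: "(a, b) \<in> set gadget \<Longrightarrow> a < 12 \<and> b < 24 \<and> a \<noteq> b"
  by (auto simp: gadget_code)

lemma gadget_degree:
  assumes "k < 24"
  shows "length (filter (\<lambda>(a, b). a = k \<or> b = k) gadget) = (if k < 12 then 3 else 1)"
proof -
  have "\<forall>k\<in>set [0..<24]. length (filter (\<lambda>(a, b). a = k \<or> b = k) gadget) = (if k < 12 then 3 else 1)"
    unfolding gadget_code by code_simp
  then show ?thesis using assms by simp
qed

lemma gadget_value: "(a, b) \<in> set gadget \<Longrightarrow> cover_value s a \<noteq> cover_value s b"
  by (auto simp: gadget_code cover_value_def)

text \<open>Along the ring all values follow from the value at 0, and each leaf has the opposite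
  value of its ring vertex. Leaf 12 hangs on vertex 0, so its value determines everything.\<close>

lemma gadget_alternates:
  assumes "\<And>a b. (a, b) \<in> set gadget \<Longrightarrow> f a \<noteq> f b" "k < 24"
  shows "f k \<longleftrightarrow> cover_value (f 12) k"
proof -
  have ring: "f j \<longleftrightarrow> (even j \<longleftrightarrow> f 0)" if "j < 12" for j
    using that
  proof (induction j)
    case (Suc j)
    have "(j, Suc j mod 12) \<in> set gadget" using Suc.prems by (auto simp: gadget_def)
    then have "f j \<noteq> f (Suc j)" using assms(1) Suc.prems by fastforce
    then show ?case using Suc by auto
  qed simp
  have leaf: "f j \<noteq> f (12 + j)" if "j < 12" for j
    using assms(1)[of j "12 + j"] that by (auto simp: gadget_def)
  show ?thesis
  proof (cases "k < 12")
    case True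
    then show ?thesis using ring[of k] leaf[of 0] by (auto simp: cover_value_def)
  next
    case False
    then obtain j where "k = 12 + j" "j < 12" using assms(2) by (metis le_Suc_ex not_less
        nat_add_left_cancel_less numeral_Bit0 numeral_plus_numeral semiring_norm(5) add_numeral_left)
    then show ?thesis using ring[of j] leaf[of j] leaf[of 0] by (auto simp: cover_value_def)
  qed
qed

lemma distinct_concat_map:
  assumes "distinct xs" "\<And>x. x \<in> set xs \<Longrightarrow> distinct (F x)"
    and "\<And>x y. x \<in> set xs \<Longrightarrow> y \<in> set xs \<Longrightarrow> x \<noteq> y \<Longrightarrow> set (F x) \<inter> set (F y) = {}"
  shows "distinct (concat (map F xs))"
  using assms
proof (induction xs)
  case (Cons x xs)
  have "set (F x) \<inter> set (concat (map F xs)) = {}"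
  proof -
    have "set (F x) \<inter> set (F y) = {}" if "y \<in> set xs" for y
      using Cons.prems(1) Cons.prems(3)[of x y] that by auto
    then show ?thesis by auto
  qed
  then show ?case using Cons by simp
qed simp

definition variables :: "(fsym \<times> name) list \<Rightarrow> name set" where
  "variables ts = (\<lambda>t. snd (ts ! t)) ` occs literal_marks ts"

text \<open>The occurrence of a variable in slot s owns the leaves 4 s to 4 s + 3 of its gadget, two for
  each polarity; the second one is used only by unit clauses.\<close>

definition leaf_number :: "(fsym \<times> name) list \<Rightarrow> nat \<Rightarrow> nat \<Rightarrow> nat" where
  "leaf_number ts b j = 12 + 4 * slot literal_marks ts j + (if fst (ts ! j) \<in> {FPos} then 0 else 1) + 2 * b"

definition leaf :: "(fsym \<times> name) list \<Rightarrow> nat \<Rightarrow> nat \<Rightarrow> name" where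
  "leaf ts b j = tag (leaf_number ts b j) (snd (ts ! j))"

text \<open>A unit clause joins two different leaves that show the same literal, as a loop is not
  allowed; covering this edge forces the literal to be true.\<close>

definition clause_edge :: "(fsym \<times> name) list \<Rightarrow> nat \<Rightarrow> name \<times> name" where
  "clause_edge ts i = (leaf ts 0 (Suc i),
     if binary_at ts i then leaf ts 0 (Suc (Suc i)) else leaf ts 1 (Suc i))"

definition gadget_edges :: "name \<Rightarrow> (name \<times> name) list" where
  "gadget_edges x = map (\<lambda>(a, b). (tag a x, tag b x)) gadget"

definition sat_vertices :: "(fsym \<times> name) list \<Rightarrow> name list" where
  "sat_vertices ts = concat (map (\<lambda>t. map (\<lambda>k. tag k (snd (ts ! t))) [0..<24]) (firsts literal_marks ts))"

definition sat_edges :: "(fsym \<times> name) list \<Rightarrow> (name \<times> name) list" where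
  "sat_edges ts = concat (map (\<lambda>t. gadget_edges (snd (ts ! t))) (firsts literal_marks ts)) @
     map (clause_edge ts) (clause_indices ts)"

abbreviation endpoints :: "name \<times> name \<Rightarrow> name set" where
  "endpoints \<equiv> \<lambda>(u, v). {u, v}"

lemma variables_firsts: "variables ts = (\<lambda>t. snd (ts ! t)) ` set (firsts literal_marks ts)"
  by (simp add: variables_def names_firsts)

lemma set_sat_vertices: "set (sat_vertices ts) = {tag k x |k x. x \<in> variables ts \<and> k < 24}"
  by (force simp: sat_vertices_def variables_firsts)

lemma endpoints_sat_edges:
  "endpoints ` set (sat_edges ts) =
    {{tag a x, tag b x} |a b x. x \<in> variables ts \<and> (a, b) \<in> set gadget} \<union>
    (\<lambda>i. endpoints (clause_edge ts i)) ` occs {FClause} ts"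
proof -
  have *: "endpoints ` set (gadget_edges x) = {{tag a x, tag b x} |a b. (a, b) \<in> set gadget}" for x
    by (force simp: gadget_edges_def)
  have "endpoints ` set (concat (map (\<lambda>t. gadget_edges (snd (ts ! t))) (firsts literal_marks ts))) =
     {{tag a x, tag b x} |a b x. x \<in> variables ts \<and> (a, b) \<in> set gadget}"
  proof -
    have eq: "endpoints ` set (concat (map (\<lambda>t. gadget_edges (snd (ts ! t))) (firsts literal_marks ts))) =
        (\<Union>t\<in>set (firsts literal_marks ts). endpoints ` set (gadget_edges (snd (ts ! t))))"
      by (simp add: image_UN)
    show ?thesis unfolding eq * variables_firsts by blast
  qed
  then show ?thesis
    unfolding sat_edges_def set_append image_Un set_map set_clause_indices by (simp add: image_image)
qed

lemma leaf_number_bounds: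
  assumes "slot literal_marks ts j < 3" "b < 2"
  shows "12 \<le> leaf_number ts b j" "leaf_number ts b j < 24"
  using assms by (auto simp: leaf_number_def)

lemma even_leaf_number: "even (leaf_number ts b j) \<longleftrightarrow> fst (ts ! j) = FPos"
  by (simp add: leaf_number_def)

text \<open>After subtraction of 12 the rank is the quotient by 4, and the remainder splits into the
  polarity bit and b.\<close>

lemma leaf_number_inj:
  assumes "leaf_number ts b j = leaf_number ts b' j'" "b < 2" "b' < 2"
  shows "slot literal_marks ts j = slot literal_marks ts j' \<and> b = b'"
proof -
  have *: "s = s' \<and> b = b'" if "4 * s + p + 2 * b = 4 * s' + p' + 2 * b'" "p < 2" "p' < 2" for s s' p p' :: nat
  proof -
    have "p = 0 \<or> p = 1" "p' = 0 \<or> p' = 1" "b = 0 \<or> b = 1" "b' = 0 \<or> b' = 1"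
      using that assms(2,3) by auto
    then show ?thesis using that(1) by (elim disjE) (simp; presburger)+
  qed
  show ?thesis
    by (rule *[of _ "if fst (ts ! j) \<in> {FPos} then 0 else 1" _ "if fst (ts ! j') \<in> {FPos} then 0 else 1"])
      (use assms(1) in \<open>auto simp: leaf_number_def\<close>)
qed

lemma leaf_inj:
  assumes "leaf ts b j = leaf ts b' j'" "b < 2" "b' < 2" "j \<in> occs literal_marks ts" "j' \<in> occs literal_marks ts"
  shows "j = j' \<and> b = b'"
proof -
  have "leaf_number ts b j = leaf_number ts b' j'" "snd (ts ! j) = snd (ts ! j')"
    using assms(1) by (auto simp: leaf_def)
  then show ?thesis using leaf_number_inj[OF _ assms(2,3)] slot_inj[OF assms(4,5)] by blast
qed

lemma clause_literals:
  assumes "cnf_shape ts" "i \<in> occs {FClause} ts"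
  shows "Suc i \<in> occs literal_marks ts" "binary_at ts i \<Longrightarrow> Suc (Suc i) \<in> occs literal_marks ts"
  using cnf_shape_D1[OF assms(1), of i] assms(2) by (auto simp: occs_def binary_at_def)

lemma clause_edge_ends:
  assumes "cnf_shape ts" "i \<in> occs {FClause} ts" "v \<in> endpoints (clause_edge ts i)"
  shows "\<exists>b<2. \<exists>j\<in>occs literal_marks ts. v = leaf ts b j \<and>
    (j = Suc i \<or> j = Suc (Suc i) \<and> binary_at ts i)"
proof -
  have "v = leaf ts 0 (Suc i) \<or> v = leaf ts 1 (Suc i) \<or> binary_at ts i \<and> v = leaf ts 0 (Suc (Suc i))"
    using assms(3) by (auto simp: clause_edge_def split: if_splits)
  moreover have "(0 :: nat) < 2" "(1 :: nat) < 2" by auto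
  ultimately show ?thesis using clause_literals[OF assms(1,2)] by blast
qed

text \<open>A leaf belongs to one occurrence of a variable and an occurrence to one clause, so
  clause edges are pairwise disjoint. This keeps them distinct and puts at most one of them at each
  leaf.\<close>

lemma clause_edges_meet:
  assumes "cnf_shape ts" "i \<in> occs {FClause} ts" "i' \<in> occs {FClause} ts"
    and "v \<in> endpoints (clause_edge ts i)" "v \<in> endpoints (clause_edge ts i')"
  shows "i = i'"
proof -
  obtain b j where 1: "b < 2" "j \<in> occs literal_marks ts" "v = leaf ts b j"
    "j = Suc i \<or> j = Suc (Suc i)" using clause_edge_ends[OF assms(1,2,4)] by blast
  obtain b' j' where 2: "b' < 2" "j' \<in> occs literal_marks ts" "v = leaf ts b' j'"
    "j' = Suc i' \<or> j' = Suc (Suc i')" using clause_edge_ends[OF assms(1,3,5)] by blast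
  have "j = j'" using leaf_inj[of ts b j b' j'] 1 2 by simp
  \<comment> \<open>The token behind a clause marker is a literal, so two markers are never
    adjacent; this excludes that the first literal of one clause is the second of the other.\<close>
  moreover have "i \<noteq> Suc i'" "i' \<noteq> Suc i"
    using clause_literals(1)[OF assms(1,2)] clause_literals(1)[OF assms(1,3)] assms(2,3)
    by (auto simp: occs_def)
  ultimately show ?thesis using 1(4) 2(4) by auto
qed

lemma clause_edge_loopless:
  assumes "cnf_shape ts" "i \<in> occs {FClause} ts"
  shows "fst (clause_edge ts i) \<noteq> snd (clause_edge ts i)"
proof
  assume eq: "fst (clause_edge ts i) = snd (clause_edge ts i)"
  show False
  proof (cases "binary_at ts i")
    case True
    then show False
      using eq leaf_inj[of ts 0 "Suc i" 0 "Suc (Suc i)"] clause_literals[OF assms]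
      by (simp add: clause_edge_def)
  next
    case False
    then show False
      using eq leaf_inj[of ts 0 "Suc i" 1 "Suc i"] clause_literals[OF assms]
      by (simp add: clause_edge_def)
  qed
qed

lemma leaf_vertex:
  assumes "good_cnf ts" "j \<in> occs literal_marks ts" "b < 2"
  shows "\<exists>k x. leaf ts b j = tag k x \<and> x \<in> variables ts \<and> 12 \<le> k \<and> k < 24"
proof -
  have "slot literal_marks ts j < 3" using assms by (simp add: good_cnf_def)
  then show ?thesis
    using leaf_number_bounds[OF _ assms(3)] assms(2) unfolding leaf_def variables_def by blast
qed

lemma clause_edge_vertex:
  assumes "good_cnf ts" "i \<in> occs {FClause} ts" "v \<in> endpoints (clause_edge ts i)"
  shows "\<exists>k x. v = tag k x \<and> x \<in> variables ts \<and> 12 \<le> k \<and> k < 24"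
  using clause_edge_ends[of ts i v] assms leaf_vertex[OF assms(1)] by (auto simp: good_cnf_def)

text \<open>Edges of different gadgets are separated by the variable in their names. Every gadget
  edge has a ring vertex, with a number below 12, whereas clause edges have only leaves.\<close>

lemma sat_graph_encodes:
  assumes "good_cnf ts"
  shows "encodes_graph (graph_word (sat_vertices ts) (sat_edges ts))
    (set (sat_vertices ts)) (endpoints ` set (sat_edges ts))"
proof (rule encodes_graph_graph_word)
  have shape: "cnf_shape ts" using assms by (simp add: good_cnf_def)
  have inj: "snd (ts ! s) \<noteq> snd (ts ! t)"
    if "s \<in> set (firsts literal_marks ts)" "t \<in> set (firsts literal_marks ts)" "s \<noteq> t" for s t
    using inj_onD[OF inj_firsts, of ts s t literal_marks] that by blast
  show "distinct (sat_vertices ts)"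
    unfolding sat_vertices_def
    by (rule distinct_concat_map)
      (use inj in \<open>auto simp: distinct_firsts distinct_map inj_on_def\<close>)
  have 1: "distinct (map endpoints (gadget_edges x))" for x
  proof -
    have "map endpoints (gadget_edges x) = map ((`) (\<lambda>k. tag k x)) (map (\<lambda>(a, b). {a, b}) gadget)"
      by (simp add: gadget_edges_def split_beta)
    moreover have "inj ((`) (\<lambda>k. tag k x))" by (rule injI) (simp add: inj_image_eq_iff inj_def)
    then have "inj_on ((`) (\<lambda>k. tag k x)) A" for A by (rule inj_on_subset) simp
    ultimately show ?thesis using distinct_gadget by (simp add: distinct_map del: map_map)
  qed
  have 2: "distinct (concat (map (\<lambda>t. map endpoints (gadget_edges (snd (ts ! t)))) (firsts literal_marks ts)))"
  proof (rule distinct_concat_map)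
    fix s t assume st: "s \<in> set (firsts literal_marks ts)" "t \<in> set (firsts literal_marks ts)" "s \<noteq> t"
    have *: "\<exists>a. tag a x \<in> e \<and> (\<forall>v\<in>e. \<exists>k. v = tag k x)" if "e \<in> set (map endpoints (gadget_edges x))" for e x
      using that by (auto simp: gadget_edges_def)
    show "set (map endpoints (gadget_edges (snd (ts ! s)))) \<inter> set (map endpoints (gadget_edges (snd (ts ! t)))) = {}"
    proof (rule ccontr)
      assume "\<not> ?thesis"
      then obtain e where "e \<in> set (map endpoints (gadget_edges (snd (ts ! s))))"
        "e \<in> set (map endpoints (gadget_edges (snd (ts ! t))))" by blast
      then obtain a k where "tag a (snd (ts ! s)) = tag k (snd (ts ! t))" using * by meson
      then show False using inj[OF st] by simp
    qed
  qed (use 1 distinct_firsts in auto)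
  have 3: "distinct (map (\<lambda>i. endpoints (clause_edge ts i)) (clause_indices ts))"
    unfolding distinct_map
  proof (intro conjI distinct_clause_indices inj_onI)
    fix i j assume ij: "i \<in> set (clause_indices ts)" "j \<in> set (clause_indices ts)"
      "endpoints (clause_edge ts i) = endpoints (clause_edge ts j)"
    have "fst (clause_edge ts i) \<in> endpoints (clause_edge ts i)" by (simp add: split_beta)
    then show "i = j" using clause_edges_meet[OF shape] ij unfolding set_clause_indices by metis
  qed
  have 4: "\<exists>a x. tag a x \<in> e \<and> a < 12"
    if "e \<in> set (concat (map (\<lambda>t. map endpoints (gadget_edges (snd (ts ! t)))) (firsts literal_marks ts)))" for e
    using that gadget_range by (auto simp: gadget_edges_def)
  have 5: "12 \<le> a" if "i \<in> occs {FClause} ts" "tag a x \<in> endpoints (clause_edge ts i)" for i a x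
    using clause_edge_vertex[OF assms that] by auto
  have "set (concat (map (\<lambda>t. map endpoints (gadget_edges (snd (ts ! t)))) (firsts literal_marks ts))) \<inter>
      set (map (\<lambda>i. endpoints (clause_edge ts i)) (clause_indices ts)) = {}"
  proof (rule ccontr)
    assume "\<not> ?thesis"
    then obtain e i where e: "e \<in> set (concat (map (\<lambda>t. map endpoints (gadget_edges (snd (ts ! t)))) (firsts literal_marks ts)))"
      "i \<in> occs {FClause} ts" "e = endpoints (clause_edge ts i)"
      unfolding set_map[of _ "clause_indices ts"] set_clause_indices by blast
    obtain a x where "tag a x \<in> e" "a < 12" using 4[OF e(1)] by blast
    then show False using 5[OF e(2), of a x] unfolding e(3) by simp
  qed
  then show "distinct (map endpoints (sat_edges ts))"
    using 2 3 by (simp add: sat_edges_def map_concat o_def)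
  fix u v assume uv: "(u, v) \<in> set (sat_edges ts)"
  show "u \<noteq> v \<and> u \<in> set (sat_vertices ts) \<and> v \<in> set (sat_vertices ts)"
  proof (cases "\<exists>t\<in>set (firsts literal_marks ts). (u, v) \<in> set (gadget_edges (snd (ts ! t)))")
    case True
    then obtain x a b where "x \<in> variables ts" "(a, b) \<in> set gadget" "u = tag a x" "v = tag b x"
      by (auto simp: gadget_edges_def variables_firsts)
    then show ?thesis using gadget_range[of a b] unfolding set_sat_vertices by auto
  next
    case False
    then obtain i where i: "i \<in> occs {FClause} ts" "(u, v) = clause_edge ts i"
      using uv by (auto simp: sat_edges_def set_clause_indices)
    have uv_ends: "u \<in> endpoints (clause_edge ts i)" "v \<in> endpoints (clause_edge ts i)"
      by (auto simp flip: i(2))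
    have "w \<in> set (sat_vertices ts)" if w: "w \<in> endpoints (clause_edge ts i)" for w
      using clause_edge_vertex[OF assms i(1) w] unfolding set_sat_vertices by auto
    from this[OF uv_ends(1)] this[OF uv_ends(2)]
    have "u \<in> set (sat_vertices ts)" "v \<in> set (sat_vertices ts)" by simp_all
    then show ?thesis using clause_edge_loopless[OF shape i(1)] by (simp flip: i(2))
  qed
qed

text \<open>Ring vertices meet gadget edges only. A leaf meets the edge to its ring vertex and at
  most one clause edge.\<close>

lemma degree_sat_graph:
  assumes "good_cnf ts" "x \<in> variables ts" "k < 24"
  shows "k < 12 \<Longrightarrow> degree (endpoints ` set (sat_edges ts)) (tag k x) = 3"
    and "12 \<le> k \<Longrightarrow> degree (endpoints ` set (sat_edges ts)) (tag k x) \<le> 2"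
proof -
  have shape: "cnf_shape ts" using assms by (simp add: good_cnf_def)
  let ?E = "endpoints ` set (sat_edges ts)"
  define P where "P = {(a, b) \<in> set gadget. a = k \<or> b = k}"
  define I where "I = {i \<in> occs {FClause} ts. tag k x \<in> endpoints (clause_edge ts i)}"
  have E: "{e \<in> ?E. tag k x \<in> e} = (\<lambda>(a, b). {tag a x, tag b x}) ` P \<union> (\<lambda>i. endpoints (clause_edge ts i)) ` I"
  proof (intro equalityI subsetI)
    fix e assume "e \<in> {e \<in> ?E. tag k x \<in> e}"
    then have e: "e \<in> ?E" "tag k x \<in> e" by auto
    then consider a b y where "e = {tag a y, tag b y}" "(a, b) \<in> set gadget"
      | i where "e = endpoints (clause_edge ts i)" "i \<in> occs {FClause} ts"
      unfolding endpoints_sat_edges by blast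
    then show "e \<in> (\<lambda>(a, b). {tag a x, tag b x}) ` P \<union> (\<lambda>i. endpoints (clause_edge ts i)) ` I"
    proof cases
      case 1
      then have "y = x" "(a, b) \<in> P" using e(2) by (auto simp: P_def)
      then show ?thesis using 1(1) by (auto intro: image_eqI[of _ _ "(a, b)"])
    next
      case 2
      then show ?thesis using e(2) by (auto simp: I_def)
    qed
  next
    fix e assume "e \<in> (\<lambda>(a, b). {tag a x, tag b x}) ` P \<union> (\<lambda>i. endpoints (clause_edge ts i)) ` I"
    then consider a b where "e = {tag a x, tag b x}" "(a, b) \<in> P"
      | i where "e = endpoints (clause_edge ts i)" "i \<in> I" by (elim UnE imageE) auto
    then show "e \<in> {e \<in> ?E. tag k x \<in> e}"
    proof cases
      case 1
      then have "(a, b) \<in> set gadget" "tag k x \<in> e" by (auto simp: P_def)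
      then show ?thesis using 1(1) assms(2) unfolding endpoints_sat_edges by blast
    next
      case 2
      then have "i \<in> occs {FClause} ts" "tag k x \<in> e" by (auto simp: I_def)
      then show ?thesis using 2(1) unfolding endpoints_sat_edges by blast
    qed
  qed
  have P: "card P = (if k < 12 then 3 else 1)" "finite P"
  proof -
    have "distinct gadget" using distinct_gadget by (simp add: distinct_map)
    moreover have "P = set (filter (\<lambda>(a, b). a = k \<or> b = k) gadget)" by (auto simp: P_def)
    ultimately show "card P = (if k < 12 then 3 else 1)" "finite P"
      using gadget_degree[OF assms(3)] distinct_card[of "filter (\<lambda>(a, b). a = k \<or> b = k) gadget"] by auto
  qed
  have "inj_on (\<lambda>(a, b). {tag a x, tag b x}) P"
  proof -
    have "inj_on (\<lambda>(a, b). {a, b}) (set gadget)" using distinct_gadget by (simp add: distinct_map)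
    then have "inj_on (\<lambda>(a, b). {a, b}) P" by (rule inj_on_subset) (auto simp: P_def)
    moreover have "inj ((`) (\<lambda>k. tag k x))" by (rule injI) (simp add: inj_image_eq_iff inj_def)
    ultimately have "inj_on ((`) (\<lambda>k. tag k x) \<circ> (\<lambda>(a, b). {a, b})) P"
      by (intro comp_inj_on) (auto intro: inj_on_subset)
    moreover have "(`) (\<lambda>k. tag k x) \<circ> (\<lambda>(a, b). {a, b}) = (\<lambda>(a, b). {tag a x, tag b x})"
      by (auto simp: fun_eq_iff)
    ultimately show ?thesis by simp
  qed
  then have cP: "card ((\<lambda>(a, b). {tag a x, tag b x}) ` P) = (if k < 12 then 3 else 1)"
    using P by (simp add: card_image)
  {
    assume "k < 12"
    then have "I = {}" using clause_edge_vertex[OF assms(1)] by (fastforce simp: I_def)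
    then show "degree ?E (tag k x) = 3" using cP \<open>k < 12\<close> by (simp add: degree_def E)
  next
    assume "12 \<le> k"
    have "card I \<le> 1"
    proof (rule card_le_1)
      fix i j assume "i \<in> I" "j \<in> I"
      then show "i = j" unfolding I_def by (intro clause_edges_meet[OF shape, of i j "tag k x"]) simp_all
    qed
    moreover have "finite I" by (simp add: I_def finite_occs)
    ultimately have "card ((\<lambda>i. endpoints (clause_edge ts i)) ` I) \<le> 1"
      using card_image_le le_trans by blast
    then show "degree ?E (tag k x) \<le> 2"
      using cP \<open>12 \<le> k\<close> card_Un_le[of "(\<lambda>(a, b). {tag a x, tag b x}) ` P" "(\<lambda>i. endpoints (clause_edge ts i)) ` I"]
      unfolding degree_def E by simp
  }
qed

lemma satisfiable_clause_list:
  "satisfiable (clause_list ts) \<longleftrightarrow> (\<exists>\<sigma>. \<forall>i\<in>occs {FClause} ts. lit_true \<sigma> (literal_at ts (Suc i)) \<or>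
     binary_at ts i \<and> lit_true \<sigma> (literal_at ts (Suc (Suc i))))"
  by (simp add: satisfiable_def clause_list_def set_clause_indices clause_at_def)

lemma lit_true_literal_at:
  "lit_true \<sigma> (literal_at ts j) \<longleftrightarrow> (fst (ts ! j) = FPos \<longleftrightarrow> \<sigma> (snd (ts ! j)))"
  by (auto simp: literal_at_def)

text \<open>From a cover the value of a variable is read at leaf 12 of its gadget, and alternation
  transfers it to the leaves used by clauses. Conversely \<open>cover_value\<close> fills the
  gadgets according to an assignment.\<close>

lemma cover_sat_graph:
  assumes "good_cnf ts"
  shows "(\<exists>C. vertex_cover (set (sat_vertices ts)) (endpoints ` set (sat_edges ts)) C \<and>
      two_checkered (endpoints ` set (sat_edges ts)) C) \<longleftrightarrow> satisfiable (clause_list ts)"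
proof
  let ?V = "set (sat_vertices ts)" and ?E = "endpoints ` set (sat_edges ts)"
  have shape: "cnf_shape ts" using assms by (simp add: good_cnf_def)
  {
    assume "\<exists>C. vertex_cover ?V ?E C \<and> two_checkered ?E C"
    then obtain C where C: "vertex_cover ?V ?E C" "two_checkered ?E C" by blast
    \<comment> \<open>The end on the ring has degree 3, so the edge is no grip and cannot lie within
      C; being covered, it has exactly one end in C.\<close>
    have alt: "tag a x \<in> C \<longleftrightarrow> tag b x \<notin> C" if x: "x \<in> variables ts" and ab: "(a, b) \<in> set gadget" for a b x
    proof -
      have e: "{tag a x, tag b x} \<in> ?E" unfolding endpoints_sat_edges using that by blast
      have a: "a < 12" "b < 24" using gadget_range[OF ab] by auto
      then have "\<not> grip ?E {tag a x, tag b x}"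
        using degree_sat_graph(1)[OF assms x, of a] by (simp add: grip_def)
      moreover have 1: "\<forall>e\<in>?E. \<exists>v\<in>e. v \<in> C" using C(1) unfolding vertex_cover_def by (elim conjE)
      have 2: "\<forall>e\<in>?E. e \<subseteq> C \<longrightarrow> grip ?E e" using C(2) unfolding two_checkered_def .
      from bspec[OF 1 e] bspec[OF 2 e]
      have "tag a x \<in> C \<or> tag b x \<in> C" "{tag a x, tag b x} \<subseteq> C \<longrightarrow> grip ?E {tag a x, tag b x}"
        by simp_all
      ultimately show ?thesis by (simp only: insert_subset) blast
    qed
    define \<sigma> where "\<sigma> = (\<lambda>x. tag 12 x \<in> C)"
    have leaf: "leaf ts b j \<in> C \<longleftrightarrow> lit_true \<sigma> (literal_at ts j)"
      if j: "j \<in> occs literal_marks ts" "b < 2" for b j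
    proof -
      have s: "slot literal_marks ts j < 3" using assms j by (simp add: good_cnf_def)
      have x: "snd (ts ! j) \<in> variables ts" using j by (auto simp: variables_def)
      have "leaf ts b j \<in> C \<longleftrightarrow> cover_value (tag 12 (snd (ts ! j)) \<in> C) (leaf_number ts b j)"
        unfolding leaf_def using alt[OF x] leaf_number_bounds[OF s j(2)]
        by (intro gadget_alternates[of "\<lambda>k. tag k (snd (ts ! j)) \<in> C"]) auto
      then show ?thesis
        using leaf_number_bounds[OF s j(2)]
        by (auto simp: cover_value_def lit_true_literal_at \<sigma>_def even_leaf_number)
    qed
    have "lit_true \<sigma> (literal_at ts (Suc i)) \<or> binary_at ts i \<and> lit_true \<sigma> (literal_at ts (Suc (Suc i)))"
      if i: "i \<in> occs {FClause} ts" for i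
    proof -
      have "endpoints (clause_edge ts i) \<in> ?E" unfolding endpoints_sat_edges using i by blast
      moreover have "\<forall>e\<in>?E. \<exists>v\<in>e. v \<in> C" using C(1) unfolding vertex_cover_def by (elim conjE)
      ultimately have "\<exists>v\<in>endpoints (clause_edge ts i). v \<in> C" by (rule bspec[rotated])
      then have "fst (clause_edge ts i) \<in> C \<or> snd (clause_edge ts i) \<in> C" by (auto simp: split_beta)
      then show ?thesis
        using clause_literals[OF shape i] leaf by (auto simp: clause_edge_def split: if_splits)
    qed
    then show "satisfiable (clause_list ts)" unfolding satisfiable_clause_list by blast
  next
    assume "satisfiable (clause_list ts)"
    then obtain \<sigma> where \<sigma>: "\<And>i. i \<in> occs {FClause} ts \<Longrightarrow> lit_true \<sigma> (literal_at ts (Suc i)) \<or>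
        binary_at ts i \<and> lit_true \<sigma> (literal_at ts (Suc (Suc i)))"
      unfolding satisfiable_clause_list by blast
    define C where "C = {tag k x |k x. x \<in> variables ts \<and> k < 24 \<and> cover_value (\<sigma> x) k}"
    have C: "tag k x \<in> C \<longleftrightarrow> cover_value (\<sigma> x) k" if "x \<in> variables ts" "k < 24" for k x
      using that by (auto simp: C_def)
    have leaf: "leaf ts b j \<in> C \<longleftrightarrow> lit_true \<sigma> (literal_at ts j)"
      if j: "j \<in> occs literal_marks ts" "b < 2" for b j
    proof -
      have s: "slot literal_marks ts j < 3" using assms j by (simp add: good_cnf_def)
      have x: "snd (ts ! j) \<in> variables ts" using j by (auto simp: variables_def)
      show ?thesis
        using leaf_number_bounds[OF s j(2)] C[OF x]
        by (auto simp: leaf_def cover_value_def lit_true_literal_at even_leaf_number)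
    qed
    have gadget: "tag a x \<in> C \<longleftrightarrow> tag b x \<notin> C" if "x \<in> variables ts" "(a, b) \<in> set gadget" for a b x
      using gadget_range[OF that(2)] gadget_value[OF that(2), of "\<sigma> x"] C[OF that(1)] by auto
    have clause: "fst (clause_edge ts i) \<in> C \<or> snd (clause_edge ts i) \<in> C" if i: "i \<in> occs {FClause} ts" for i
      using \<sigma>[OF i] clause_literals[OF shape i] leaf by (auto simp: clause_edge_def)
    have "vertex_cover ?V ?E C"
      unfolding vertex_cover_def
    proof (intro conjI ballI)
      show "C \<subseteq> ?V" unfolding set_sat_vertices C_def by blast
      fix e assume "e \<in> ?E"
      then consider a b x where "e = {tag a x, tag b x}" "x \<in> variables ts" "(a, b) \<in> set gadget"
        | i where "e = endpoints (clause_edge ts i)" "i \<in> occs {FClause} ts"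
        unfolding endpoints_sat_edges by blast
      then show "\<exists>v\<in>e. v \<in> C"
      proof cases
        case 1
        then show ?thesis using gadget by auto
      next
        case 2
        then show ?thesis using clause[OF 2(2)] by (auto simp: split_beta)
      qed
    qed
    moreover have "two_checkered ?E C"
      unfolding two_checkered_def
    proof (intro ballI impI)
      fix e assume e: "e \<in> ?E" "e \<subseteq> C"
      then consider a b x where "e = {tag a x, tag b x}" "x \<in> variables ts" "(a, b) \<in> set gadget"
        | i where "e = endpoints (clause_edge ts i)" "i \<in> occs {FClause} ts"
        unfolding endpoints_sat_edges by blast
      then show "grip ?E e"
      proof cases
        case 1
        then show ?thesis using gadget e(2) by auto
      next
        case 2
        \<comment> \<open>Both ends of a clause edge may be in C, when both literals are true. This
          is allowed because both ends are leaves of degree at most 2, which makes the edge a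
          grip.\<close>
        have "degree ?E v \<le> 2" if "v \<in> e" for v
        proof -
          have "v \<in> endpoints (clause_edge ts i)" using that unfolding 2(1) .
          from clause_edge_vertex[OF assms 2(2) this] obtain k x
            where "v = tag k x" "x \<in> variables ts" "12 \<le> k" "k < 24" by blast
          then show ?thesis using degree_sat_graph(2)[OF assms, of x k] by (simp only:)
        qed
        then show ?thesis using e(1) by (simp add: grip_def)
      qed
    qed
    ultimately show "\<exists>C. vertex_cover ?V ?E C \<and> two_checkered ?E C" by blast
  }
qed

text \<open>A gadget has 24 vertices and 24 edges. Each clause has a first literal, so there are at
  most as many clause edges as literal occurrences, that is three per variable; this gives
  27.\<close>

lemma card_sat_graph:
  assumes "good_cnf ts"
  shows "card (set (sat_vertices ts)) \<le> 24 * card (variables ts)"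
    and "card (endpoints ` set (sat_edges ts)) \<le> 27 * card (variables ts)"
proof -
  have shape: "cnf_shape ts" using assms by (simp add: good_cnf_def)
  have fin: "finite (variables ts)" by (simp add: variables_def finite_occs)
  have "set (sat_vertices ts) = (\<lambda>(k, x). tag k x) ` ({..<24} \<times> variables ts)"
    unfolding set_sat_vertices by (auto simp: image_iff)
  then have "card (set (sat_vertices ts)) \<le> card ({..<24 :: nat} \<times> variables ts)"
    using card_image_le[of "{..<24 :: nat} \<times> variables ts" "\<lambda>(k, x). tag k x"] fin by simp
  then show "card (set (sat_vertices ts)) \<le> 24 * card (variables ts)" by (simp add: card_cartesian_product)
  have G: "card {{tag a x, tag b x} |a b x. x \<in> variables ts \<and> (a, b) \<in> set gadget} \<le> 24 * card (variables ts)"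
  proof -
    have "{{tag a x, tag b x} |a b x. x \<in> variables ts \<and> (a, b) \<in> set gadget} =
        (\<lambda>((a, b), x). {tag a x, tag b x}) ` (set gadget \<times> variables ts)"
    proof (intro equalityI subsetI)
      fix e assume "e \<in> {{tag a x, tag b x} |a b x. x \<in> variables ts \<and> (a, b) \<in> set gadget}"
      then obtain a b x where "e = {tag a x, tag b x}" "x \<in> variables ts" "(a, b) \<in> set gadget" by blast
      then show "e \<in> (\<lambda>((a, b), x). {tag a x, tag b x}) ` (set gadget \<times> variables ts)"
        by (intro image_eqI[of _ _ "((a, b), x)"]) auto
    next
      fix e assume "e \<in> (\<lambda>((a, b), x). {tag a x, tag b x}) ` (set gadget \<times> variables ts)"
      then obtain p where "p \<in> set gadget \<times> variables ts" "e = (\<lambda>((a, b), x). {tag a x, tag b x}) p" ..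
      then obtain a b x where "e = {tag a x, tag b x}" "x \<in> variables ts" "(a, b) \<in> set gadget"
        by (cases p, cases "fst p") simp
      then show "e \<in> {{tag a x, tag b x} |a b x. x \<in> variables ts \<and> (a, b) \<in> set gadget}" by blast
    qed
    then have "card {{tag a x, tag b x} |a b x. x \<in> variables ts \<and> (a, b) \<in> set gadget} \<le>
        card (set gadget \<times> variables ts)"
      using card_image_le[of "set gadget \<times> variables ts" "\<lambda>((a, b), x). {tag a x, tag b x}"] fin by simp
    moreover have "card (set gadget) \<le> 24" using card_length[of gadget] by (simp add: gadget_def)
    ultimately show ?thesis by (simp add: card_cartesian_product) (meson le_trans mult_le_mono1)
  qed
  have "card ((\<lambda>i. endpoints (clause_edge ts i)) ` occs {FClause} ts) \<le> card (occs {FClause} ts)"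
    by (rule card_image_le) (rule finite_occs)
  also have "\<dots> = card (Suc ` occs {FClause} ts)" by (simp add: card_image)
  also have "\<dots> \<le> card (occs literal_marks ts)"
    by (rule card_mono) (use clause_literals(1)[OF shape] in \<open>auto simp: finite_occs\<close>)
  also have "\<dots> \<le> card (variables ts \<times> {..<3 :: nat})"
  proof (rule card_inj_on_le)
    show "inj_on (\<lambda>t. (snd (ts ! t), slot literal_marks ts t)) (occs literal_marks ts)"
    proof (rule inj_onI)
      fix s t assume "s \<in> occs literal_marks ts" "t \<in> occs literal_marks ts"
        "(snd (ts ! s), slot literal_marks ts s) = (snd (ts ! t), slot literal_marks ts t)"
      then show "s = t" using slot_inj[of s literal_marks ts t] by simp
    qed
    show "(\<lambda>t. (snd (ts ! t), slot literal_marks ts t)) ` occs literal_marks ts \<subseteq> variables ts \<times> {..<3}"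
      using assms by (auto simp: good_cnf_def variables_def)
  qed (use fin in simp)
  finally have K: "card ((\<lambda>i. endpoints (clause_edge ts i)) ` occs {FClause} ts) \<le> 3 * card (variables ts)"
    by (simp add: card_cartesian_product)
  show "card (endpoints ` set (sat_edges ts)) \<le> 27 * card (variables ts)"
    unfolding endpoints_sat_edges by (rule le_trans[OF card_Un_le]) (use G K in linarith)
qed

section \<open>Printing the graph of a formula\<close>

definition print_tagged :: "gsym \<Rightarrow> nat \<Rightarrow> nat \<Rightarrow> (fsym, gsym) printer" where
  "print_tagged a k i = Then (Out (a # map GBit (tag k []))) (Name i)"

lemma printed_print_tagged:
  "FG.printed ts e (print_tagged a k i) = a # map GBit (tag k (snd (ts ! e i)))"
  by (simp add: print_tagged_def tag_def)

text \<open>The six numbers possible for fixed b are emitted as constants, selected by rank and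
  polarity. The auxiliary variables start at 3 because 0, 1 and 2 may be bound around it.\<close>

definition print_leaf :: "gsym \<Rightarrow> nat \<Rightarrow> nat \<Rightarrow> (fsym, gsym) printer" where
  "print_leaf a b i = FG.by_slot literal_marks i 3 (\<lambda>s. Ite (Mark {FPos} i)
     (print_tagged a (12 + 4 * s + 0 + 2 * b) i) (print_tagged a (12 + 4 * s + 1 + 2 * b) i))"

lemma printed_print_leaf:
  assumes "good_cnf ts" "e i \<in> occs literal_marks ts" "i < 3"
  shows "FG.printed ts e (print_leaf a b i) = a # map GBit (leaf ts b (e i))"
proof -
  have "slot literal_marks ts (e i) < 3" "e i < length ts"
    using assms by (auto simp: good_cnf_def occs_def)
  then show ?thesis
    using assms(3) unfolding print_leaf_def
    by (simp add: FG.printed_by_slot printed_print_tagged leaf_def leaf_number_def)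
qed

definition sat_printer :: "(fsym, gsym) printer" where
  "sat_printer = Ite good_cnf_fm
     (FG.series
       [FG.for_firsts literal_marks (FG.series (map (\<lambda>k. print_tagged GVertex k 0) [0..<24])),
        FG.for_firsts literal_marks (FG.series
          (map (\<lambda>(a, b). Then (print_tagged GEdge a 0) (print_tagged GSep b 0)) gadget)),
        FG.for_pairs {FClause} (Ite (Exi 2 (An (adjacent 1 2 3) (Mark literal_marks 2)))
          (For 2 (Ite (adjacent 1 2 3) (Then (print_leaf GEdge 0 1) (print_leaf GSep 0 2)) (Out [])))
          (Then (print_leaf GEdge 0 1) (print_leaf GSep 1 1)))])
     (Out [GSep])"

lemma scoped_sat_printer: "scoped_printer {} sat_printer"
  unfolding sat_printer_def
  by (auto simp: scoped_good_cnf_fm FG.scoped_for_firsts FG.scoped_for_pairs FG.scoped_series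
      FG.scoped_by_slot print_leaf_def print_tagged_def)

lemma FG_printed_for_clauses:
  assumes "cnf_shape ts"
  shows "FG.printed ts e (FG.for_pairs {FClause} P) =
    concat (map (\<lambda>i. FG.printed ts (e(0 := i, 1 := Suc i)) P) (clause_indices ts))"
  unfolding clause_indices_def
  by (rule FG.printed_for_pairs) (use cnf_shape_D1[OF assms] in auto)

lemma printed_sat_printer:
  "FG.printed ts e sat_printer =
    (if good_cnf ts then graph_word (sat_vertices ts) (sat_edges ts) else [GSep])"
proof (cases "good_cnf ts")
  case True
  then have shape: "cnf_shape ts" by (simp add: good_cnf_def)
  let ?P = "Ite (Exi 2 (An (adjacent 1 2 3) (Mark literal_marks 2)))
          (For 2 (Ite (adjacent 1 2 3) (Then (print_leaf GEdge 0 1) (print_leaf GSep 0 2)) (Out [])))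
          (Then (print_leaf GEdge 0 1) (print_leaf GSep 1 1))"
  have 1: "FG.printed ts (e(0 := i, 1 := Suc i)) ?P = edge_word (clause_edge ts i)"
    if i: "i \<in> occs {FClause} ts" for i
  proof -
    let ?e = "e(0 := i, 1 := Suc i)"
    have len: "Suc i < length ts" using clause_literals(1)[OF shape i] by (simp add: occs_def)
    have adj: "sat ts (?e(2 := j)) (adjacent 1 2 3) \<longleftrightarrow> j = Suc (Suc i)" if "j < length ts" for j
      by (subst sat_adjacent) (use that len in auto)
    have two: "sat ts ?e (Exi 2 (An (adjacent 1 2 3) (Mark literal_marks 2))) \<longleftrightarrow> binary_at ts i"
    proof -
      have "sat ts ?e (Exi 2 (An (adjacent 1 2 3) (Mark literal_marks 2))) \<longleftrightarrow>
          (\<exists>j<length ts. j = Suc (Suc i) \<and> fst (ts ! j) \<in> literal_marks)"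
        unfolding sat.simps using adj by (auto simp del: insert_iff)
      then show ?thesis by (auto simp: binary_at_def)
    qed
    show ?thesis
    proof (cases "binary_at ts i")
      case True
      have "FG.printed ts ?e (For 2 (Ite (adjacent 1 2 3) (Then (print_leaf GEdge 0 1) (print_leaf GSep 0 2)) (Out []))) =
          concat (map (\<lambda>j. if j = Suc (Suc i) then FG.printed ts (?e(2 := j))
            (Then (print_leaf GEdge 0 1) (print_leaf GSep 0 2)) else []) [0..<length ts])"
        unfolding FG.printed.simps by (intro arg_cong[of _ _ concat] map_cong) (use adj in auto)
      also have "\<dots> = FG.printed ts (?e(2 := Suc (Suc i))) (Then (print_leaf GEdge 0 1) (print_leaf GSep 0 2))"
        using True unfolding concat_eq_index by (simp add: binary_at_def)
      also have "\<dots> = edge_word (clause_edge ts i)"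
        using printed_print_leaf[OF \<open>good_cnf ts\<close>, of "?e(2 := Suc (Suc i))" 1 GEdge 0]
          printed_print_leaf[OF \<open>good_cnf ts\<close>, of "?e(2 := Suc (Suc i))" 2 GSep 0]
          clause_literals(1)[OF shape i] clause_literals(2)[OF shape i True] True
        by (simp add: clause_edge_def edge_word_def)
      finally show ?thesis using two True by simp
    next
      case False
      then show ?thesis
        using two printed_print_leaf[OF \<open>good_cnf ts\<close>, of ?e 1 GEdge 0]
          printed_print_leaf[OF \<open>good_cnf ts\<close>, of ?e 1 GSep 1] clause_literals(1)[OF shape i]
        by (simp add: clause_edge_def edge_word_def del: sat.simps)
    qed
  qed
  have 2: "FG.printed ts (e(0 := t)) (FG.series (map (\<lambda>k. print_tagged GVertex k 0) [0..<24])) =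
      concat (map vertex_word (map (\<lambda>k. tag k (snd (ts ! t))) [0..<24]))" for t
    by (simp add: FG.printed_series printed_print_tagged vertex_word_def[abs_def] o_def)
  have 3: "FG.printed ts (e(0 := t)) (FG.series
      (map (\<lambda>(a, b). Then (print_tagged GEdge a 0) (print_tagged GSep b 0)) gadget)) =
      concat (map edge_word (gadget_edges (snd (ts ! t))))" for t
    by (simp add: FG.printed_series printed_print_tagged gadget_edges_def edge_word_def[abs_def] o_def split_beta)
  have 4: "map (\<lambda>i. FG.printed ts (e(0 := i, 1 := Suc i)) ?P) (clause_indices ts) =
      map (\<lambda>i. edge_word (clause_edge ts i)) (clause_indices ts)"
    by (rule map_cong[OF refl]) (use 1 in \<open>simp only: set_clause_indices\<close>)
  have concat_words: "concat (map f (concat (map g xs))) = concat (map (\<lambda>x. concat (map f (g x))) xs)" for f g xs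
    by (induction xs) auto
  define P where "P = ?P"
  have "FG.printed ts e sat_printer =
      FG.printed ts e (FG.for_firsts literal_marks (FG.series (map (\<lambda>k. print_tagged GVertex k 0) [0..<24]))) @
      FG.printed ts e (FG.for_firsts literal_marks (FG.series
        (map (\<lambda>(a, b). Then (print_tagged GEdge a 0) (print_tagged GSep b 0)) gadget))) @
      FG.printed ts e (FG.for_pairs {FClause} P)"
    using True unfolding sat_printer_def P_def[symmetric]
    by (simp only: FG.printed.simps(3) sat_good_cnf_fm if_True FG.printed_series list.map concat.simps append_Nil2)
  then have "FG.printed ts e sat_printer =
     concat (map (\<lambda>t. concat (map vertex_word (map (\<lambda>k. tag k (snd (ts ! t))) [0..<24]))) (firsts literal_marks ts)) @
     concat (map (\<lambda>t. concat (map edge_word (gadget_edges (snd (ts ! t))))) (firsts literal_marks ts)) @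
     concat (map (\<lambda>i. edge_word (clause_edge ts i)) (clause_indices ts))"
    unfolding FG.printed_for_firsts 2 3 FG_printed_for_clauses[OF shape] 4[folded P_def] .
  then show ?thesis
    using True unfolding graph_word_def sat_vertices_def sat_edges_def map_append concat_append concat_words
    by (simp add: o_def)
next
  case False
  then show ?thesis by (simp add: sat_printer_def sat_good_cnf_fm)
qed

lemma sat_printer_correct:
  assumes "FG.marked ts"
  shows "FG.word ts \<in> TwoSAT3 \<longleftrightarrow> FG.printed ts e sat_printer \<in> TwoCVC3"
proof (cases "good_cnf ts")
  case True
  have "degree (endpoints ` set (sat_edges ts)) v \<le> 3" if "v \<in> set (sat_vertices ts)" for v
  proof -
    obtain k x where "v = tag k x" "x \<in> variables ts" "k < 24" using \<open>v \<in> set (sat_vertices ts)\<close>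
      unfolding set_sat_vertices by blast
    then show ?thesis using degree_sat_graph[OF True, of x k] by (cases "k < 12") auto
  qed
  then show ?thesis
    using True TwoSAT3_word_iff[OF assms] TwoCVC3_encodes[OF sat_graph_encodes[OF True]] cover_sat_graph[OF True]
    by (simp add: printed_sat_printer)
next
  case False
  then show ?thesis
    using TwoSAT3_word_iff[OF assms] not_graph_word(1)[of "[GSep]"] by (simp add: printed_sat_printer)
qed

lemma sat_printer_sizes:
  assumes "FG.marked ts"
  shows "m_ver (FG.printed ts e sat_printer) \<le> 27 * m_vbl (FG.word ts) + 1"
    and "m_edg (FG.printed ts e sat_printer) \<le> 27 * m_vbl (FG.word ts) + 1"
proof -
  have "m_ver (FG.printed ts e sat_printer) \<le> 27 * m_vbl (FG.word ts) + 1 \<and>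
      m_edg (FG.printed ts e sat_printer) \<le> 27 * m_vbl (FG.word ts) + 1"
  proof (cases "good_cnf ts")
    case True
    then have shape: "cnf_shape ts" by (simp add: good_cnf_def)
    have "m_vbl (FG.word ts) = card (variables ts)"
      using m_vbl_eq[of "FG.word ts" "clause_list ts"] shape encodes_2cnf_word[OF assms]
        cnf_vars_clause_list[OF assms shape] by (simp add: variables_def)
    moreover have "m_ver (FG.printed ts e sat_printer) = card (set (sat_vertices ts))"
      "m_edg (FG.printed ts e sat_printer) = card (endpoints ` set (sat_edges ts))"
      using m_ver_eq m_edg_eq sat_graph_encodes[OF True] True by (auto simp: printed_sat_printer)
    ultimately show ?thesis using card_sat_graph[OF True] by simp
  next
    case False
    then show ?thesis using not_graph_word[of "[GSep]"] by (simp add: printed_sat_printer)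
  qed
  then show "m_ver (FG.printed ts e sat_printer) \<le> 27 * m_vbl (FG.word ts) + 1"
    "m_edg (FG.printed ts e sat_printer) \<le> 27 * m_vbl (FG.word ts) + 1" by auto
qed

lemma TwoSAT3_le_TwoCVC3:
  "(TwoSAT3, m_vbl) \<le>\<^sub>s\<^sub>L (TwoCVC3, m_edg)" "(TwoSAT3, m_vbl) \<le>\<^sub>s\<^sub>L (TwoCVC3, m_ver)"
  by (rule FG.reducible_by_printer[OF scoped_sat_printer, where k = 27 and bad = "[GSep]"];
      use sat_printer_correct sat_printer_sizes not_graph_word not_cnf_word in auto)+

theorem theorem3p1:
  "(TwoCVC3, m_ver) \<equiv>\<^sub>s\<^sub>L (TwoCVC3, m_edg) \<and>
   (TwoCVC3, m_edg) \<equiv>\<^sub>s\<^sub>L (TwoSAT3, m_vbl) \<and>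
   (TwoCVC3, m_ver) \<equiv>\<^sub>s\<^sub>L (TwoSAT3, m_vbl)"
  using TwoCVC3_ver_edg TwoCVC3_le_TwoSAT3 TwoSAT3_le_TwoCVC3 unfolding sL_equivalent_def by blast

end
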